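(* Let $\overline{\mu}\in\mathcal{P}(L^2_x)$ be initial data for the incompressible Euler equations such that there exists $M>0$ with $\overline\mu(B_M(0))=1$, where $B_M(0)=\{u\in L^2_x : \|u\|_{L^2_x}<M\}$. For $\Delta=1/N$, $N\in\mathbb{N}$, let $\mu^\Delta_t$, $t\in[0,T]$, be obtained from the spectral viscosity scheme with Monte-Carlo sampling (SV+MC). If there exist constants $\bar C>0$ and $0<\alpha<1$ such that $$\sup_{t\in[0,T]}S_2(\mu^\Delta_t;r)\le \bar C\,r^\alpha\qquad\text{for all }\Delta,\ \text{and all } r>0,$$ then, up to a subsequence, $\mu^\Delta_t\to\mu_t$ in $L^1_t(\mathcal{P})$, i.e. there exist a subsequence $\Delta_k\to0$ and $\mu_t\in\mathcal{P}(L^2_x)$ such that $$\int_0^T W_1(\mu^{\Delta_k}_t,\mu_t)\,dt\to0\qquad(k\to\infty),$$ and $\mu_t$ is energy conservative, in the sense that $t\mapsto\int_{L^2_x}\|u\|_{L^2_x}^2\,d\mu_t(u)$ is constant (for almost every $t\in[0,T]$).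
   Context: The domain is the two-dimensional torus $D=\mathbb{T}^2$ (period $2\pi$), $T>0$ is fixed, $L^2_x:=L^2(\mathbb{T}^2;\mathbb{R}^2)$, $\mathcal{P}(L^2_x)$ is the set of Borel probability measures on $L^2_x$, and $W_1$ is the $1$-Wasserstein metric for probability measures on $L^2_x$. Initial data are assumed divergence-free and of zero mean (vanishing $0$-th Fourier coefficient); $\overline\mu$ is concentrated on such fields. Spectral viscosity (SV) scheme at resolution $\Delta=1/N$: write $u_N(x,t)=\sum_{|k|_\infty\le N}\widehat u_k(t)e^{ik\cdot x}$, $|k|_\infty=\max(|k_1|,|k_2|)$, and solve $$\partial_t u_N+P_N(u_N\cdot\nabla u_N)+\nabla p_N=\epsilon_N\Delta(Q_N*u_N),\quad \mathrm{div}(u_N)=0,\quad u_N|_{t=0}=\overline u_N,$$ where in this equation $\Delta$ denotes the Laplacian, $P_N f=\sum_{|k|_\infty\le N}\widehat f_k e^{ik\cdot x}$ is the Fourier projection, $\overline u_N$ is a divergence-free, mean-zero discretized approximation (supported on Fourier modes $|k|_\infty\le N$) of the given initial data $\overline u\in L^2_x$ with $\overline u_N\to\overline u$ strongly in $L^2_x$ as $N\to\infty$, and $Q_N*$ is the Fourier multiplier with coefficients $\widehat Q_k$ satisfying $0\le\widehat Q_k\le1$, $\widehat Q_k=0$ for $|k|\le m_N$ and $\widehat Q_k=1$ for $|k|>2m_N$. The parameters are $\epsilon_N=\epsilon/N$ with fixed $\epsilon>0$, and $m_N$ chosen so that $\epsilon_N m_N\to0$ and $\sup_N\epsilon_N m_N^2<\infty$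 (e.g. $m_N=\sqrt N$). Let $S^\Delta_t$, $\Delta=1/N$, denote the map sending initial data to the solution of this scheme at time $t$. Monte-Carlo sampling (SV+MC): with a number of samples $K=K(N)\to\infty$ as $N\to\infty$, draw i.i.d. samples from $\overline\mu$ and let $\overline v^\Delta_1,\dots,\overline v^\Delta_K$ denote the sampled initial fields, $\overline\mu^\Delta:=\frac1K\sum_{i=1}^K\delta_{\overline v^\Delta_i}$, and set $$\mu^\Delta_t:=(S^\Delta_t)_\#\overline\mu^\Delta=\frac1K\sum_{i=1}^K\delta_{v^\Delta_i(t)},\qquad v^\Delta_i(t)=S^\Delta_t\overline v^\Delta_i .$$ The discretized samples $v^\Delta_i(0)$ lie in $B_M(0)$, and a realisation of the samples is fixed for which $\mu^\Delta_0$ converges weakly to $\overline\mu$ as $\Delta\to0$. Structure function of a measure: for $\mu\in\mathcal{P}(L^2_x)$ and $r>0$, $$S_2(\mu;r):=\Big(\int_{L^2_x}\int_D\frac{1}{|B_r(0)|}\int_{B_r(0)}|u(x+h)-u(x)|^2\,dh\,dx\,d\mu(u)\Big)^{1/2}.$$ *)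

theory Defs
  imports "HOL-Probability.Probability"
begin

section \<open>The space of square-integrable vector fields on the torus\<close>

text \<open>
  Functions on the torus are functions on the plane that are \<open>2 * pi\<close>-periodic in each coordinate;
  the torus with its (unnormalised) Lebesgue measure is a fundamental domain.
\<close>

definition torus :: "(real^2) measure" where
  "torus = restrict_space lborel (cbox 0 (\<chi> i. 2 * pi))"

definition periodic :: "(real^2 \<Rightarrow> 'b) \<Rightarrow> bool" where
  "periodic f \<longleftrightarrow> (\<forall>x i. f (x + axis i (2 * pi)) = f x)"

definition square_integrable :: "(real^2 \<Rightarrow> real^2) \<Rightarrow> bool" where
  "square_integrable f \<longleftrightarrow> f \<in> borel_measurable borel \<and> periodic f \<and> integrable torus (\<lambda>x. (norm (f x))\<^sup>2)"

definition ae_equal :: "(real^2 \<Rightarrow> real^2) \<Rightarrow> (real^2 \<Rightarrow> real^2) \<Rightarrow> bool" where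
  "ae_equal f g \<longleftrightarrow> square_integrable f \<and> square_integrable g \<and> (AE x in lborel. f x = g x)"

lemma space_torus: "space torus = cbox 0 (\<chi> i. 2 * pi)"
  by (simp add: torus_def space_restrict_space)

lemma measurable_torus: "f \<in> borel_measurable borel \<Longrightarrow> f \<in> borel_measurable torus"
  unfolding torus_def by (intro measurable_restrict_space1) simp

lemma square_integrable_zero: "square_integrable (\<lambda>x. 0)"
  by (simp add: square_integrable_def periodic_def)

lemma AE_torusI: "AE x in lborel. P x \<Longrightarrow> AE x in torus. P x"
  unfolding torus_def by (subst AE_restrict_space_iff) auto

lemma square_integrable_inner:
  assumes "square_integrable f" "square_integrable g"
  shows "integrable torus (\<lambda>x. f x \<bullet> g x)"
proof (rule Bochner_Integration.integrable_bound)
  show "integrable torus (\<lambda>x. (norm (f x))\<^sup>2 + (norm (g x))\<^sup>2)"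
    using assms by (auto simp: square_integrable_def)
  show "(\<lambda>x. f x \<bullet> g x) \<in> borel_measurable torus"
    using assms by (intro borel_measurable_inner measurable_torus) (auto simp: square_integrable_def)
  have "\<bar>a \<bullet> b\<bar> \<le> (norm a)\<^sup>2 + (norm b)\<^sup>2" for a b :: "real^2"
  proof -
    have "\<bar>a \<bullet> b\<bar> \<le> norm a * norm b" by (rule Cauchy_Schwarz_ineq2)
    also have "\<dots> \<le> (norm a)\<^sup>2 + (norm b)\<^sup>2"
      using sum_squares_bound[of "norm a" "norm b"] mult_nonneg_nonneg[OF norm_ge_zero[of a] norm_ge_zero[of b]]
      by linarith
    finally show ?thesis .
  qed
  then show "AE x in torus. norm (f x \<bullet> g x) \<le> norm ((norm (f x))\<^sup>2 + (norm (g x))\<^sup>2)"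
    by simp
qed

lemma square_integrable_add:
  assumes "square_integrable f" "square_integrable g"
  shows "square_integrable (\<lambda>x. f x + g x)"
proof -
  have "integrable torus (\<lambda>x. (f x \<bullet> f x + f x \<bullet> g x) + (g x \<bullet> f x + g x \<bullet> g x))"
    using assms by (intro Bochner_Integration.integrable_add square_integrable_inner)
  also have "(\<lambda>x. (f x \<bullet> f x + f x \<bullet> g x) + (g x \<bullet> f x + g x \<bullet> g x)) = (\<lambda>x. (norm (f x + g x))\<^sup>2)"
    by (simp add: power2_norm_eq_inner inner_add_left inner_add_right algebra_simps)
  finally show ?thesis
    using assms by (auto simp: square_integrable_def periodic_def)
qed

lemma square_integrable_scaleR:
  "square_integrable f \<Longrightarrow> square_integrable (\<lambda>x. c *\<^sub>R f x)"
  by (auto simp: square_integrable_def periodic_def power_mult_distrib)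

lemma square_integrable_uminus:
  "square_integrable f \<Longrightarrow> square_integrable (\<lambda>x. - f x)"
  using square_integrable_scaleR[of f "-1"] by simp

lemma square_integrable_diff:
  "square_integrable f \<Longrightarrow> square_integrable g \<Longrightarrow> square_integrable (\<lambda>x. f x - g x)"
  using square_integrable_add[OF _ square_integrable_uminus, of f g] by simp

lemma periodic_shift_int:
  assumes "periodic f"
  shows "f (x + axis i (2 * pi * of_int n)) = f x"
proof -
  have nat: "f (x + axis i (2 * pi * of_nat m)) = f x" for x m
  proof (induction m)
    case 0
    have "x + axis i (2 * pi * of_nat 0) = x" by (simp add: vec_eq_iff axis_def)
    then show ?case by (simp only:)
  next
    case (Suc m)
    have "x + axis i (2 * pi * of_nat (Suc m)) = (x + axis i (2 * pi * of_nat m)) + axis i (2 * pi)"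
      by (simp add: vec_eq_iff axis_def algebra_simps)
    then show ?case using Suc assms by (metis periodic_def)
  qed
  show ?thesis
  proof (cases "n \<ge> 0")
    case True
    then show ?thesis using nat[of x "nat n"] by simp
  next
    case False
    then have n: "real_of_int n = - real (nat (- n))" by simp
    have "f (x + axis i (2 * pi * of_int n)) =
        f ((x + axis i (2 * pi * of_int n)) + axis i (2 * pi * of_nat (nat (- n))))"
      by (rule nat[symmetric])
    also have "(x + axis i (2 * pi * of_int n)) + axis i (2 * pi * of_nat (nat (- n))) = x"
      unfolding n by (simp add: vec_eq_iff axis_def)
    finally show ?thesis .
  qed
qed

lemma periodic_shift:
  fixes k :: "int^2"
  assumes "periodic f"
  shows "f (x + (\<chi> i. 2 * pi * of_int (k $ i))) = f x"
proof -
  have "x + (\<chi> i. 2 * pi * of_int (k $ i)) =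
      (x + axis 1 (2 * pi * of_int (k $ 1))) + axis 2 (2 * pi * of_int (k $ 2))"
    by (simp add: vec_eq_iff axis_def forall_2)
  then show ?thesis by (simp only: periodic_shift_int[OF assms])
qed

lemma AE_periodic:
  assumes f: "periodic f" "f \<in> borel_measurable borel"
    and ae: "AE x in torus. f x = (0 :: real^2)"
  shows "AE x in lborel. f x = 0"
proof -
  let ?D = "cbox 0 (\<chi> i. 2 * pi) :: (real^2) set"
  let ?v = "\<lambda>k :: int^2. (\<chi> i. 2 * pi * of_int (k $ i)) :: real^2"
  have D: "AE x in lborel. x \<in> ?D \<longrightarrow> f x = 0"
    using ae unfolding torus_def by (subst (asm) AE_restrict_space_iff) auto
  have "AE x in lborel. ?v k + x \<in> ?D \<longrightarrow> f (?v k + x) = 0" for k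
  proof -
    have "AE x in distr lborel borel ((+) (?v k)). x \<in> ?D \<longrightarrow> f x = 0"
      using D unfolding lborel_distr_plus .
    moreover have "{x \<in> space borel. x \<in> ?D \<longrightarrow> f x = 0} \<in> sets borel"
      using f(2) by measurable
    ultimately show ?thesis by (subst (asm) AE_distr_iff) auto
  qed
  then have "AE x in lborel. \<forall>k. ?v k + x \<in> ?D \<longrightarrow> f (?v k + x) = 0"
    by (simp add: AE_all_countable)
  then show ?thesis
  proof (rule AE_mp, intro AE_I2 impI)
    fix x assume *: "\<forall>k. ?v k + x \<in> ?D \<longrightarrow> f (?v k + x) = 0"
    define k :: "int^2" where "k = (\<chi> i. - \<lfloor>x $ i / (2 * pi)\<rfloor>)"
    have "0 \<le> (?v k + x) $ i \<and> (?v k + x) $ i \<le> 2 * pi" for i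
    proof -
      have "2 * pi * of_int \<lfloor>x $ i / (2 * pi)\<rfloor> \<le> 2 * pi * (x $ i / (2 * pi))"
        by (intro mult_left_mono) auto
      moreover have "2 * pi * (x $ i / (2 * pi)) \<le> 2 * pi * (of_int \<lfloor>x $ i / (2 * pi)\<rfloor> + 1)"
        by (intro mult_left_mono) (linarith | simp)+
      ultimately show ?thesis by (simp add: k_def algebra_simps)
    qed
    then have "?v k + x \<in> ?D" by (simp add: mem_box_cart)
    with * have "f (?v k + x) = 0" by blast
    then show "f x = 0" using periodic_shift[OF f(1), of x k] by (simp add: add.commute)
  qed
qed

lemma part_equivp_ae_equal: "part_equivp ae_equal"
proof (rule part_equivpI)
  show "\<exists>f. ae_equal f f"
    using square_integrable_zero by (auto simp: ae_equal_def)
  show "symp ae_equal" by (auto simp: symp_def ae_equal_def eq_commute)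
  show "transp ae_equal" unfolding transp_def ae_equal_def
  proof (intro allI impI conjI; (elim conjE)?)
    fix f g h :: "real^2 \<Rightarrow> real^2"
    assume "AE x in lborel. f x = g x" "AE x in lborel. g x = h x"
    then show "AE x in lborel. f x = h x" by eventually_elim simp
  qed
qed

quotient_type L2x = "real^2 \<Rightarrow> real^2" / partial: ae_equal
  morphisms rep_L2x L2_class
  by (rule part_equivp_ae_equal)

instantiation L2x :: real_vector
begin

lift_definition zero_L2x :: L2x is "\<lambda>x. 0"
  by (simp add: ae_equal_def square_integrable_zero)

lift_definition plus_L2x :: "L2x \<Rightarrow> L2x \<Rightarrow> L2x" is "\<lambda>f g x. f x + g x"
  by (auto simp: ae_equal_def square_integrable_add)

lift_definition minus_L2x :: "L2x \<Rightarrow> L2x \<Rightarrow> L2x" is "\<lambda>f g x. f x - g x"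
  by (auto simp: ae_equal_def square_integrable_diff)

lift_definition uminus_L2x :: "L2x \<Rightarrow> L2x" is "\<lambda>f x. - f x"
  by (auto simp: ae_equal_def square_integrable_uminus)

lift_definition scaleR_L2x :: "real \<Rightarrow> L2x \<Rightarrow> L2x" is "\<lambda>c f x. c *\<^sub>R f x"
  by (auto simp: ae_equal_def square_integrable_scaleR)

instance
proof
  fix u v w :: L2x and a b :: real
  show "u + v + w = u + (v + w)"
    by transfer (auto simp: ae_equal_def square_integrable_add add.assoc)
  show "u + v = v + u"
    by transfer (auto simp: ae_equal_def square_integrable_add add.commute)
  show "0 + u = u"
    by transfer (auto simp: ae_equal_def)
  show "- u + u = 0"
    by transfer (auto simp: ae_equal_def square_integrable_zero)
  show "u - v = u + - v"
    by transfer (auto simp: ae_equal_def square_integrable_diff)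
  show "a *\<^sub>R (u + v) = a *\<^sub>R u + a *\<^sub>R v"
    by transfer (auto simp: ae_equal_def square_integrable_add square_integrable_scaleR scaleR_add_right)
  show "(a + b) *\<^sub>R u = a *\<^sub>R u + b *\<^sub>R u"
    by transfer (auto simp: ae_equal_def square_integrable_add square_integrable_scaleR
        scaleR_add_left[symmetric] simp del: scaleR_add_left)
  show "a *\<^sub>R b *\<^sub>R u = (a * b) *\<^sub>R u"
    by transfer (auto simp: ae_equal_def square_integrable_scaleR)
  show "1 *\<^sub>R u = u"
    by transfer (auto simp: ae_equal_def)
qed

end

instantiation L2x :: real_inner
begin

lift_definition inner_L2x :: "L2x \<Rightarrow> L2x \<Rightarrow> real" is "\<lambda>f g. LINT x|torus. f x \<bullet> g x"
proof -
  fix f f' g g' assume *: "ae_equal f f'" "ae_equal g g'"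
  then have "AE x in lborel. f x \<bullet> g x = f' x \<bullet> g' x"
    by (auto simp: ae_equal_def elim: eventually_elim2)
  then show "(LINT x|torus. f x \<bullet> g x) = (LINT x|torus. f' x \<bullet> g' x)"
    using * by (intro integral_cong_AE AE_torusI borel_measurable_inner measurable_torus)
      (auto simp: ae_equal_def square_integrable_def)
qed

definition norm_L2x :: "L2x \<Rightarrow> real" where "norm_L2x u = sqrt (u \<bullet> u)"

definition sgn_L2x :: "L2x \<Rightarrow> L2x" where "sgn_L2x u = u /\<^sub>R norm u"

definition dist_L2x :: "L2x \<Rightarrow> L2x \<Rightarrow> real" where "dist_L2x u v = norm (u - v)"

definition uniformity_L2x :: "(L2x \<times> L2x) filter" where
  "uniformity_L2x = (INF e\<in>{0<..}. principal {(x, y). dist x y < e})"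

definition open_L2x :: "L2x set \<Rightarrow> bool" where
  "open_L2x U \<longleftrightarrow> (\<forall>x\<in>U. eventually (\<lambda>(x', y). x' = x \<longrightarrow> y \<in> U) uniformity)"

instance
proof
  fix u v w :: L2x and a :: real
  show "u \<bullet> v = v \<bullet> u"
    by transfer (simp add: inner_commute)
  show "(u + v) \<bullet> w = u \<bullet> w + v \<bullet> w"
    by transfer (auto simp: ae_equal_def inner_add_left square_integrable_inner)
  show "(a *\<^sub>R u) \<bullet> v = a * (u \<bullet> v)"
    by transfer simp
  show "0 \<le> u \<bullet> u"
    by transfer simp
  show "u \<bullet> u = 0 \<longleftrightarrow> u = 0"
  proof transfer
    fix f assume "ae_equal f f"
    then have f: "square_integrable f" by (simp add: ae_equal_def)
    have "(LINT x|torus. f x \<bullet> f x) = 0 \<longleftrightarrow> (AE x in torus. f x \<bullet> f x = 0)"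
      by (intro integral_nonneg_eq_0_iff_AE square_integrable_inner f) auto
    also have "\<dots> \<longleftrightarrow> (AE x in torus. f x = 0)" by simp
    also have "\<dots> \<longleftrightarrow> (AE x in lborel. f x = 0)"
      using AE_periodic[of f] AE_torusI[of "\<lambda>x. f x = 0"] f by (auto simp: square_integrable_def)
    also have "\<dots> \<longleftrightarrow> ae_equal f (\<lambda>x. 0)"
      using f by (auto simp: ae_equal_def square_integrable_zero)
    finally show "((LINT x|torus. f x \<bullet> f x) = 0) = ae_equal f (\<lambda>x. 0)" .
  qed
qed (simp_all add: norm_L2x_def sgn_L2x_def dist_L2x_def uniformity_L2x_def open_L2x_def)

end


section \<open>Fourier modes\<close>

definition wave :: "int^2 \<Rightarrow> real^2" where
  "wave k = (\<chi> i. of_int (k $ i))"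

definition kmax :: "int^2 \<Rightarrow> int" where
  "kmax k = max \<bar>k $ 1\<bar> \<bar>k $ 2\<bar>"

definition fourier_coeff :: "(real^2 \<Rightarrow> real^2) \<Rightarrow> int^2 \<Rightarrow> complex^2" where
  "fourier_coeff f k =
    (\<chi> j. (LINT x|torus. of_real (f x $ j) * cis (- (wave k \<bullet> x))) / (2 * pi)\<^sup>2)"

text \<open>
  The trigonometric polynomial with coefficients \<open>a k * fourier_coeff f k\<close>, \<open>kmax k \<le> N\<close>.
  For an even real multiplier \<open>a\<close> (in particular for \<open>a = 1\<close>) the sum is real, so \<open>Re\<close> only
  changes the type; for a general \<open>a\<close> it amounts to replacing \<open>a k\<close> by \<open>(a k + a (- k)) / 2\<close>.
\<close>

definition fourier_mult :: "nat \<Rightarrow> (int^2 \<Rightarrow> real) \<Rightarrow> (real^2 \<Rightarrow> real^2) \<Rightarrow> real^2 \<Rightarrow> real^2" where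
  "fourier_mult N a f x =
    (\<chi> j. Re (\<Sum>k | kmax k \<le> int N. of_real (a k) * fourier_coeff f k $ j * cis (wave k \<bullet> x)))"

definition fourier_proj :: "nat \<Rightarrow> (real^2 \<Rightarrow> real^2) \<Rightarrow> real^2 \<Rightarrow> real^2" where
  "fourier_proj N = fourier_mult N (\<lambda>k. 1)"

lemma finite_kmax: "finite {k. kmax k \<le> n}"
proof (rule finite_subset)
  show "{k. kmax k \<le> n} \<subseteq> (\<lambda>(a, b). \<chi> i. if i = 1 then a else b) ` ({-n..n} \<times> {-n..n})"
  proof
    fix k :: "int^2" assume "k \<in> {k. kmax k \<le> n}"
    then have "(k $ 1, k $ 2) \<in> {-n..n} \<times> {-n..n}" by (auto simp: kmax_def)
    moreover have "k = (case (k $ 1, k $ 2) of (a, b) \<Rightarrow> \<chi> i. if i = 1 then a else b)"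
      by (simp add: vec_eq_iff forall_2)
    ultimately show "k \<in> (\<lambda>(a, b). \<chi> i. if i = 1 then a else b) ` ({-n..n} \<times> {-n..n})"
      by (rule rev_image_eqI)
  qed
qed simp

lift_definition fourier :: "L2x \<Rightarrow> int^2 \<Rightarrow> complex^2" is fourier_coeff
proof (rule ext)
  fix f g and k :: "int^2" assume *: "ae_equal f g"
  have "(LINT x|torus. complex_of_real (f x $ j) * cis (- (wave k \<bullet> x))) =
      (LINT x|torus. complex_of_real (g x $ j) * cis (- (wave k \<bullet> x)))" for j
  proof (rule integral_cong_AE)
    have cis: "(\<lambda>x. cis (- (wave k \<bullet> x))) \<in> borel_measurable borel"
      by (intro borel_measurable_continuous_onI continuous_intros)
    have comp: "(\<lambda>x. h x $ j) \<in> borel_measurable borel" if "h \<in> borel_measurable borel" for h :: "real^2 \<Rightarrow> real^2"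
      using measurable_compose[OF that, of "\<lambda>y. y $ j"]
      by (simp add: borel_measurable_continuous_onI continuous_on_component)
    have of_real: "(\<lambda>x. complex_of_real (h x)) \<in> borel_measurable borel"
      if "h \<in> borel_measurable borel" for h :: "real^2 \<Rightarrow> real"
      using that by measurable
    show "(\<lambda>x. complex_of_real (f x $ j) * cis (- (wave k \<bullet> x))) \<in> borel_measurable torus"
      "(\<lambda>x. complex_of_real (g x $ j) * cis (- (wave k \<bullet> x))) \<in> borel_measurable torus"
      by (intro measurable_torus borel_measurable_times cis of_real comp
          *[unfolded ae_equal_def square_integrable_def, THEN conjunct1, THEN conjunct1]
          *[unfolded ae_equal_def square_integrable_def, THEN conjunct2, THEN conjunct1, THEN conjunct1])+
    have "AE x in lborel. f x = g x" using * by (simp add: ae_equal_def)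
    then show "AE x in torus. complex_of_real (f x $ j) * cis (- (wave k \<bullet> x)) =
        complex_of_real (g x $ j) * cis (- (wave k \<bullet> x))"
      by (intro AE_torusI) (auto elim: eventually_mono)
  qed
  then show "fourier_coeff f k = fourier_coeff g k"
    by (simp add: fourier_coeff_def)
qed

definition band_limited :: "nat \<Rightarrow> L2x \<Rightarrow> bool" where
  "band_limited N u \<longleftrightarrow> (\<forall>k. kmax k > int N \<longrightarrow> fourier u k = 0)"

definition mean_zero :: "L2x \<Rightarrow> bool" where
  "mean_zero u \<longleftrightarrow> fourier u 0 = 0"

text \<open>Divergence in the sense of distributions, tested against periodic \<open>C\<^sup>1\<close> functions.\<close>

lift_definition divergence_free :: "L2x \<Rightarrow> bool" is
  "\<lambda>f. \<forall>\<phi> g. periodic \<phi> \<and> (\<forall>x. GDERIV \<phi> x :> g x) \<and> continuous_on UNIV g \<longrightarrow>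
     (LINT x|torus. f x \<bullet> g x) = 0"
proof -
  fix f f' :: "real^2 \<Rightarrow> real^2" assume *: "ae_equal f f'"
  have "(LINT x|torus. f x \<bullet> g x) = (LINT x|torus. f' x \<bullet> g x)"
    if "continuous_on UNIV g" for g :: "real^2 \<Rightarrow> real^2"
  proof (rule integral_cong_AE)
    have "g \<in> borel_measurable borel" using that by (rule borel_measurable_continuous_onI)
    then show "(\<lambda>x. f x \<bullet> g x) \<in> borel_measurable torus" "(\<lambda>x. f' x \<bullet> g x) \<in> borel_measurable torus"
      using * by (intro measurable_torus borel_measurable_inner;
          simp add: ae_equal_def square_integrable_def)+
    have "AE x in lborel. f x = f' x" using * by (simp add: ae_equal_def)
    then show "AE x in torus. f x \<bullet> g x = f' x \<bullet> g x"
      by (intro AE_torusI) (auto elim: eventually_mono)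
  qed
  then show "(\<forall>\<phi> g. periodic \<phi> \<and> (\<forall>x. GDERIV \<phi> x :> g x) \<and> continuous_on UNIV g \<longrightarrow>
      (LINT x|torus. f x \<bullet> g x) = 0) =
    (\<forall>\<phi> g. periodic \<phi> \<and> (\<forall>x. GDERIV \<phi> x :> g x) \<and> continuous_on UNIV g \<longrightarrow>
      (LINT x|torus. f' x \<bullet> g x) = 0)"
    by simp
qed

abbreviation admissible :: "L2x \<Rightarrow> bool" where
  "admissible u \<equiv> divergence_free u \<and> mean_zero u"


section \<open>The spectral viscosity scheme\<close>

definition partial_deriv :: "2 \<Rightarrow> (real^2 \<Rightarrow> 'b::real_normed_vector) \<Rightarrow> real^2 \<Rightarrow> 'b" where
  "partial_deriv i f x = frechet_derivative f (at x) (axis i 1)"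

definition divergence :: "(real^2 \<Rightarrow> real^2) \<Rightarrow> real^2 \<Rightarrow> real" where
  "divergence u x = (\<Sum>i\<in>UNIV. partial_deriv i u x $ i)"

definition laplacian :: "(real^2 \<Rightarrow> real^2) \<Rightarrow> real^2 \<Rightarrow> real^2" where
  "laplacian u x = (\<Sum>i\<in>UNIV. partial_deriv i (partial_deriv i u) x)"

definition convection :: "(real^2 \<Rightarrow> real^2) \<Rightarrow> real^2 \<Rightarrow> real^2" where
  "convection u x = (\<Sum>i\<in>UNIV. u x $ i *\<^sub>R partial_deriv i u x)"

text \<open>
  \<open>SV_solution T N \<nu> Q u\<^sub>0 u\<close>: the velocity \<open>u t x\<close> solves the scheme with \<open>N\<close> modes, viscosity
  \<open>\<nu>\<close>, multiplier \<open>Q\<close> and (discretised) initial datum \<open>u\<^sub>0\<close> on \<open>[0, T]\<close>. The first conjunct says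
  that each \<open>u t\<close> is a trigonometric polynomial with modes \<open>kmax k \<le> N\<close>; hence it is
  square integrable and \<open>L2_class (u t)\<close> is its genuine equivalence class.
\<close>

definition SV_solution ::
  "real \<Rightarrow> nat \<Rightarrow> real \<Rightarrow> (int^2 \<Rightarrow> real) \<Rightarrow> L2x \<Rightarrow> (real \<Rightarrow> real^2 \<Rightarrow> real^2) \<Rightarrow> bool" where
  "SV_solution T N \<nu> Q u\<^sub>0 u \<longleftrightarrow>
    (\<forall>t\<in>{0..T}. u t = fourier_proj N (u t)) \<and>
    (\<exists>(dtu :: real \<Rightarrow> real^2 \<Rightarrow> real^2) (p :: real \<Rightarrow> real^2 \<Rightarrow> real) (gradp :: real \<Rightarrow> real^2 \<Rightarrow> real^2).
       \<forall>t\<in>{0..T}. periodic (p t) \<and>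
         (\<forall>x. ((\<lambda>s. u s x) has_vector_derivative dtu t x) (at t within {0..T}) \<and>
              GDERIV (p t) x :> gradp t x \<and>
              dtu t x + fourier_proj N (convection (u t)) x + gradp t x =
                \<nu> *\<^sub>R laplacian (fourier_mult N Q (u t)) x)) \<and>
    (\<forall>t\<in>{0..T}. \<forall>x. divergence (u t) x = 0) \<and>
    L2_class (u 0) = u\<^sub>0"

definition SV_parameters :: "real \<Rightarrow> (nat \<Rightarrow> real) \<Rightarrow> (nat \<Rightarrow> int^2 \<Rightarrow> real) \<Rightarrow> bool" where
  "SV_parameters \<epsilon> m Q \<longleftrightarrow>
    \<epsilon> > 0 \<and>
    (\<lambda>N. \<epsilon> / real N * m N) \<longlonglongrightarrow> 0 \<and>
    bdd_above ((\<lambda>N. \<epsilon> / real N * (m N)\<^sup>2) ` {1..}) \<and>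
    (\<forall>N\<ge>1. \<forall>k. 0 \<le> Q N k \<and> Q N k \<le> 1 \<and>
       (norm (wave k) \<le> m N \<longrightarrow> Q N k = 0) \<and>
       (norm (wave k) > 2 * m N \<longrightarrow> Q N k = 1))"

text \<open>\<open>J N\<close> maps initial data to their discretised approximations with \<open>N\<close> modes.\<close>

definition discretization :: "(nat \<Rightarrow> L2x \<Rightarrow> L2x) \<Rightarrow> bool" where
  "discretization J \<longleftrightarrow>
    (\<forall>u. admissible u \<longrightarrow>
       (\<forall>N\<ge>1. admissible (J N u) \<and> band_limited N (J N u)) \<and>
       (\<lambda>N. J N u) \<longlonglongrightarrow> u)"

text \<open>\<open>S N t\<close> is the solution operator of the scheme at resolution \<open>1 / N\<close>.\<close>

definition SV_solution_map ::
  "real \<Rightarrow> real \<Rightarrow> (nat \<Rightarrow> int^2 \<Rightarrow> real) \<Rightarrow> (nat \<Rightarrow> L2x \<Rightarrow> L2x) \<Rightarrow> (nat \<Rightarrow> real \<Rightarrow> L2x \<Rightarrow> L2x) \<Rightarrow> bool" where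
  "SV_solution_map T \<epsilon> Q J S \<longleftrightarrow>
    (\<forall>N\<ge>1. \<forall>v. admissible v \<longrightarrow>
       (\<exists>u. SV_solution T N (\<epsilon> / real N) (Q N) (J N v) u \<and>
            (\<forall>t\<in>{0..T}. S N t v = L2_class (u t))))"


section \<open>Probability measures on the space of vector fields\<close>

definition borel_probs :: "'a::topological_space measure set" where
  "borel_probs = {\<mu>. prob_space \<mu> \<and> sets \<mu> = sets borel}"

text \<open>The average of the Dirac measures at \<open>v 0, \<dots>, v (K - 1)\<close>, meaningful for \<open>K > 0\<close>.\<close>

definition empirical_measure :: "nat \<Rightarrow> (nat \<Rightarrow> 'a::topological_space) \<Rightarrow> 'a measure" where
  "empirical_measure K v = distr (uniform_count_measure {..<K}) borel v"

definition weakly_converges :: "(nat \<Rightarrow> 'a::topological_space measure) \<Rightarrow> 'a measure \<Rightarrow> bool" where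
  "weakly_converges M \<mu> \<longleftrightarrow>
    (\<forall>f :: 'a \<Rightarrow> real. continuous_on UNIV f \<and> bounded (range f) \<longrightarrow>
       (\<lambda>n. LINT u|M n. f u) \<longlonglongrightarrow> (LINT u|\<mu>. f u))"

definition couplings :: "'a::metric_space measure \<Rightarrow> 'a measure \<Rightarrow> ('a \<times> 'a) measure set" where
  "couplings \<mu> \<nu> = {\<pi> \<in> borel_probs. distr \<pi> borel fst = \<mu> \<and> distr \<pi> borel snd = \<nu>}"

definition W1 :: "'a::metric_space measure \<Rightarrow> 'a measure \<Rightarrow> ennreal" where
  "W1 \<mu> \<nu> = (INF \<pi>\<in>couplings \<mu> \<nu>. \<integral>\<^sup>+ z. ennreal (dist (fst z) (snd z)) \<partial>\<pi>)"

text \<open>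
  The elements of \<open>L\<^sup>1\<^sub>t(\<P>)\<close>: weakly measurable curves of probability measures at integrable
  \<open>W\<^sub>1\<close>-distance from the Dirac measure at 0.
\<close>

definition L1_prob :: "real \<Rightarrow> (real \<Rightarrow> L2x measure) set" where
  "L1_prob T = {\<mu>.
     (\<forall>t\<in>{0..T}. \<mu> t \<in> borel_probs) \<and>
     (\<forall>f :: L2x \<Rightarrow> real. continuous_on UNIV f \<and> bounded (range f) \<longrightarrow>
        (\<lambda>t. LINT u|\<mu> t. f u) \<in> borel_measurable (restrict_space lborel {0..T})) \<and>
     (\<integral>\<^sup>+ t\<in>{0..T}. W1 (\<mu> t) (return borel 0) \<partial>lborel) < \<infinity>}"

lift_definition mean_increment :: "real \<Rightarrow> L2x \<Rightarrow> ennreal" is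
  "\<lambda>r f. \<integral>\<^sup>+ x. (\<integral>\<^sup>+ h\<in>ball 0 r. ennreal ((norm (f (x + h) - f x))\<^sup>2) \<partial>lborel)
                / emeasure lborel (ball (0 :: real^2) r) \<partial>torus"
proof (rule nn_integral_cong_AE)
  fix r and f g :: "real^2 \<Rightarrow> real^2" assume *: "ae_equal f g"
  then have ae: "AE x in lborel. f x = g x" by (simp add: ae_equal_def)
  have shift: "AE h in lborel. f (x + h) = g (x + h)" for x
  proof -
    have "AE y in distr lborel borel ((+) x). f y = g y"
      using ae unfolding lborel_distr_plus .
    moreover have "{y \<in> space borel. f y = g y} \<in> sets borel"
    proof -
      have "f \<in> borel_measurable borel" "g \<in> borel_measurable borel"
        using * by (simp_all add: ae_equal_def square_integrable_def)
      then show ?thesis by measurable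
    qed
    ultimately show ?thesis by (subst (asm) AE_distr_iff) auto
  qed
  have "AE x in torus. f x = g x" using ae by (rule AE_torusI)
  then show "AE x in torus.
      (\<integral>\<^sup>+ h\<in>ball 0 r. ennreal ((norm (f (x + h) - f x))\<^sup>2) \<partial>lborel) / emeasure lborel (ball (0 :: real^2) r) =
      (\<integral>\<^sup>+ h\<in>ball 0 r. ennreal ((norm (g (x + h) - g x))\<^sup>2) \<partial>lborel) / emeasure lborel (ball (0 :: real^2) r)"
  proof eventually_elim
    fix x assume "f x = g x"
    with shift[of x] have "AE h in lborel. ennreal ((norm (f (x + h) - f x))\<^sup>2) * indicator (ball 0 r) h =
        ennreal ((norm (g (x + h) - g x))\<^sup>2) * indicator (ball 0 r) h"
      by (auto elim: eventually_mono)
    then show "(\<integral>\<^sup>+ h\<in>ball 0 r. ennreal ((norm (f (x + h) - f x))\<^sup>2) \<partial>lborel) / emeasure lborel (ball (0 :: real^2) r) =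
      (\<integral>\<^sup>+ h\<in>ball 0 r. ennreal ((norm (g (x + h) - g x))\<^sup>2) \<partial>lborel) / emeasure lborel (ball (0 :: real^2) r)"
      by (simp cong: nn_integral_cong_AE)
  qed
qed

definition ennreal_sqrt :: "ennreal \<Rightarrow> ennreal" where
  "ennreal_sqrt x = (if x = \<infinity> then \<infinity> else ennreal (sqrt (enn2real x)))"

definition S2 :: "L2x measure \<Rightarrow> real \<Rightarrow> ennreal" where
  "S2 \<mu> r = ennreal_sqrt (\<integral>\<^sup>+ u. mean_increment r u \<partial>\<mu>)"

text \<open>A curve of measures has almost everywhere constant (finite) mean energy.\<close>

definition energy_conservative :: "real \<Rightarrow> (real \<Rightarrow> L2x measure) \<Rightarrow> bool" where
  "energy_conservative T \<mu> \<longleftrightarrow>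
    (\<exists>E. AE t in lborel. t \<in> {0..T} \<longrightarrow>
       integrable (\<mu> t) (\<lambda>u. (norm u)\<^sup>2) \<and> (LINT u|\<mu> t. (norm u)\<^sup>2) = E)"

end

theory Submission
  imports Defs "HOL-Real_Asymp.Real_Asymp"
begin

text \<open>
  On Fourier coefficients the scheme is a finite system of ordinary differential equations. Each
  coefficient of each sample is bounded and Lipschitz in time, uniformly in the resolution, because
  the pressure is orthogonal to divergence-free modes. The structure function bound controls the
  modes \<open>|k| \<le> R\<close> of the mean enstrophy by \<open>R powr (2 - 2 * \<alpha>)\<close>, hence the mean energy of the high modes
  uniformly.

  Compactness: a single Skorohod representation for the Fourier coefficients of the sampled paths
  at rational times yields random sample indices along which all coefficients converge almost
  surely, at all times by the Lipschitz bound. With the uniform control of high modes the fields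
  converge in \<open>L\<^sup>2\<close> over time and probability, and the representation is a coupling that bounds \<open>W1\<close>.

  Energy: in two dimensions the truncated nonlinearity conserves the enstrophy, so above \<open>2 * m\<close> viscosity
  damps it, down to the level of the low modes. For positive times the energy dissipation,
  viscosity times mean enstrophy, therefore vanishes in the limit.
\<close>

section \<open>Trigonometric polynomials on the torus\<close>

text \<open>The structure function alone does not close the energy argument. Applied to all modes up
  to N it bounds the mean enstrophy by a multiple of \<open>N powr (2 - 2 * \<alpha>)\<close>, so
  the dissipation is of order \<open>N powr (1 - 2 * \<alpha>)\<close> at most, which vanishes only
  for \<alpha> > 1/2. In general the viscosity has to suppress the modes above a cutoff R far below
  N, with R squared of order \<open>N powr (1 + \<alpha> / 2)\<close>. The initial enstrophy is only
  known to be of order N squared, hence the restriction to positive times.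

  Skorohod's theorem is applied on the real line only. Continuous coordinate functions decode a
  whole sequence from one real code, so convergence of the codes is convergence of all the data. One
  index is drawn per path, not per time, so that a single probability space serves all times.

  Completeness of \<open>L2x\<close> is proved below, but no countable base is used. Measurability
  of differences and pairs is therefore obtained by first fixing the countably many values of the
  random index.\<close>

lemma torus_integral:
  fixes f :: "real^2 \<Rightarrow> 'b :: {banach, second_countable_topology}"
  shows "(LINT x|torus. f x) = (LINT x|lborel. indicator (cbox 0 (\<chi> i. 2 * pi)) x *\<^sub>R f x)"
  unfolding torus_def by (subst integral_restrict_space) simp_all

lemma integrable_torus_continuous:
  fixes f :: "real^2 \<Rightarrow> 'b :: {banach, second_countable_topology}"
  assumes "continuous_on UNIV f"
  shows "integrable torus f"
  unfolding torus_def
  by (subst integrable_restrict_space)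
    (auto intro!: borel_integrable_compact continuous_on_subset[OF assms])

lemma integral_cis_period:
  "(LINT y|lborel. indicator {0..2*pi} y *\<^sub>R cis (of_int n * y)) = (if n = 0 then of_real (2 * pi) else 0)"
proof (cases "n = 0")
  case True
  have "(LINT y|lborel. indicator {0..2*pi} y *\<^sub>R (1::complex)) = of_real (2*pi)"
    by (simp add: integral_FTC_Icc scaleR_conv_of_real)
  then show ?thesis using True by simp
next
  case False
  define F where "F y = cis (of_int n * y) / (\<i> * of_int n)" for y :: real
  have "(LINT y|lborel. indicator {0..2*pi} y *\<^sub>R cis (of_int n * y)) = F (2 * pi) - F 0"
  proof (rule integral_FTC_atLeastAtMost)
    fix x :: real
    show "(F has_vector_derivative cis (of_int n * x)) (at x within {0..2*pi})"
      unfolding F_def has_vector_derivative_def using False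
      by (auto intro!: derivative_eq_intros simp: scaleR_conv_of_real fun_eq_iff mult.left_commute[of \<i> _ "\<i> * _"] simp flip: mult.assoc[of \<i> \<i>])
  qed (auto intro!: continuous_intros)
  also have "cis (of_int n * (2 * pi)) = 1"
    using cis_multiple_2pi[of "of_int n"] by (simp add: mult_ac)
  then have "F (2 * pi) - F 0 = 0" by (simp add: F_def)
  finally show ?thesis using False by simp
qed

text \<open>Everything factors over the coordinates: \<open>lborel\<close> is the image of a product
  of one-dimensional Lebesgue measures indexed by \<open>Basis\<close>, and both the indicator of
  the square and the character are products. Each factor is
  \<open>integral_cis_period\<close>.\<close>

lemma integral_wave:
  "(LINT x|torus. cis (wave k \<bullet> x)) = (if k = 0 then of_real ((2 * pi)\<^sup>2) else 0)"
proof -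
  define g :: "real^2 \<Rightarrow> real \<Rightarrow> complex"
    where "g b y = indicator {0..2*pi} y *\<^sub>R cis ((wave k \<bullet> b) * y)" for b y
  have g: "integrable lborel (g b)" for b
    unfolding g_def by (auto intro!: borel_integrable_compact continuous_intros)
  have ind: "indicator (cbox 0 (\<chi> i. 2 * pi)) x = (\<Prod>b\<in>Basis. indicator {0..2*pi} (x \<bullet> b) :: real)" for x :: "real^2"
  proof (cases "x \<in> cbox 0 (\<chi> i. 2 * pi)")
    case True
    then have "(\<Prod>b\<in>Basis. indicator {0..2*pi} (x \<bullet> b) :: real) = 1"
      by (intro prod.neutral) (auto simp: mem_box_cart Basis_vec_def inner_axis)
    then show ?thesis using True by simp
  next
    case False
    then obtain i where "\<not> (0 \<le> x $ i \<and> x $ i \<le> 2 * pi)" by (auto simp: mem_box_cart)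
    then have "indicator {0..2*pi} (x \<bullet> axis i 1) = (0::real)" by (auto simp: inner_axis)
    moreover have "axis i 1 \<in> (Basis :: (real^2) set)" by (simp add: axis_in_Basis_iff)
    ultimately have "(\<Prod>b\<in>Basis. indicator {0..2*pi} (x \<bullet> b) :: real) = 0"
      by (intro prod_zero) auto
    then show ?thesis using False by simp
  qed
  have scp: "(\<Prod>b\<in>B. u b *\<^sub>R (v b :: complex)) = (\<Prod>b\<in>B. u b) *\<^sub>R (\<Prod>b\<in>B. v b)" for u v and B :: "(real^2) set"
    by (simp add: scaleR_conv_of_real prod.distrib)
  have eq: "indicator (cbox 0 (\<chi> i. 2 * pi)) x *\<^sub>R cis (wave k \<bullet> x) = (\<Prod>b\<in>Basis. g b (x \<bullet> b))" for x
  proof -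
    have "cis (wave k \<bullet> x) = (\<Prod>b\<in>Basis. cis ((wave k \<bullet> b) * (x \<bullet> b)))"
      by (subst euclidean_inner) (simp add: cis_conv_exp sum_distrib_left flip: exp_sum)
    then show ?thesis unfolding ind g_def by (simp only: scp)
  qed
  interpret product_sigma_finite "\<lambda>b :: real^2. lborel :: real measure" ..
  have "(LINT x|torus. cis (wave k \<bullet> x)) = (LINT x|lborel. (\<Prod>b\<in>Basis. g b (x \<bullet> b)))"
    unfolding torus_integral eq ..
  also have "\<dots> = (LINT y|Pi\<^sub>M Basis (\<lambda>b. lborel). (\<Prod>b\<in>Basis. g b (y b)))"
  proof (subst lborel_eq, subst integral_distr)
    show "(\<lambda>f. \<Sum>b\<in>Basis. f b *\<^sub>R b) \<in> (\<Pi>\<^sub>M b\<in>(Basis::(real^2) set). lborel) \<rightarrow>\<^sub>M borel" by measurable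
    have g_meas: "g b \<in> borel_measurable borel" for b using borel_measurable_integrable[OF g[of b]] by simp
    show "(\<lambda>x :: real^2. \<Prod>b\<in>Basis. g b (x \<bullet> b)) \<in> borel_measurable borel"
      by (intro borel_measurable_prod measurable_compose[OF _ g_meas] borel_measurable_inner) simp_all
    show "(LINT y|Pi\<^sub>M Basis (\<lambda>b. lborel). (\<Prod>b\<in>Basis. g b ((\<Sum>b\<in>Basis. y b *\<^sub>R b) \<bullet> b))) =
      (LINT y|Pi\<^sub>M Basis (\<lambda>b. lborel). (\<Prod>b\<in>Basis. g b (y b)))"
      by (intro Bochner_Integration.integral_cong prod.cong refl)
        (simp add: inner_sum_left inner_Basis if_distrib[of "\<lambda>z. _ * z"] cong: if_cong)
  qed
  also have "\<dots> = (\<Prod>b\<in>Basis. LINT y|lborel. g b y)"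
    by (rule product_integral_prod) (use g in auto)
  also have "\<dots> = (\<Prod>i\<in>UNIV. LINT y|lborel. g (axis i 1) y)"
    unfolding Basis_vec_def
    by (auto simp: UNION_singleton_eq_range prod.reindex inj_on_def axis_eq_axis)
  also have "\<dots> = (\<Prod>i\<in>UNIV. if k $ i = 0 then of_real (2 * pi) else 0)"
    unfolding g_def by (intro prod.cong refl, subst integral_cis_period[symmetric]) (simp add: inner_axis wave_def)
  also have "\<dots> = (if k = 0 then of_real ((2 * pi)\<^sup>2) else 0)"
    by (auto simp: UNIV_2 vec_eq_iff forall_2 power2_eq_square)
  finally show ?thesis .
qed

text \<open>The real part makes the field real by type for arbitrary \<open>a\<close>. For symmetric
  \<open>F\<close> and hermitian \<open>a\<close> it discards nothing (\<open>trig_real\<close>),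
  and such coefficients are recovered from the field by \<open>fourier_coeff_trig\<close>.\<close>

definition trig :: "(int^2) set \<Rightarrow> (int^2 \<Rightarrow> complex^2) \<Rightarrow> real^2 \<Rightarrow> real^2" where
  "trig F a x = (\<chi> j. Re (\<Sum>k\<in>F. a k $ j * cis (wave k \<bullet> x)))"

definition hermitian :: "(int^2 \<Rightarrow> complex^2) \<Rightarrow> bool" where
  "hermitian a \<longleftrightarrow> (\<forall>k j. a (- k) $ j = cnj (a k $ j))"

definition symmetric :: "(int^2) set \<Rightarrow> bool" where
  "symmetric F \<longleftrightarrow> finite F \<and> uminus ` F = F"

lemma wave_add: "wave (k + l) = wave k + wave l"
  and wave_minus: "wave (- k) = - wave k"
  and wave_diff: "wave (k - l) = wave k - wave l"
  by (auto simp: wave_def vec_eq_iff)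

lemma sum_symmetric: "symmetric F \<Longrightarrow> (\<Sum>k\<in>F. f (- k)) = (\<Sum>k\<in>F. f k)"
  using sum.reindex[of uminus F f] by (simp add: symmetric_def inj_on_def comp_def)

lemma trig_real:
  assumes "symmetric F" "hermitian a"
  shows "complex_of_real (trig F a x $ j) = (\<Sum>k\<in>F. a k $ j * cis (wave k \<bullet> x))"
proof -
  have "cnj (\<Sum>k\<in>F. a k $ j * cis (wave k \<bullet> x)) = (\<Sum>k\<in>F. a (- k) $ j * cis (wave (- k) \<bullet> x))"
    using assms(2) by (auto simp: hermitian_def wave_minus cis_cnj)
  also have "\<dots> = (\<Sum>k\<in>F. a k $ j * cis (wave k \<bullet> x))"
    by (rule sum_symmetric[OF assms(1), of "\<lambda>k. a k $ j * cis (wave k \<bullet> x)"])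
  finally have "(\<Sum>k\<in>F. a k $ j * cis (wave k \<bullet> x)) \<in> \<real>" by (simp only: Reals_cnj_iff)
  then show ?thesis unfolding trig_def by (simp only: vec_lambda_beta of_real_Re)
qed

lemma continuous_trig: "continuous_on S (trig F a)"
  unfolding trig_def by (auto intro!: continuous_intros)

lemma periodic_trig: "periodic (trig F a)"
proof -
  have "cis (wave k \<bullet> (x + axis i (2 * pi))) = cis (wave k \<bullet> x)" for k x i
  proof -
    have "cis (wave k \<bullet> axis i (2 * pi)) = 1"
      using cis_multiple_2pi[of "of_int (k $ i)"] by (simp add: inner_axis wave_def mult_ac)
    then show ?thesis by (simp add: inner_add_right flip: cis_mult)
  qed
  then show ?thesis by (simp add: periodic_def trig_def)
qed

lemma square_integrable_trig: "square_integrable (trig F a)"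
  unfolding square_integrable_def
  by (intro conjI periodic_trig borel_measurable_continuous_onI integrable_torus_continuous
      continuous_trig continuous_intros)

text \<open>The frequency map \<open>m\<close> may repeat values. The lemma thereby also covers
  products of fields, where the pair (p, q) contributes at frequency p + q.\<close>

lemma fourier_coeff_sum:
  assumes "finite G" "\<And>x. complex_of_real (f x $ j) = (\<Sum>l\<in>G. b l * cis (wave (m l) \<bullet> x))"
  shows "fourier_coeff f k $ j = (\<Sum>l\<in>G. if m l = k then b l else 0)"
proof -
  have "(LINT x|torus. of_real (f x $ j) * cis (- (wave k \<bullet> x))) =
      (LINT x|torus. (\<Sum>l\<in>G. b l * cis (wave (m l - k) \<bullet> x)))"
    by (intro Bochner_Integration.integral_cong refl)
      (simp add: assms(2) sum_distrib_right mult.assoc cis_mult wave_diff inner_diff_left)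
  also have "\<dots> = (\<Sum>l\<in>G. b l * (LINT x|torus. cis (wave (m l - k) \<bullet> x)))"
    by (subst Bochner_Integration.integral_sum)
      (auto intro!: integrable_torus_continuous continuous_intros)
  also have "\<dots> = (\<Sum>l\<in>G. if m l = k then b l else 0) * (2 * pi)\<^sup>2"
    unfolding integral_wave by (auto simp: sum_distrib_right intro!: sum.cong)
  finally show ?thesis by (simp add: fourier_coeff_def)
qed

lemma fourier_coeff_trig:
  assumes "symmetric F" "hermitian a"
  shows "fourier_coeff (trig F a) k = (if k \<in> F then a k else 0)"
proof -
  have "fourier_coeff (trig F a) k $ j = (\<Sum>l\<in>F. if l = k then a l $ j else 0)" for j
    using assms by (intro fourier_coeff_sum) (auto simp: symmetric_def trig_real[OF assms])
  moreover have "finite F" using assms(1) by (simp add: symmetric_def)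
  ultimately show ?thesis by (subst vec_eq_iff) (auto simp: sum.delta)
qed

lemma hermitian_fourier_coeff: "hermitian (fourier_coeff f)"
proof -
  have "(LINT x|torus. of_real (f x $ j) * cis (- (wave (- k) \<bullet> x))) =
      cnj (LINT x|torus. of_real (f x $ j) * cis (- (wave k \<bullet> x)))" for k j
  proof -
    have "(LINT x|torus. of_real (f x $ j) * cis (- (wave (- k) \<bullet> x))) =
      (LINT x|torus. cnj (of_real (f x $ j) * cis (- (wave k \<bullet> x))))"
      by (intro Bochner_Integration.integral_cong refl) (simp only: wave_minus complex_cnj_mult cis_cnj inner_minus_left complex_cnj_complex_of_real)
    then show ?thesis by (simp only: Bochner_Integration.integral_cnj)
  qed
  then show ?thesis by (simp add: hermitian_def fourier_coeff_def)
qed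

lemma trig_unique:
  assumes "symmetric F" "hermitian a" "hermitian b" "\<And>x. trig F a x = trig F b x" "k \<in> F"
  shows "a k = b k"
proof -
  have "trig F a = trig F b" using assms(4) by auto
  then show ?thesis using fourier_coeff_trig[OF assms(1,2), of k] fourier_coeff_trig[OF assms(1,3), of k] assms(5)
    by simp
qed

lemma norm_vec2_sq: "(norm (x :: 'a::real_normed_vector^2))\<^sup>2 = (\<Sum>j\<in>UNIV. (norm (x $ j))\<^sup>2)"
  by (simp add: norm_vec_def L2_set_def sum_nonneg)

lemma integral_trig_square:
  assumes "symmetric F" "hermitian a"
  shows "(LINT x|torus. (norm (trig F a x))\<^sup>2) = (2 * pi)\<^sup>2 * (\<Sum>k\<in>F. (norm (a k))\<^sup>2)"
proof -
  have fin: "finite F" using assms(1) by (simp add: symmetric_def)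
  have comp: "(LINT x|torus. complex_of_real ((trig F a x $ j)\<^sup>2)) = (2 * pi)\<^sup>2 * (\<Sum>k\<in>F. (norm (a k $ j))\<^sup>2)" for j
  proof -
    \<comment> \<open>Only one factor of the square is expanded, so that the integrals that remain
      are Fourier coefficients, known from \<open>fourier_coeff_trig\<close>.\<close>
    have "complex_of_real ((trig F a x $ j)\<^sup>2) = (\<Sum>k\<in>F. cnj (a k $ j) * (complex_of_real (trig F a x $ j) * cis (- (wave k \<bullet> x))))" for x
    proof -
      have "complex_of_real ((trig F a x $ j)\<^sup>2) = cnj (complex_of_real (trig F a x $ j)) * complex_of_real (trig F a x $ j)"
        by (simp add: power2_eq_square)
      then show ?thesis
        by (subst (asm) trig_real[OF assms]) (simp add: sum_distrib_left sum_distrib_right mult_ac cis_cnj)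
    qed
    then have "(LINT x|torus. complex_of_real ((trig F a x $ j)\<^sup>2)) =
      (\<Sum>k\<in>F. cnj (a k $ j) * (LINT x|torus. complex_of_real (trig F a x $ j) * cis (- (wave k \<bullet> x))))"
      by (simp only:, subst Bochner_Integration.integral_sum)
        (auto intro!: integrable_torus_continuous continuous_intros continuous_trig)
    also have "\<dots> = (\<Sum>k\<in>F. cnj (a k $ j) * ((2 * pi)\<^sup>2 * fourier_coeff (trig F a) k $ j))"
      by (simp add: fourier_coeff_def)
    also have "\<dots> = (\<Sum>k\<in>F. complex_of_real ((2 * pi)\<^sup>2 * (norm (a k $ j))\<^sup>2))"
    proof (intro sum.cong refl)
      fix k assume "k \<in> F"
      have "complex_of_real ((norm (a k $ j))\<^sup>2) = a k $ j * cnj (a k $ j)"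
        by (rule complex_norm_square)
      then show "cnj (a k $ j) * (complex_of_real ((2 * pi)\<^sup>2) * fourier_coeff (trig F a) k $ j) = complex_of_real ((2 * pi)\<^sup>2 * (norm (a k $ j))\<^sup>2)"
        using \<open>k \<in> F\<close> by (simp only: fourier_coeff_trig[OF assms] of_real_mult if_True mult_ac)
    qed
    finally show ?thesis by (simp only: sum_distrib_left of_real_sum)
  qed
  have "(LINT x|torus. (norm (trig F a x))\<^sup>2) = (\<Sum>j\<in>UNIV. LINT x|torus. (trig F a x $ j)\<^sup>2)"
    unfolding norm_vec2_sq
    by (subst Bochner_Integration.integral_sum)
      (auto intro!: integrable_torus_continuous continuous_intros continuous_trig)
  also have "\<dots> = (\<Sum>j\<in>UNIV. (2 * pi)\<^sup>2 * (\<Sum>k\<in>F. (norm (a k $ j))\<^sup>2))"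
  proof (intro sum.cong refl)
    fix j
    have "complex_of_real (LINT x|torus. (trig F a x $ j)\<^sup>2) = complex_of_real ((2 * pi)\<^sup>2 * (\<Sum>k\<in>F. (norm (a k $ j))\<^sup>2))"
      unfolding integral_complex_of_real[symmetric] comp by simp
    then show "(LINT x|torus. (trig F a x $ j)\<^sup>2) = (2 * pi)\<^sup>2 * (\<Sum>k\<in>F. (norm (a k $ j))\<^sup>2)"
      by (simp only: of_real_eq_iff)
  qed
  also have "\<dots> = (2 * pi)\<^sup>2 * (\<Sum>k\<in>F. (norm (a k))\<^sup>2)"
    unfolding norm_vec2_sq by (subst sum.swap) (simp add: sum_distrib_left)
  finally show ?thesis .
qed

lemma trig_diff: "trig F a x - trig F b x = trig F (\<lambda>k. a k - b k) x"
  and trig_add: "trig F a x + trig F b x = trig F (\<lambda>k. a k + b k) x"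
  by (auto simp: trig_def vec_eq_iff sum_subtractf sum.distrib algebra_simps)

lemma trig_scaleR: "r *\<^sub>R trig F a x = trig F (\<lambda>k. r *\<^sub>R a k) x"
  by (simp add: trig_def vec_eq_iff sum_distrib_left)

lemma trig_shift: "trig F a (x + h) = trig F (\<lambda>k. \<chi> j. cis (wave k \<bullet> h) * a k $ j) x"
  by (simp add: trig_def vec_eq_iff inner_add_right mult_ac flip: cis_mult)

lemma trig_mono_neutral:
  assumes "finite G" "F \<subseteq> G" "\<And>k. k \<in> G - F \<Longrightarrow> a k = 0"
  shows "trig F a = trig G a"
proof (intro ext, unfold trig_def, intro arg_cong[of _ _ vec_lambda] ext arg_cong[of _ _ Re])
  fix x j
  show "(\<Sum>k\<in>F. a k $ j * cis (wave k \<bullet> x)) = (\<Sum>k\<in>G. a k $ j * cis (wave k \<bullet> x))"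
    using assms by (intro sum.mono_neutral_left) auto
qed

section \<open>Differential operators and convection acting on coefficients\<close>

definition deriv_coeff :: "2 \<Rightarrow> (int^2 \<Rightarrow> complex^2) \<Rightarrow> int^2 \<Rightarrow> complex^2" where
  "deriv_coeff i a k = (\<chi> j. \<i> * of_int (k $ i) * a k $ j)"

lemma has_derivative_trig:
  "(trig F a has_derivative (\<lambda>h. \<chi> j. Re (\<Sum>k\<in>F. (wave k \<bullet> h) * (\<i> * a k $ j * cis (wave k \<bullet> x))))) (at x)"
proof -
  have c: "((\<lambda>x. cis (wave k \<bullet> x)) has_derivative (\<lambda>h. (wave k \<bullet> h) *\<^sub>R (\<i> * cis (wave k \<bullet> x)))) (at x)" for k
    by (rule has_derivative_cis) (auto intro!: derivative_eq_intros)
  have "((\<lambda>x. trig F a x $ j) has_derivative (\<lambda>h. Re (\<Sum>k\<in>F. (wave k \<bullet> h) * (\<i> * a k $ j * cis (wave k \<bullet> x))))) (at x)" for j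
    unfolding trig_def vec_lambda_beta
    apply (rule has_derivative_Re)
    apply (rule has_derivative_eq_rhs, rule has_derivative_sum, rule has_derivative_mult_right, rule c)
    apply (auto simp: scaleR_conv_of_real mult_ac)
    done
  then show ?thesis
    by (subst has_derivative_componentwise_within)
      (auto simp: Basis_vec_def inner_axis)
qed

lemma partial_deriv_trig: "partial_deriv i (trig F a) = trig F (deriv_coeff i a)"
proof
  fix x
  have "frechet_derivative (trig F a) (at x) =
    (\<lambda>h. \<chi> j. Re (\<Sum>k\<in>F. (wave k \<bullet> h) * (\<i> * a k $ j * cis (wave k \<bullet> x))))"
    using frechet_derivative_at[OF has_derivative_trig] by metis
  then show "partial_deriv i (trig F a) x = trig F (deriv_coeff i a) x"
    unfolding partial_deriv_def
    by (auto simp: trig_def deriv_coeff_def inner_axis wave_def vec_eq_iff mult_ac intro!: sum.cong)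
qed

lemma hermitian_deriv_coeff: "hermitian a \<Longrightarrow> hermitian (deriv_coeff i a)"
  by (simp add: hermitian_def deriv_coeff_def)

text \<open>Bilinear, without conjugation. It vanishes exactly when the mode with wave vector
  \<open>k\<close> and amplitude \<open>a\<close> is divergence free.\<close>

definition cdot :: "complex^2 \<Rightarrow> int^2 \<Rightarrow> complex" where
  "cdot a k = (\<Sum>i\<in>UNIV. a $ i * of_int (k $ i))"

lemma laplacian_trig: "laplacian (trig F a) x = trig F (\<lambda>k. - (norm (wave k))\<^sup>2 *\<^sub>R a k) x"
proof -
  have "laplacian (trig F a) x = trig F (\<lambda>k. deriv_coeff 1 (deriv_coeff 1 a) k + deriv_coeff 2 (deriv_coeff 2 a) k) x"
    by (simp add: laplacian_def partial_deriv_trig UNIV_2 trig_add)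
  also have "(\<lambda>k. deriv_coeff 1 (deriv_coeff 1 a) k + deriv_coeff 2 (deriv_coeff 2 a) k) = (\<lambda>k. - (norm (wave k))\<^sup>2 *\<^sub>R a k)"
  proof
    fix k
    have "(norm (wave k))\<^sup>2 = (of_int (k $ 1))\<^sup>2 + (of_int (k $ 2))\<^sup>2"
      by (simp add: norm_vec2_sq UNIV_2 wave_def)
    then show "deriv_coeff 1 (deriv_coeff 1 a) k + deriv_coeff 2 (deriv_coeff 2 a) k = - (norm (wave k))\<^sup>2 *\<^sub>R a k"
      by (simp add: vec_eq_iff deriv_coeff_def power2_eq_square scaleR_conv_of_real[where 'a=complex] algebra_simps)
  qed
  finally show ?thesis .
qed

lemma divergence_trig:
  assumes "symmetric F" "hermitian a" "\<And>x. divergence (trig F a) x = 0" "k \<in> F"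
  shows "cdot (a k) k = 0"
proof -
  \<comment> \<open>The scalar divergence is written into both components because
    \<open>trig\<close> is vector valued; \<open>trig_unique\<close> then applies to it.\<close>
  define b where "b k = (\<chi> j :: 2. deriv_coeff 1 a k $ 1 + deriv_coeff 2 a k $ 2)" for k
  have "trig F b x = trig F (\<lambda>k. 0) x" for x
    using assms(3)[of x] by (auto simp: divergence_def partial_deriv_trig UNIV_2 trig_def b_def vec_eq_iff
        sum.distrib algebra_simps)
  then have "b k = 0"
    using assms by (intro trig_unique[OF assms(1), of b "\<lambda>k. 0" k])
      (auto simp: hermitian_def b_def deriv_coeff_def)
  then have "deriv_coeff 1 a k $ 1 + deriv_coeff 2 a k $ 2 = 0"
    by (simp add: b_def vec_eq_iff)
  then have "\<i> * cdot (a k) k = 0" by (simp add: deriv_coeff_def cdot_def UNIV_2 algebra_simps)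
  then show ?thesis by simp
qed

text \<open>In each product \<open>p\<close> belongs to the advecting velocity and \<open>q\<close>
  to the differentiated field, whence the factor \<open>\<i> * cdot (c p) q\<close>.\<close>

definition conv :: "(int^2) set \<Rightarrow> (int^2 \<Rightarrow> complex^2) \<Rightarrow> int^2 \<Rightarrow> complex^2" where
  "conv F c k = (\<chi> j. \<Sum>p\<in>F. \<Sum>q\<in>F. if p + q = k then \<i> * cdot (c p) q * c q $ j else 0)"

lemma fourier_coeff_convection:
  assumes "symmetric F" "hermitian a"
  shows "fourier_coeff (convection (trig F a)) k = conv F a k"
proof -
  have fin: "finite F" using assms(1) by (simp add: symmetric_def)
  have "complex_of_real (convection (trig F a) x $ j) =
     (\<Sum>(p,q)\<in>F\<times>F. (\<i> * cdot (a p) q * a q $ j) * cis (wave (p + q) \<bullet> x))" for x j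
  proof -
    have "complex_of_real (convection (trig F a) x $ j) =
      (\<Sum>i\<in>UNIV. complex_of_real (trig F a x $ i) * complex_of_real (trig F (deriv_coeff i a) x $ j))"
      by (simp add: convection_def partial_deriv_trig)
    also have "\<dots> = (\<Sum>i\<in>UNIV. \<Sum>(p,q)\<in>F\<times>F. (a p $ i * cis (wave p \<bullet> x)) * (deriv_coeff i a q $ j * cis (wave q \<bullet> x)))"
      by (simp add: trig_real[OF assms(1) assms(2)] trig_real[OF assms(1) hermitian_deriv_coeff[OF assms(2)]] sum_product sum.cartesian_product)
    also have "\<dots> = (\<Sum>(p,q)\<in>F\<times>F. \<Sum>i\<in>UNIV. (a p $ i * cis (wave p \<bullet> x)) * (deriv_coeff i a q $ j * cis (wave q \<bullet> x)))"
      by (subst sum.swap) (simp add: case_prod_unfold)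
    also have "\<dots> = (\<Sum>(p,q)\<in>F\<times>F. (\<i> * cdot (a p) q * a q $ j) * cis (wave (p + q) \<bullet> x))"
      by (intro sum.cong refl)
        (auto simp: UNIV_2 deriv_coeff_def cdot_def wave_add inner_add_left algebra_simps simp flip: cis_mult)
    finally show ?thesis .
  qed
  then have "fourier_coeff (convection (trig F a)) k $ j = 
    (\<Sum>pq\<in>F\<times>F. if fst pq + snd pq = k then \<i> * cdot (a (fst pq)) (snd pq) * a (snd pq) $ j else 0)" for j
    using fin by (intro fourier_coeff_sum) (auto simp: case_prod_unfold)
  then show ?thesis
    by (simp add: vec_eq_iff conv_def sum.cartesian_product case_prod_unfold)
qed

section \<open>Mode sets and the multiplier of the scheme\<close>

definition modes :: "nat \<Rightarrow> (int^2) set" where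
  "modes N = {k. kmax k \<le> int N}"

lemma modes_iff: "k \<in> modes N \<longleftrightarrow> (\<forall>i. \<bar>k $ i\<bar> \<le> int N)"
  by (auto simp: modes_def kmax_def forall_2)

lemma symmetric_modes: "symmetric (modes N)"
proof -
  have "- k \<in> modes N \<longleftrightarrow> k \<in> modes N" for k by (simp add: modes_iff)
  then have "uminus ` modes N = modes N"
    by (metis (no_types, lifting) add.inverse_inverse image_eqI image_subsetI subsetI subset_antisym)
  then show ?thesis using finite_kmax[of "int N"] by (simp add: symmetric_def modes_def)
qed

lemma finite_modes: "finite (modes N)"
  using symmetric_modes[of N] by (simp add: symmetric_def)

text \<open>\<open>Q\<close> need not be even. On real fields the real part in
  \<open>fourier_mult\<close> acts as this even part, which inherits the bounds 0 and 1 and the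
  value 1 at high frequencies.\<close>

definition sym_mult :: "(int^2 \<Rightarrow> real) \<Rightarrow> int^2 \<Rightarrow> real" where
  "sym_mult Q k = (Q k + Q (- k)) / 2"

lemma fourier_proj_eq: "fourier_proj N f = trig (modes N) (fourier_coeff f)"
  by (simp add: fourier_proj_def fourier_mult_def trig_def modes_def fun_eq_iff)

lemma hermitian_real_mult:
  "hermitian a \<Longrightarrow> (\<And>k. r (- k) = r k) \<Longrightarrow> hermitian (\<lambda>k. r k *\<^sub>R a k)"
  by (simp add: hermitian_def)

lemma hermitian_diff: "hermitian a \<Longrightarrow> hermitian b \<Longrightarrow> hermitian (\<lambda>k. a k - b k)"
  by (simp add: hermitian_def)

text \<open>Reflecting the index turns every term into its complex conjugate, which the real part
  does not see.\<close>

lemma trig_multiplier_reflect: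
  assumes "symmetric F" "hermitian a"
  shows "trig F (\<lambda>k. Q (- k) *\<^sub>R a k) x = trig F (\<lambda>k. Q k *\<^sub>R a k) x"
proof -
  have "Re (\<Sum>k\<in>F. (Q (- k) *\<^sub>R a k) $ j * cis (wave k \<bullet> x)) = Re (\<Sum>k\<in>F. (Q k *\<^sub>R a k) $ j * cis (wave k \<bullet> x))" for j
  proof -
    have "(\<Sum>k\<in>F. (Q (- k) *\<^sub>R a k) $ j * cis (wave k \<bullet> x)) =
       (\<Sum>k\<in>F. (Q (- (- k)) *\<^sub>R a (- k)) $ j * cis (wave (- k) \<bullet> x))"
      by (rule sum_symmetric[OF assms(1), symmetric])
    also have "\<dots> = (\<Sum>k\<in>F. cnj ((Q k *\<^sub>R a k) $ j * cis (wave k \<bullet> x)))"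
      using assms(2) by (intro sum.cong refl) (simp add: hermitian_def wave_minus cis_cnj)
    finally show ?thesis by simp
  qed
  then show ?thesis by (simp add: trig_def)
qed

lemma fourier_mult_eq: "fourier_mult N Q f x = trig (modes N) (\<lambda>k. sym_mult Q k *\<^sub>R fourier_coeff f k) x"
proof -
  have "fourier_mult N Q f x = trig (modes N) (\<lambda>k. Q k *\<^sub>R fourier_coeff f k) x"
    by (simp add: fourier_mult_def trig_def modes_def scaleR_conv_of_real[where 'a=complex] mult.assoc)
  also have "\<dots> = (1/2) *\<^sub>R (trig (modes N) (\<lambda>k. Q k *\<^sub>R fourier_coeff f k) x +
      trig (modes N) (\<lambda>k. Q (- k) *\<^sub>R fourier_coeff f k) x)"
    unfolding trig_multiplier_reflect[OF symmetric_modes hermitian_fourier_coeff] by (simp add: scaleR_2[symmetric])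
  also have "\<dots> = trig (modes N) (\<lambda>k. sym_mult Q k *\<^sub>R fourier_coeff f k) x"
    unfolding trig_add trig_scaleR sym_mult_def
    by (simp only: scaleR_add_left[symmetric] scaleR_scaleR) (simp only: mult.commute[of "1/2"] times_divide_eq_right mult_1_right)
  finally show ?thesis .
qed

section \<open>Fourier coefficients as finite sums of point values\<close>

lemma sum_roots_of_unity:
  assumes "\<bar>m\<bar> < int n"
  shows "(\<Sum>a<n. cis (2 * pi * of_int m * of_nat a / of_nat n)) = (if m = 0 then of_nat n else 0)"
proof (cases "m = 0")
  case False
  define z where "z = cis (2 * pi * of_int m / of_nat n)"
  have n: "n > 0" using assms by auto
  have "z ^ n = cis (2 * pi * of_int m)" using n by (simp add: z_def Complex.DeMoivre)
  also have "\<dots> = 1" by (rule cis_multiple_2pi) simp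
  finally have zn: "z ^ n = 1" .
  have "z \<noteq> 1"
  proof
    assume "z = 1"
    then obtain l :: int where "2 * pi * of_int m / of_nat n = of_int (2 * l) * pi"
      by (auto simp: z_def cis_conv_exp exp_eq_1)
    then have "of_int m = (of_int (l * int n) :: real)" using n by (simp add: field_simps)
    then have "m = l * int n" by (simp only: of_int_eq_iff)
    then have "int n dvd m" by simp
    then show False using assms False zdvd_not_zless[of "\<bar>m\<bar>" "int n"] by auto
  qed
  then have "(\<Sum>a<n. z ^ a) = 0" using zn by (simp add: geometric_sum)
  moreover have "cis (2 * pi * of_int m * of_nat a / of_nat n) = z ^ a" for a
    by (simp add: z_def Complex.DeMoivre mult_ac)
  ultimately show ?thesis using False by simp
qed simp

definition grid :: "nat \<Rightarrow> nat \<Rightarrow> nat \<Rightarrow> real^2" where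
  "grid n a b = (\<chi> i. 2 * pi * of_nat (if i = 1 then a else b) / of_nat n)"

text \<open>The scheme provides time derivatives of \<open>u s x\<close> at each point x. A
  coefficient written as a finite sum of point values inherits its derivative from them, without
  differentiation under the integral.\<close>

definition dft :: "nat \<Rightarrow> (real^2 \<Rightarrow> real^2) \<Rightarrow> int^2 \<Rightarrow> complex^2" where
  "dft n f k = (\<chi> j. \<Sum>a<n. \<Sum>b<n. of_real (f (grid n a b) $ j) * (cis (- (wave k \<bullet> grid n a b)) / (of_nat n)\<^sup>2))"

lemma sum_grid:
  assumes "\<And>i. \<bar>m $ i\<bar> < int n"
  shows "(\<Sum>a<n. \<Sum>b<n. cis (wave m \<bullet> grid n a b)) = (if m = 0 then (of_nat n)\<^sup>2 else 0)"
proof -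
  have "(\<Sum>a<n. \<Sum>b<n. cis (wave m \<bullet> grid n a b)) =
    (\<Sum>a<n. cis (2 * pi * of_int (m $ 1) * of_nat a / of_nat n)) * (\<Sum>b<n. cis (2 * pi * of_int (m $ 2) * of_nat b / of_nat n))"
    by (simp add: sum_product cis_mult wave_def grid_def inner_vec_def UNIV_2 mult_ac)
  then show ?thesis
    by (simp add: sum_roots_of_unity[OF assms] power2_eq_square vec_eq_iff forall_2)
qed

text \<open>Two elements of \<open>modes N\<close> differ by at most 2 * N in each component, so 2 *
  N + 1 grid points per direction exclude aliasing and the discrete orthogonality relation is
  exact.\<close>

lemma dft_trig:
  assumes "hermitian c" "k \<in> modes N"
  shows "dft (2 * N + 1) (trig (modes N) c) k = c k"
proof -
  define n where "n = 2 * N + 1"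
  have "n > 0" by (simp add: n_def)
  have small: "\<bar>(l - k) $ i\<bar> < int n" if "l \<in> modes N" for l i
  proof -
    have "\<bar>l $ i\<bar> \<le> int N" "\<bar>k $ i\<bar> \<le> int N" using that assms(2) by (auto simp: modes_iff)
    then show ?thesis by (simp add: n_def)
  qed
  have "dft n (trig (modes N) c) k $ j = c k $ j" for j
  proof -
    have "dft n (trig (modes N) c) k $ j =
      (\<Sum>a<n. \<Sum>b<n. \<Sum>l\<in>modes N. c l $ j / (of_nat n)\<^sup>2 * cis (wave (l - k) \<bullet> grid n a b))"
      unfolding dft_def vec_lambda_beta trig_real[OF symmetric_modes assms(1)]
      unfolding sum_distrib_right
      by (intro sum.cong refl) (simp add: wave_diff inner_diff_left cis_mult)
    also have "\<dots> = (\<Sum>l\<in>modes N. c l $ j / (of_nat n)\<^sup>2 * (\<Sum>a<n. \<Sum>b<n. cis (wave (l - k) \<bullet> grid n a b)))"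
      unfolding sum_distrib_left
    proof -
      have "(\<Sum>a<n. \<Sum>b<n. \<Sum>l\<in>modes N. f a b l) = (\<Sum>l\<in>modes N. \<Sum>a<n. \<Sum>b<n. f a b l)" for f :: "nat \<Rightarrow> nat \<Rightarrow> int^2 \<Rightarrow> complex"
      proof -
        have "(\<Sum>a<n. \<Sum>b<n. \<Sum>l\<in>modes N. f a b l) = (\<Sum>a<n. \<Sum>l\<in>modes N. \<Sum>b<n. f a b l)"
          by (intro sum.cong refl sum.swap)
        also have "\<dots> = (\<Sum>l\<in>modes N. \<Sum>a<n. \<Sum>b<n. f a b l)" by (rule sum.swap)
        finally show ?thesis .
      qed
      then show "(\<Sum>a<n. \<Sum>b<n. \<Sum>l\<in>modes N. c l $ j / (of_nat n)\<^sup>2 * cis (wave (l - k) \<bullet> grid n a b)) =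
        (\<Sum>l\<in>modes N. \<Sum>a<n. \<Sum>b<n. c l $ j / (of_nat n)\<^sup>2 * cis (wave (l - k) \<bullet> grid n a b))" .
    qed
    also have "\<dots> = (\<Sum>l\<in>modes N. if l = k then c l $ j else 0)"
    proof (intro sum.cong refl)
      fix l assume "l \<in> modes N"
      then show "c l $ j / (of_nat n)\<^sup>2 * (\<Sum>a<n. \<Sum>b<n. cis (wave (l - k) \<bullet> grid n a b)) = (if l = k then c l $ j else 0)"
        unfolding sum_grid[OF small[OF \<open>l \<in> modes N\<close>]] using \<open>n > 0\<close> by simp
    qed
    finally show ?thesis using assms(2) finite_modes by simp
  qed
  then show ?thesis by (simp add: vec_eq_iff n_def)
qed

lemma hermitian_dft: "hermitian (dft n f)"
  by (simp add: hermitian_def dft_def wave_minus cis_cnj)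

lemma has_vector_derivative_vec_lambda:
  fixes f :: "real \<Rightarrow> 'n::finite \<Rightarrow> 'a::euclidean_space"
  assumes "\<And>i. ((\<lambda>s. f s i) has_vector_derivative f' i) F"
  shows "((\<lambda>s. \<chi> i. f s i) has_vector_derivative (\<chi> i. f' i)) F"
proof -
  have lin: "bounded_linear (axis i :: 'a \<Rightarrow> 'a^'n)" for i
    by (intro linear_conv_bounded_linear[THEN iffD1] linearI) (auto simp: axis_def vec_eq_iff)
  have "((\<lambda>s. \<Sum>i\<in>UNIV. axis i (f s i)) has_vector_derivative (\<Sum>i\<in>UNIV. axis i (f' i))) F"
    by (intro has_vector_derivative_sum bounded_linear.has_vector_derivative[OF lin] assms)
  moreover have "(\<Sum>i\<in>UNIV. axis i (g i)) = (\<chi> i. g i)" for g :: "'n \<Rightarrow> 'a"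
    by (simp add: vec_eq_iff axis_def)
  ultimately show ?thesis by simp
qed
lemma has_vector_derivative_dft:
  assumes "\<And>x. ((\<lambda>s. u s x) has_vector_derivative v x) F"
  shows "((\<lambda>s. dft n (u s) k) has_vector_derivative dft n v k) F"
proof -
  have "((\<lambda>s. complex_of_real (u s x $ j) * z) has_vector_derivative complex_of_real (v x $ j) * z) F" for x j z
    by (intro has_vector_derivative_mult_left bounded_linear.has_vector_derivative[OF bounded_linear_of_real]
        bounded_linear.has_vector_derivative[OF bounded_linear_vec_nth] assms)
  then show ?thesis unfolding dft_def
    by (intro has_vector_derivative_vec_lambda has_vector_derivative_sum)
qed

lemma has_vector_derivative_trig:
  assumes "\<And>k. k \<in> F \<Longrightarrow> ((\<lambda>s. c s k) has_vector_derivative d k) G"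
  shows "((\<lambda>s. trig F (c s) x) has_vector_derivative trig F d x) G"
proof -
  have "((\<lambda>s. Re (\<Sum>k\<in>F. c s k $ j * cis (wave k \<bullet> x))) has_vector_derivative
      Re (\<Sum>k\<in>F. d k $ j * cis (wave k \<bullet> x))) G" for j
    by (intro bounded_linear.has_vector_derivative[OF bounded_linear_Re] has_vector_derivative_sum
        has_vector_derivative_mult_left bounded_linear.has_vector_derivative[OF bounded_linear_vec_nth] assms)
  then show ?thesis unfolding trig_def by (intro has_vector_derivative_vec_lambda)
qed

section \<open>The pressure gradient\<close>

text \<open>The shift by \<open>pi / of_int (k $ i)\<close> along the axis is half a wavelength of
  mode \<open>k\<close> and multiplies its coefficient by -1, while invariance leaves the
  coefficient unchanged.\<close>

lemma trig_translation_invariant: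
  assumes "symmetric F" "hermitian h" "\<And>x s. trig F h (x + s *\<^sub>R axis i 1) = trig F h x" "k \<in> F" "k $ i \<noteq> 0"
  shows "h k = 0"
proof -
  define s where "s = pi / of_int (k $ i)"
  define e where "e l = (\<chi> j. cis (wave l \<bullet> (s *\<^sub>R axis i 1)) * h l $ j)" for l
  have "e k = h k"
  proof (rule trig_unique[OF assms(1) _ assms(2) _ assms(4)])
    show "hermitian e" using assms(2) by (simp add: hermitian_def e_def wave_minus cis_cnj)
    show "trig F e x = trig F h x" for x
      using assms(3)[of x s] unfolding trig_shift e_def .
  qed
  moreover have "wave k \<bullet> (s *\<^sub>R axis i 1) = pi"
    using assms(5) by (simp add: s_def wave_def inner_axis)
  then have "e k = - h k" by (simp add: e_def vec_eq_iff)
  ultimately show ?thesis by (simp add: vec_eq_iff)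
qed

text \<open>\<open>P\<close> integrates the modes with \<open>k $ i \<noteq> 0\<close> of \<open>\<partial>\<^sub>i p\<close>; the remaining modes make \<open>p - P\<close> grow
  linearly along the \<open>i\<close>-th axis, which periodicity forbids.\<close>

lemma trig_gradient_axis:
  fixes i :: 2
  assumes F: "symmetric F" and g: "hermitian g" and p: "periodic p"
    and grad: "\<And>x. GDERIV p x :> trig F g x"
  defines "b \<equiv> \<lambda>k. \<chi> j :: 2. if k $ i = 0 then 0 else g k $ i / (\<i> * of_int (k $ i))"
  shows "k \<in> F \<Longrightarrow> k $ i = 0 \<Longrightarrow> g k $ i = 0"
    and "p (x + s *\<^sub>R axis i 1) - trig F b (x + s *\<^sub>R axis i 1) $ 1 = p x - trig F b x $ 1"
proof -
  \<comment> \<open>\<open>r\<close> collects what \<open>b\<close> cannot integrate: the modes of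
    the i-th derivative that are constant along the i-th axis. Scalars again occupy both
    components.\<close>
  define r where "r k = (\<chi> j :: 2. if k $ i = 0 then g k $ i else 0)" for k
  have r: "hermitian r" using g by (simp add: hermitian_def r_def)
  have inv: "trig F r (x + s *\<^sub>R axis i 1) = trig F r x" for x s
  proof -
    have "trig F r (x + s *\<^sub>R axis i 1) = trig F (\<lambda>k. \<chi> j. cis (wave k \<bullet> (s *\<^sub>R axis i 1)) * r k $ j) x"
      by (rule trig_shift)
    also have "(\<lambda>k. \<chi> j. cis (wave k \<bullet> (s *\<^sub>R axis i 1)) * r k $ j) = r"
      by (auto simp: fun_eq_iff vec_eq_iff r_def wave_def inner_axis)
    finally show ?thesis .
  qed
  have lin: "p (x + s *\<^sub>R axis i 1) - trig F b (x + s *\<^sub>R axis i 1) $ 1 - s * trig F r x $ 1 = p x - trig F b x $ 1" for x s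
  proof -
    define f where "f s = p (x + s *\<^sub>R axis i 1) - trig F b (x + s *\<^sub>R axis i 1) $ 1 - s * trig F r x $ 1" for s
    have line: "((\<lambda>s. x + s *\<^sub>R axis i 1) has_derivative (\<lambda>h. h *\<^sub>R axis i 1)) (at s)" for s
      by (auto intro!: derivative_eq_intros)
    have "(f has_derivative (\<lambda>h. h * 0)) (at s)" for s
    proof -
      let ?y = "x + s *\<^sub>R axis i 1"
      have 1: "((\<lambda>s. p (x + s *\<^sub>R axis i 1)) has_derivative (\<lambda>h. (h *\<^sub>R axis i 1) \<bullet> trig F g ?y)) (at s)"
        using has_derivative_compose[OF line grad[of ?y, unfolded gderiv_def]] .
      have 2: "((\<lambda>s. trig F b (x + s *\<^sub>R axis i 1) $ 1) has_derivative
          (\<lambda>h. Re (\<Sum>k\<in>F. (wave k \<bullet> (h *\<^sub>R axis i 1)) * (\<i> * b k $ 1 * cis (wave k \<bullet> ?y))))) (at s)"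
        using has_derivative_compose[OF line bounded_linear.has_derivative[OF bounded_linear_vec_nth[of 1] has_derivative_trig[of F b ?y]]] by simp
      have 3: "(h *\<^sub>R axis i 1) \<bullet> trig F g ?y - Re (\<Sum>k\<in>F. (wave k \<bullet> (h *\<^sub>R axis i 1)) * (\<i> * b k $ 1 * cis (wave k \<bullet> ?y)))
         = h * trig F r x $ 1" for h
      proof -
        have "trig F r x $ 1 = trig F r ?y $ 1" by (simp add: inv)
        also have "trig F r ?y $ 1 = trig F g ?y $ i - Re (\<Sum>k\<in>F. of_int (k $ i) * (\<i> * b k $ 1 * cis (wave k \<bullet> ?y)))"
          unfolding trig_def vec_lambda_beta minus_complex.sel(1)[symmetric] sum_subtractf[symmetric]
          by (intro arg_cong[of _ _ Re] sum.cong refl) (auto simp: r_def b_def field_simps)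
        finally have "trig F r x $ 1 = trig F g ?y $ i - Re (\<Sum>k\<in>F. of_int (k $ i) * (\<i> * b k $ 1 * cis (wave k \<bullet> ?y)))" .
        moreover have "(\<Sum>k\<in>F. (wave k \<bullet> (h *\<^sub>R axis i 1)) * (\<i> * b k $ 1 * cis (wave k \<bullet> ?y))) =
           of_real h * (\<Sum>k\<in>F. of_int (k $ i) * (\<i> * b k $ 1 * cis (wave k \<bullet> ?y)))"
          unfolding sum_distrib_left by (intro sum.cong refl) (simp add: wave_def inner_axis)
        moreover have "Re (of_real h * z) = h * Re z" for z by simp
        ultimately show ?thesis by (simp only: inner_scaleR_left inner_axis inner_commute[of "axis i 1" "trig F g ?y"] right_diff_distrib inner_real_def mult_1_right)
      qed
      have "(f has_derivative (\<lambda>h. ((h *\<^sub>R axis i 1) \<bullet> trig F g ?y - 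
          Re (\<Sum>k\<in>F. (wave k \<bullet> (h *\<^sub>R axis i 1)) * (\<i> * b k $ 1 * cis (wave k \<bullet> ?y)))) - h * trig F r x $ 1)) (at s)"
        unfolding f_def by (intro has_derivative_diff 1 2 has_derivative_mult_left has_derivative_ident)
      then show ?thesis unfolding 3 by simp
    qed
    then have "(f has_real_derivative 0) (at s)" for s
      by (simp add: has_field_derivative_def lambda_zero)
    then have "f s = f 0" using DERIV_isconst_all[of f] by blast
    then show ?thesis unfolding f_def by simp
  qed
  have r0: "trig F r x $ 1 = 0" for x
  proof -
    \<comment> \<open>After a full period \<open>p\<close> and \<open>trig F b\<close> return to
      their values, so the linear term \<open>2 * pi * trig F r x $ 1\<close> has to vanish.\<close>
    have "x + (2 * pi) *\<^sub>R axis i 1 = x + axis i (2 * pi)" by (simp add: vec_eq_iff axis_def)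
    then show ?thesis
      using lin[of x "2 * pi"] p periodic_trig[of F b] by (simp add: periodic_def)
  qed
  show "p (x + s *\<^sub>R axis i 1) - trig F b (x + s *\<^sub>R axis i 1) $ 1 = p x - trig F b x $ 1"
    using lin[of x s] by (simp add: r0)
  assume k: "k \<in> F" "k $ i = 0"
  have "trig F r x = trig F (\<lambda>k. 0) x" for x
  proof -
    have "trig F r x $ j = trig F r x $ 1" for j by (simp only: trig_def vec_lambda_beta r_def)
    then show ?thesis by (simp add: vec_eq_iff r0) (simp add: trig_def)
  qed
  then have "r k = 0"
    by (intro trig_unique[OF F r, of "\<lambda>k. 0"] k) (auto simp: hermitian_def)
  then show "g k $ i = 0" using k by (simp add: r_def vec_eq_iff)
qed

text \<open>Curl-freeness is read off from one primitive. Subtracting from \<open>p\<close> the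
  primitive of its first derivative leaves a function \<open>D\<close> that is constant along the
  first axis, and so is the second partial derivative of \<open>D\<close>. That derivative has
  coefficients \<open>h\<close>, which must vanish for \<open>k $ 1 \<noteq> 0\<close>.\<close>

lemma trig_gradient:
  assumes F: "symmetric F" and g: "hermitian g" and p: "periodic p"
    and grad: "\<And>x. GDERIV p x :> trig F g x" and k: "k \<in> F"
  shows "of_int (k $ 1) * g k $ 2 = of_int (k $ 2) * g k $ 1" "k $ 2 = 0 \<Longrightarrow> g k $ 2 = 0"
proof -
  define b where "b k = (\<chi> j :: 2. if k $ 1 = 0 then 0 else g k $ 1 / (\<i> * of_int (k $ 1)))" for k :: "int^2"
  define D where "D x = p x - trig F b x $ 1" for x
  define h where "h k = (\<chi> j :: 2. g k $ 2 - \<i> * of_int (k $ 2) * b k $ 1)" for k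
  have h: "hermitian h" using g by (simp add: hermitian_def h_def b_def)
  have D: "D (x + s *\<^sub>R axis 1 1) = D x" for x s
    unfolding D_def b_def by (rule trig_gradient_axis(2)[OF F g p grad])
  have D': "(D has_derivative (\<lambda>v. v \<bullet> trig F g x - Re (\<Sum>k\<in>F. (wave k \<bullet> v) * (\<i> * b k $ 1 * cis (wave k \<bullet> x))))) (at x)" for x
    unfolding D_def
    using has_derivative_diff[OF grad[unfolded gderiv_def] bounded_linear.has_derivative[OF bounded_linear_vec_nth[of 1] has_derivative_trig[of F b]]]
    by simp
  have D2: "frechet_derivative D (at x) (axis 2 1) = trig F h x $ j" for x j
  proof -
    have "frechet_derivative D (at x) (axis 2 1) = 
       axis 2 1 \<bullet> trig F g x - Re (\<Sum>k\<in>F. (wave k \<bullet> axis 2 1) * (\<i> * b k $ 1 * cis (wave k \<bullet> x)))"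
      by (rule fun_cong[OF frechet_derivative_at[OF D', symmetric]])
    also have "\<dots> = trig F h x $ j"
    proof -
      have "trig F h x $ j = Re ((\<Sum>k\<in>F. g k $ 2 * cis (wave k \<bullet> x)) - (\<Sum>k\<in>F. (wave k \<bullet> axis 2 1) * (\<i> * b k $ 1 * cis (wave k \<bullet> x))))"
        unfolding trig_def vec_lambda_beta sum_subtractf[symmetric]
        by (intro arg_cong[of _ _ Re] sum.cong refl) (simp add: h_def inner_axis wave_def algebra_simps)
      moreover have "axis 2 1 \<bullet> v = v $ 2" for v :: "real^2"
        by (simp add: inner_axis inner_commute[of "axis 2 1"])
      ultimately show ?thesis by (simp only: minus_complex.sel trig_def vec_lambda_beta)
    qed
    finally show ?thesis .
  qed
  have "frechet_derivative D (at (x + s *\<^sub>R axis 1 1)) = frechet_derivative D (at x)" for x s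
  proof -
    have "((\<lambda>y. D (y + s *\<^sub>R axis 1 1)) has_derivative (\<lambda>v. frechet_derivative D (at (x + s *\<^sub>R axis 1 1)) v)) (at x)"
    proof (rule has_derivative_compose[of "\<lambda>y. y + s *\<^sub>R axis 1 1" "\<lambda>v. v" x UNIV D])
      show "((\<lambda>y. y + s *\<^sub>R axis 1 1) has_derivative (\<lambda>v. v)) (at x)"
        by (auto intro!: derivative_eq_intros)
      show "(D has_derivative (\<lambda>v. frechet_derivative D (at (x + s *\<^sub>R axis 1 1)) v)) (at (x + s *\<^sub>R axis 1 1))"
        using D'[of "x + s *\<^sub>R axis 1 1"] unfolding frechet_derivative_at[OF D'[of "x + s *\<^sub>R axis 1 1"], symmetric] .
    qed
    then have "(D has_derivative frechet_derivative D (at (x + s *\<^sub>R axis 1 1))) (at x)" by (simp add: D)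
    then show ?thesis by (rule frechet_derivative_at)
  qed
  then have "trig F h (x + s *\<^sub>R axis 1 1) = trig F h x" for x s
    unfolding vec_eq_iff D2[symmetric] by simp
  then have "k $ 1 \<noteq> 0 \<Longrightarrow> h k = 0"
    using trig_translation_invariant[OF F h _ k] by blast
  moreover have "k $ 1 = 0 \<Longrightarrow> g k $ 1 = 0"
    by (rule trig_gradient_axis(1)[OF F g p grad k])
  ultimately show "of_int (k $ 1) * g k $ 2 = of_int (k $ 2) * g k $ 1"
    by (cases "k $ 1 = 0") (simp_all add: h_def b_def vec_eq_iff field_simps)
  show "k $ 2 = 0 \<Longrightarrow> g k $ 2 = 0"
    by (rule trig_gradient_axis(1)[OF F g p grad k])
qed

section \<open>Energy, enstrophy and coefficient bounds for the Galerkin system\<close>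

lemma trig_cong: "(\<And>k. k \<in> F \<Longrightarrow> a k = b k) \<Longrightarrow> trig F a = trig F b"
  unfolding trig_def by (intro ext arg_cong[of _ _ vec_lambda] arg_cong[of _ _ Re] sum.cong refl) simp

section \<open>Conservation of energy and enstrophy by the truncated convection\<close>

lemma cdot_add: "cdot a (k + l) = cdot a k + cdot a l"
  and cdot_minus: "cdot a (- k) = - cdot a k"
  by (simp_all add: cdot_def UNIV_2 algebra_simps)

lemma inner_complex_vec: "x \<bullet> y = Re (\<Sum>j\<in>UNIV. x $ j * cnj (y $ j))" for x y :: "complex^2"
  by (simp add: inner_vec_def inner_complex_def)

text \<open>Up to a factor \<open>\<i>\<close> this is the vorticity coefficient: the scalar curl of
  the mode with wave vector \<open>k\<close> and amplitude \<open>a\<close>.\<close>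

definition cross :: "int^2 \<Rightarrow> complex^2 \<Rightarrow> complex" where
  "cross k a = of_int (k $ 1) * a $ 2 - of_int (k $ 2) * a $ 1"

text \<open>The summand is antisymmetric under the exchange of q and r: on a triad
  \<open>q + r = - p\<close>, so \<open>cdot (c p) q\<close> and \<open>cdot (c p) r\<close> add up
  to \<open>- cdot (c p) p\<close>, which is zero. The scalar \<open>w\<close> later stands for a
  velocity component or for the vorticity.\<close>

lemma triad_sum_zero:
  assumes "\<And>p. p \<in> F \<Longrightarrow> cdot (c p) p = 0"
  shows "(\<Sum>p\<in>F. \<Sum>q\<in>F. \<Sum>r\<in>F. if p + q + r = 0 then cdot (c p) q * (w q * w r) else 0) = 0"
    (is "?S = 0")
proof -
  define f where "f p q r = (if p + q + r = 0 then cdot (c p) q * (w q * w r) else 0)" for p q r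
  have "?S = (\<Sum>p\<in>F. \<Sum>q\<in>F. \<Sum>r\<in>F. f p r q)"
    unfolding f_def[symmetric] by (intro sum.cong refl sum.swap)
  then have "?S + ?S = (\<Sum>p\<in>F. \<Sum>q\<in>F. \<Sum>r\<in>F. f p q r + f p r q)"
    unfolding f_def[symmetric] sum.distrib by simp
  also have "\<dots> = 0"
  proof (intro sum.neutral ballI)
    fix p q r assume "p \<in> F"
    show "f p q r + f p r q = 0"
    proof (cases "p + q + r = 0")
      case True
      then have "q + r = - p" by (simp add: eq_neg_iff_add_eq_0 add_ac)
      then have "cdot (c p) q + cdot (c p) r = 0"
        using assms[OF \<open>p \<in> F\<close>] cdot_add[of "c p" q r] cdot_minus[of "c p" p] by simp
      moreover have "p + r + q = 0" using True by (simp add: add_ac)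
      ultimately show ?thesis using True by (simp add: f_def algebra_simps flip: distrib_left distrib_right)
    next
      case False
      then show ?thesis by (simp add: f_def add_ac)
    qed
  qed
  finally show ?thesis by simp
qed

text \<open>Reflecting \<open>k\<close> turns the pairing with \<open>cnj (w k)\<close> into a sum
  over triads. In physical terms, transport by a divergence-free field preserves the square integral
  of a scalar; truncation keeps this because all three indices range over the same symmetric
  set.\<close>

lemma transport_sum_zero:
  assumes F: "symmetric F" and "\<And>p. p \<in> F \<Longrightarrow> cdot (c p) p = 0" and w: "\<And>k. w (- k) = cnj (w k)"
  shows "(\<Sum>k\<in>F. (\<Sum>p\<in>F. \<Sum>q\<in>F. if p + q = k then cdot (c p) q * w q else 0) * cnj (w k)) = 0"
proof -
  have "(\<Sum>k\<in>F. (\<Sum>p\<in>F. \<Sum>q\<in>F. if p + q = k then cdot (c p) q * w q else 0) * cnj (w k)) =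
     (\<Sum>k\<in>F. (\<Sum>p\<in>F. \<Sum>q\<in>F. if p + q = - k then cdot (c p) q * w q else 0) * cnj (w (- k)))"
    by (rule sum_symmetric[OF F, symmetric])
  also have "\<dots> = (\<Sum>r\<in>F. \<Sum>p\<in>F. \<Sum>q\<in>F. if p + q + r = 0 then cdot (c p) q * (w q * w r) else 0)"
    unfolding sum_distrib_right by (intro sum.cong refl) (simp add: w eq_neg_iff_add_eq_0)
  also have "\<dots> = (\<Sum>p\<in>F. \<Sum>r\<in>F. \<Sum>q\<in>F. if p + q + r = 0 then cdot (c p) q * (w q * w r) else 0)"
    by (rule sum.swap)
  also have "\<dots> = (\<Sum>p\<in>F. \<Sum>q\<in>F. \<Sum>r\<in>F. if p + q + r = 0 then cdot (c p) q * (w q * w r) else 0)"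
    by (intro sum.cong refl sum.swap)
  also have "\<dots> = 0" by (rule triad_sum_zero) fact
  finally show ?thesis .
qed

text \<open>Each velocity component is a scalar transported by the field itself.\<close>

lemma conv_energy:
  assumes F: "symmetric F" and c: "hermitian c" and div: "\<And>p. p \<in> F \<Longrightarrow> cdot (c p) p = 0"
  shows "(\<Sum>k\<in>F. conv F c k \<bullet> c k) = 0"
proof -
  have "(\<Sum>k\<in>F. conv F c k $ j * cnj (c k $ j)) = 0" for j
  proof -
    have "(\<Sum>k\<in>F. conv F c k $ j * cnj (c k $ j)) =
      \<i> * (\<Sum>k\<in>F. (\<Sum>p\<in>F. \<Sum>q\<in>F. if p + q = k then cdot (c p) q * c q $ j else 0) * cnj (c k $ j))"
      unfolding conv_def vec_lambda_beta sum_distrib_left sum_distrib_right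
      by (intro sum.cong refl) simp
    also have "\<dots> = 0"
      using transport_sum_zero[OF F div, of "\<lambda>k. c k $ j"] c by (simp add: hermitian_def)
    finally show ?thesis .
  qed
  then show ?thesis
    by (simp only: inner_complex_vec Re_sum[symmetric], subst sum.swap) simp
qed

text \<open>With \<open>a\<close> and \<open>b\<close> the amplitudes of the modes \<open>p\<close>
  and \<open>q\<close>, the two terms are the contributions of (p, q) and (q, p) that are not
  transport. Their sum is a combination of the divergences \<open>cdot a p\<close> and
  \<open>cdot b q\<close>, so it cancels.\<close>

lemma cdot_cross_swap:
  assumes "cdot a p = 0" "cdot b q = 0"
  shows "cdot a q * cross p b + cdot b p * cross q a = 0"
proof -
  have "cdot a q * cross p b + cdot b p * cross q a =
    cdot a p * (b $ 2 * of_int (q $ 1) - b $ 1 * of_int (q $ 2)) + cdot b q * (a $ 2 * of_int (p $ 1) - a $ 1 * of_int (p $ 2))"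
    by (simp add: cdot_def cross_def UNIV_2 algebra_simps)
  then show ?thesis using assms by simp
qed

text \<open>For p + q = k the factor \<open>cross k (c q)\<close> splits into
  \<open>cross p (c q)\<close> and \<open>cross q (c q)\<close>. The first part cancels on
  exchanging p and q; the second is transport of the vorticity.\<close>

lemma cross_conv:
  assumes "\<And>p. p \<in> F \<Longrightarrow> cdot (c p) p = 0"
  shows "cross k (conv F c k) = \<i> * (\<Sum>p\<in>F. \<Sum>q\<in>F. if p + q = k then cdot (c p) q * cross q (c q) else 0)"
proof -
  define f where "f p q = (if p + q = k then cdot (c p) q * cross p (c q) else 0)" for p q
  have "(\<Sum>p\<in>F. \<Sum>q\<in>F. f p q) + (\<Sum>p\<in>F. \<Sum>q\<in>F. f p q) = (\<Sum>p\<in>F. \<Sum>q\<in>F. f p q) + (\<Sum>p\<in>F. \<Sum>q\<in>F. f q p)"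
    by (simp only: sum.swap[of f])
  also have "\<dots> = (\<Sum>p\<in>F. \<Sum>q\<in>F. f p q + f q p)" by (simp only: sum.distrib)
  also have "\<dots> = 0"
    using cdot_cross_swap assms by (intro sum.neutral ballI) (auto simp: f_def add.commute)
  finally have 0: "(\<Sum>p\<in>F. \<Sum>q\<in>F. f p q) = 0" by simp
  have "cross k (conv F c k) = (\<Sum>p\<in>F. \<Sum>q\<in>F. if p + q = k then \<i> * cdot (c p) q * cross k (c q) else 0)"
    unfolding cross_def conv_def vec_lambda_beta sum_distrib_left sum_subtractf[symmetric]
    by (intro sum.cong refl) (simp add: algebra_simps)
  also have "\<dots> = \<i> * (\<Sum>p\<in>F. \<Sum>q\<in>F. f p q + (if p + q = k then cdot (c p) q * cross q (c q) else 0))"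
    unfolding sum_distrib_left
    by (intro sum.cong refl) (auto simp: f_def cross_def algebra_simps)
  also have "\<dots> = \<i> * (\<Sum>p\<in>F. \<Sum>q\<in>F. if p + q = k then cdot (c p) q * cross q (c q) else 0)"
    by (simp add: sum.distrib 0)
  finally show ?thesis .
qed

lemma norm_wave_sq: "(norm (wave k))\<^sup>2 = (of_int (k $ 1))\<^sup>2 + (of_int (k $ 2))\<^sup>2"
  by (simp add: norm_vec2_sq UNIV_2 wave_def)

text \<open>In two dimensions the weight \<open>|k|\<^sup>2\<close> turns the velocity pairing into the vorticity pairing
  (Lagrange's identity), and the vorticity is transported without stretching.\<close>

lemma conv_enstrophy:
  assumes F: "symmetric F" and c: "hermitian c" and div: "\<And>p. p \<in> F \<Longrightarrow> cdot (c p) p = 0"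
  shows "(\<Sum>k\<in>F. (norm (wave k))\<^sup>2 * (conv F c k \<bullet> c k)) = 0"
proof -
  have lagrange: "(norm (wave k))\<^sup>2 * (a \<bullet> b) = Re (cross k a * cnj (cross k b))" if "cdot b k = 0" for k a b
  proof -
    have "cross k a * cnj (cross k b) =
      ((of_int (k $ 1))\<^sup>2 + (of_int (k $ 2))\<^sup>2) * (\<Sum>j\<in>UNIV. a $ j * cnj (b $ j)) - cdot a k * cnj (cdot b k)"
      by (simp add: cross_def cdot_def UNIV_2 power2_eq_square algebra_simps)
    also have "(of_int (k $ 1))\<^sup>2 + (of_int (k $ 2))\<^sup>2 = complex_of_real ((norm (wave k))\<^sup>2)"
      by (simp add: norm_wave_sq)
    finally have "cross k a * cnj (cross k b) = complex_of_real ((norm (wave k))\<^sup>2) * (\<Sum>j\<in>UNIV. a $ j * cnj (b $ j))"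
      using that by simp
    moreover have "Re (of_real r * z) = r * Re z" for r z by simp
    ultimately show ?thesis unfolding inner_complex_vec by (simp only:)
  qed
  \<comment> \<open>Reflection sends \<open>cross k (c k)\<close> to minus its conjugate. The factor
    \<open>\<i>\<close> corrects the sign, as the reality condition of
    \<open>transport_sum_zero\<close> requires.\<close>
  define w where "w k = \<i> * cross k (c k)" for k
  have w: "w (- k) = cnj (w k)" for k
    using c by (simp add: w_def cross_def hermitian_def algebra_simps)
  have "cross k (conv F c k) = (\<Sum>p\<in>F. \<Sum>q\<in>F. if p + q = k then cdot (c p) q * w q else 0)" for k
  proof -
    have "cross k (conv F c k) = \<i> * (\<Sum>p\<in>F. \<Sum>q\<in>F. if p + q = k then cdot (c p) q * cross q (c q) else 0)"
      by (rule cross_conv) (rule div)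
    also have "\<dots> = (\<Sum>p\<in>F. \<Sum>q\<in>F. if p + q = k then cdot (c p) q * w q else 0)"
      unfolding sum_distrib_left by (intro sum.cong refl) (simp add: w_def)
    finally show ?thesis .
  qed
  moreover have "cnj (cross k (c k)) = \<i> * cnj (w k)" for k by (simp add: w_def)
  ultimately have "(\<Sum>k\<in>F. cross k (conv F c k) * cnj (cross k (c k))) =
    \<i> * (\<Sum>k\<in>F. (\<Sum>p\<in>F. \<Sum>q\<in>F. if p + q = k then cdot (c p) q * w q else 0) * cnj (w k))"
    by (simp add: sum_distrib_left mult_ac)
  also have "(\<Sum>k\<in>F. (\<Sum>p\<in>F. \<Sum>q\<in>F. if p + q = k then cdot (c p) q * w q else 0) * cnj (w k)) = 0"
    by (rule transport_sum_zero[OF F]) (rule div, assumption, rule w)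
  finally have "Re (\<Sum>k\<in>F. cross k (conv F c k) * cnj (cross k (c k))) = 0" by (simp only: mult_zero_right zero_complex.sel)
  then show ?thesis by (simp add: lagrange div)
qed

lemma norm_cdot_le: "norm (cdot a k) \<le> norm a * norm (wave k)"
proof -
  have "norm (cdot a k) \<le> (\<Sum>i\<in>UNIV. \<bar>norm (a $ i)\<bar> * \<bar>wave k $ i\<bar>)"
    unfolding cdot_def by (rule order_trans[OF norm_sum]) (simp add: norm_mult wave_def)
  also have "\<dots> \<le> L2_set (\<lambda>i. norm (a $ i)) UNIV * L2_set (\<lambda>i. wave k $ i) UNIV"
    by (rule L2_set_mult_ineq)
  also have "\<dots> = norm a * norm (wave k)" by (simp add: norm_vec_def L2_set_def)
  finally show ?thesis .
qed

lemma norm_vec_scale: "norm (\<chi> j. z * v $ j) = norm z * norm v" for z :: complex and v :: "complex^2"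
proof -
  have "(norm (\<chi> j. z * v $ j))\<^sup>2 = (norm z * norm v)\<^sup>2"
    by (simp add: norm_vec2_sq norm_mult power_mult_distrib sum_distrib_left)
  then show ?thesis by (rule power2_eq_imp_eq) simp_all
qed

text \<open>Incompressibility moves the derivative from \<open>q\<close> to the output:
  \<open>cdot (c p) q = cdot (c p) k\<close> when p + q = k. Each \<open>p\<close> meets at most one
  \<open>q\<close>, so the energy suffices as a bound, and no power of the resolution
  enters.\<close>

lemma norm_conv_le:
  assumes fin: "finite F" and div: "\<And>p. p \<in> F \<Longrightarrow> cdot (c p) p = 0"
  shows "norm (conv F c k) \<le> norm (wave k) * (\<Sum>p\<in>F. (norm (c p))\<^sup>2)"
proof -
  define B where "B p q = (if p + q = k then norm (wave k) * ((norm (c p))\<^sup>2 / 2 + (norm (c q))\<^sup>2 / 2) else 0)" for p q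
  have "conv F c k = (\<Sum>p\<in>F. \<Sum>q\<in>F. if p + q = k then (\<chi> j. (\<i> * cdot (c p) q) * c q $ j) else 0)"
    unfolding conv_def
    by (subst vec_eq_iff, intro allI, simp only: vec_lambda_beta sum_component, intro sum.cong refl) simp
  also have "norm \<dots> \<le> (\<Sum>p\<in>F. \<Sum>q\<in>F. B p q)"
  proof (intro sum_norm_le)
    fix p q assume p: "p \<in> F"
    show "norm (if p + q = k then (\<chi> j. (\<i> * cdot (c p) q) * c q $ j) else 0) \<le> B p q"
    proof (cases "p + q = k")
      case True
      have "cdot (c p) q = cdot (c p) k" using div[OF p] cdot_add[of "c p" p q] True by simp
      then have "norm (\<chi> j. (\<i> * cdot (c p) q) * c q $ j) \<le> (norm (c p) * norm (wave k)) * norm (c q)"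
        unfolding norm_vec_scale using norm_cdot_le[of "c p" k] by (simp add: norm_mult mult_right_mono)
      also have "\<dots> = norm (wave k) * (norm (c p) * norm (c q))" by simp
      also have "\<dots> \<le> norm (wave k) * ((norm (c p))\<^sup>2 / 2 + (norm (c q))\<^sup>2 / 2)"
        using sum_squares_bound[of "norm (c p)" "norm (c q)"] by (intro mult_left_mono) auto
      finally show ?thesis using True by (simp add: B_def)
    qed (simp add: B_def)
  qed
  also have "\<dots> = (\<Sum>p\<in>F. \<Sum>q\<in>F. if q = k - p then norm (wave k) * (norm (c p))\<^sup>2 / 2 else 0) +
     (\<Sum>p\<in>F. \<Sum>q\<in>F. if p = k - q then norm (wave k) * (norm (c q))\<^sup>2 / 2 else 0)"
    unfolding sum.distrib[symmetric] by (intro sum.cong refl) (auto simp: B_def algebra_simps)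
  also have "\<dots> \<le> (\<Sum>p\<in>F. norm (wave k) * (norm (c p))\<^sup>2 / 2) + (\<Sum>q\<in>F. norm (wave k) * (norm (c q))\<^sup>2 / 2)"
  proof (rule add_mono)
    show "(\<Sum>p\<in>F. \<Sum>q\<in>F. if q = k - p then norm (wave k) * (norm (c p))\<^sup>2 / 2 else 0) \<le> (\<Sum>p\<in>F. norm (wave k) * (norm (c p))\<^sup>2 / 2)"
      using fin by (intro sum_mono) simp
    show "(\<Sum>p\<in>F. \<Sum>q\<in>F. if p = k - q then norm (wave k) * (norm (c q))\<^sup>2 / 2 else 0) \<le> (\<Sum>q\<in>F. norm (wave k) * (norm (c q))\<^sup>2 / 2)"
      using fin by (subst sum.swap, intro sum_mono) simp
  qed
  also have "\<dots> = norm (wave k) * (\<Sum>p\<in>F. (norm (c p))\<^sup>2)"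
    by (simp add: sum_distrib_left flip: sum.distrib)
  finally show ?thesis .
qed

text \<open>The first hypothesis makes \<open>g\<close> parallel to a nonzero \<open>k\<close>,
  while \<open>a\<close> is orthogonal to \<open>k\<close>. The two conditions on vanishing
  components settle \<open>k = 0\<close>, where the first one says nothing.\<close>

lemma gradient_orthogonal:
  assumes "of_int (k $ 1) * g $ 2 = of_int (k $ 2) * g $ 1" "k $ 1 = 0 \<Longrightarrow> g $ 1 = 0" "k $ 2 = 0 \<Longrightarrow> g $ 2 = 0"
    and "cdot a k = 0"
  shows "g \<bullet> a = 0"
proof -
  have a: "a $ 1 * of_int (k $ 1) = - (a $ 2 * of_int (k $ 2))"
    using assms(4) by (simp add: cdot_def UNIV_2 eq_neg_iff_add_eq_0)
  have "g $ 1 * cnj (a $ 1) + g $ 2 * cnj (a $ 2) = 0"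
  proof (cases "k $ 1 = 0")
    case True
    then show ?thesis using assms(2,3) a by (cases "k $ 2 = 0") auto
  next
    case False
    have "of_int (k $ 1) * (g $ 1 * cnj (a $ 1) + g $ 2 * cnj (a $ 2)) =
      g $ 1 * cnj (a $ 1 * of_int (k $ 1)) + (of_int (k $ 1) * g $ 2) * cnj (a $ 2)"
      by (simp add: algebra_simps)
    also have "\<dots> = 0" unfolding a assms(1) by (simp add: algebra_simps)
    finally show ?thesis using False by simp
  qed
  then have "(\<Sum>j\<in>UNIV. g $ j * cnj (a $ j)) = 0" by (simp add: UNIV_2)
  then show ?thesis unfolding inner_complex_vec by (simp only: zero_complex.sel)
qed

text \<open>What later sections use of a solution, with the pressure eliminated: energy balance,
  enstrophy balance, and a bound on the time derivative of each coefficient.\<close>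

definition sv_coefficients ::
  "real \<Rightarrow> nat \<Rightarrow> real \<Rightarrow> (int^2 \<Rightarrow> real) \<Rightarrow> (real \<Rightarrow> int^2 \<Rightarrow> complex^2) \<Rightarrow> (real \<Rightarrow> int^2 \<Rightarrow> complex^2) \<Rightarrow> bool" where
  "sv_coefficients T N \<nu> q c d \<longleftrightarrow>
    (\<forall>t. hermitian (c t)) \<and> (\<forall>t k. k \<notin> modes N \<longrightarrow> c t k = 0) \<and>
    (\<forall>t\<in>{0..T}.
      (\<forall>k. ((\<lambda>s. c s k) has_vector_derivative d t k) (at t within {0..T})) \<and>
      (\<Sum>k\<in>modes N. c t k \<bullet> d t k) = - \<nu> * (\<Sum>k\<in>modes N. q k * (norm (wave k))\<^sup>2 * (norm (c t k))\<^sup>2) \<and>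
      (\<Sum>k\<in>modes N. (norm (wave k))\<^sup>2 * (c t k \<bullet> d t k)) =
        - \<nu> * (\<Sum>k\<in>modes N. q k * (norm (wave k))^4 * (norm (c t k))\<^sup>2) \<and>
      (\<forall>k. norm (d t k) \<le>
        \<bar>\<nu> * q k\<bar> * (norm (wave k))\<^sup>2 * norm (c t k) + norm (wave k) * (\<Sum>p\<in>modes N. (norm (c t p))\<^sup>2)))"

lemma SV_solution_sv_coefficients:
  assumes T: "T > 0" and sol: "SV_solution T N \<nu> Q u\<^sub>0 u"
  obtains c d where "sv_coefficients T N \<nu> (sym_mult Q) c d" "\<And>t. t \<in> {0..T} \<Longrightarrow> u t = trig (modes N) (c t)"
proof -
  define F where "F = modes N"
  define n where "n = 2 * N + 1"
  have F: "symmetric F" "finite F" by (simp_all add: F_def symmetric_modes finite_modes)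
  obtain v p gradp where per: "\<And>t. t \<in> {0..T} \<Longrightarrow> periodic (p t)"
    and dt: "\<And>t x. t \<in> {0..T} \<Longrightarrow> ((\<lambda>s. u s x) has_vector_derivative v t x) (at t within {0..T})"
    and gp: "\<And>t x. t \<in> {0..T} \<Longrightarrow> GDERIV (p t) x :> gradp t x"
    and eq: "\<And>t x. t \<in> {0..T} \<Longrightarrow> v t x + fourier_proj N (convection (u t)) x + gradp t x =
                \<nu> *\<^sub>R laplacian (fourier_mult N Q (u t)) x"
    using sol unfolding SV_solution_def by metis
  have proj: "\<And>t. t \<in> {0..T} \<Longrightarrow> u t = fourier_proj N (u t)"
    and div0: "\<And>t x. t \<in> {0..T} \<Longrightarrow> divergence (u t) x = 0"
    using sol unfolding SV_solution_def by blast+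
  \<comment> \<open>Defined from point values so that \<open>dt\<close> yields the derivative
    \<open>d\<close>; at times in \<open>{0..T}\<close> these are the Fourier coefficients of
    \<open>u t\<close>.\<close>
  define c where "c t k = (if k \<in> F then dft n (u t) k else 0)" for t k
  define d where "d t k = (if k \<in> F then dft n (v t) k else 0)" for t k
  have sym_F: "- k \<in> F \<longleftrightarrow> k \<in> F" for k by (simp add: F_def modes_iff)
  have herm_c: "hermitian (c t)" and herm_d: "hermitian (d t)" for t
    using hermitian_dft[of n "u t"] hermitian_dft[of n "v t"] by (simp_all add: hermitian_def c_def d_def sym_F)
  have c_fourier: "c t k = fourier_coeff (u t) k" if "t \<in> {0..T}" "k \<in> F" for t k
    using that dft_trig[OF hermitian_fourier_coeff, of k N "u t"] proj[OF that(1)]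
    by (simp add: c_def F_def n_def fourier_proj_eq)
  have u: "u t = trig F (c t)" if "t \<in> {0..T}" for t
  proof -
    have "trig F (fourier_coeff (u t)) = trig F (c t)"
      by (rule trig_cong) (simp add: c_fourier[OF that])
    then show ?thesis using proj[OF that] by (simp add: fourier_proj_eq F_def)
  qed
  have deriv: "((\<lambda>s. c s k) has_vector_derivative d t k) (at t within {0..T})" if "t \<in> {0..T}" for t k
    using has_vector_derivative_dft[of u "v t", OF dt[OF that]] by (cases "k \<in> F") (simp_all add: c_def d_def)
  have unique: "a = b" if "(f has_vector_derivative a) (at t within {0..T})" "(f has_vector_derivative b) (at t within {0..T})" "t \<in> {0..T}"
    for f :: "real \<Rightarrow> 'z::real_normed_vector" and a b t
    using vector_derivative_unique_within_closed_interval[of 0 T t f a b] T that by simp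
  have v: "v t x = trig F (d t) x" if "t \<in> {0..T}" for t x
  proof (rule unique[OF dt[OF that] _ that])
    have "((\<lambda>s. trig F (c s) x) has_vector_derivative trig F (d t) x) (at t within {0..T})"
      by (rule has_vector_derivative_trig) (rule deriv[OF that])
    then show "((\<lambda>s. u s x) has_vector_derivative trig F (d t) x) (at t within {0..T})"
      by (rule has_vector_derivative_transform[OF that, rotated]) (simp add: u)
  qed
  have div_c: "cdot (c t k) k = 0" if "t \<in> {0..T}" "k \<in> F" for t k
    using divergence_trig[OF F(1) herm_c _ that(2)] div0[OF that(1)] u[OF that(1)] by metis
  have div_d: "cdot (d t k) k = 0" if "t \<in> {0..T}" "k \<in> F" for t k
  proof (rule unique[OF _ _ that(1)])
    show "((\<lambda>s. cdot (c s k) k) has_vector_derivative cdot (d t k) k) (at t within {0..T})"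
      unfolding cdot_def
      by (intro has_vector_derivative_sum has_vector_derivative_mult_left
          bounded_linear.has_vector_derivative[OF bounded_linear_vec_nth] deriv that)
    show "((\<lambda>s. cdot (c s k) k) has_vector_derivative 0) (at t within {0..T})"
      by (rule has_vector_derivative_transform[OF that(1) _ has_vector_derivative_const[of 0]]) (simp add: div_c that)
  qed
  define r where "r k = \<nu> * sym_mult Q k * (norm (wave k))\<^sup>2" for k
  \<comment> \<open>The pressure gradient, solved for from the equation. All other terms are
    trigonometric polynomials over \<open>F\<close>, hence so is the gradient, although
    \<open>p\<close> itself is only known to be periodic and differentiable.\<close>
  define g where "g t k = - r k *\<^sub>R c t k - d t k - conv F (c t) k" for t k
  have r_sym: "r (- k) = r k" for k by (simp add: r_def sym_mult_def wave_minus add.commute)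
  have herm_conv: "hermitian (conv F (c t))" for t
  proof -
    have "fourier_coeff (convection (trig F (c t))) = conv F (c t)"
      by (rule ext) (rule fourier_coeff_convection[OF F(1) herm_c])
    then show ?thesis using hermitian_fourier_coeff by metis
  qed
  have herm_g: "hermitian (g t)" for t
    unfolding g_def using r_sym by (intro hermitian_diff hermitian_real_mult herm_c herm_d herm_conv) simp
  have grad: "GDERIV (p t) x :> trig F (g t) x" if "t \<in> {0..T}" for t x
  proof -
    have "fourier_mult N Q (u t) = trig F (\<lambda>k. sym_mult Q k *\<^sub>R fourier_coeff (u t) k)"
      by (rule ext) (simp only: fourier_mult_eq F_def)
    also have "\<dots> = trig F (\<lambda>k. sym_mult Q k *\<^sub>R c t k)"
      by (rule trig_cong) (simp add: c_fourier[OF that])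
    finally have "\<nu> *\<^sub>R laplacian (fourier_mult N Q (u t)) x = trig F (\<lambda>k. - r k *\<^sub>R c t k) x"
      by (simp add: laplacian_trig trig_scaleR r_def mult_ac)
    moreover have "fourier_proj N (convection (u t)) x = trig F (conv F (c t)) x"
      unfolding fourier_proj_eq F_def[symmetric] u[OF that]
      by (rule fun_cong[OF trig_cong]) (rule fourier_coeff_convection[OF F(1) herm_c])
    ultimately have "gradp t x = trig F (\<lambda>k. - r k *\<^sub>R c t k) x - trig F (d t) x - trig F (conv F (c t)) x"
      using eq[OF that, of x] v[OF that, of x] by (simp add: algebra_simps)
    then have "gradp t x = trig F (g t) x" by (simp only: trig_diff g_def[abs_def])
    then show ?thesis using gp[OF that] by metis
  qed
  have g_orth: "g t k \<bullet> a = 0" if "t \<in> {0..T}" "k \<in> F" "cdot a k = 0" for t k a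
  proof (rule gradient_orthogonal[OF _ _ _ that(3)])
    show "of_int (k $ 1) * g t k $ 2 = of_int (k $ 2) * g t k $ 1"
      by (rule trig_gradient(1)[OF F(1) herm_g per[OF that(1)] grad[OF that(1)] that(2)])
    show "k $ 2 = 0 \<Longrightarrow> g t k $ 2 = 0"
      by (rule trig_gradient(2)[OF F(1) herm_g per[OF that(1)] grad[OF that(1)] that(2)])
    show "k $ 1 = 0 \<Longrightarrow> g t k $ 1 = 0"
      by (rule trig_gradient_axis(1)[OF F(1) herm_g per[OF that(1)] grad[OF that(1)] that(2)])
  qed
  have d_eq: "d t k = - r k *\<^sub>R c t k - conv F (c t) k - g t k" for t k by (simp add: g_def)
  have cd: "c t k \<bullet> d t k = - r k * (norm (c t k))\<^sup>2 - conv F (c t) k \<bullet> c t k" if "t \<in> {0..T}" "k \<in> F" for t k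
    using g_orth[OF that div_c[OF that]] unfolding d_eq[of t k]
    by (simp add: inner_diff_right inner_commute power2_norm_eq_inner)
  have "sv_coefficients T N \<nu> (sym_mult Q) c d"
    unfolding sv_coefficients_def
  proof (intro conjI allI ballI impI herm_c deriv)
    show "k \<notin> modes N \<Longrightarrow> c t k = 0" for t k by (simp add: c_def F_def)
    show "(\<Sum>k\<in>modes N. c t k \<bullet> d t k) =
        - \<nu> * (\<Sum>k\<in>modes N. sym_mult Q k * (norm (wave k))\<^sup>2 * (norm (c t k))\<^sup>2)" if "t \<in> {0..T}" for t
    proof -
      have "(\<Sum>k\<in>F. c t k \<bullet> d t k) = (\<Sum>k\<in>F. - r k * (norm (c t k))\<^sup>2) - (\<Sum>k\<in>F. conv F (c t) k \<bullet> c t k)"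
        unfolding sum_subtractf[symmetric] by (intro sum.cong refl cd that)
      then show ?thesis using conv_energy[OF F(1) herm_c div_c[OF that]]
        by (simp add: F_def r_def sum_distrib_left sum_negf[symmetric] mult_ac)
    qed
    show "(\<Sum>k\<in>modes N. (norm (wave k))\<^sup>2 * (c t k \<bullet> d t k)) =
        - \<nu> * (\<Sum>k\<in>modes N. sym_mult Q k * (norm (wave k))^4 * (norm (c t k))\<^sup>2)" if "t \<in> {0..T}" for t
    proof -
      have "(\<Sum>k\<in>F. (norm (wave k))\<^sup>2 * (c t k \<bullet> d t k)) =
          (\<Sum>k\<in>F. - r k * (norm (wave k))\<^sup>2 * (norm (c t k))\<^sup>2) - (\<Sum>k\<in>F. (norm (wave k))\<^sup>2 * (conv F (c t) k \<bullet> c t k))"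
        unfolding sum_subtractf[symmetric] by (intro sum.cong refl) (simp add: cd[OF that] algebra_simps)
      also have "(\<Sum>k\<in>F. (norm (wave k))\<^sup>2 * (conv F (c t) k \<bullet> c t k)) = 0"
        by (rule conv_enstrophy[OF F(1) herm_c div_c[OF that]])
      also have "(\<Sum>k\<in>F. - r k * (norm (wave k))\<^sup>2 * (norm (c t k))\<^sup>2) = 
        - \<nu> * (\<Sum>k\<in>F. sym_mult Q k * (norm (wave k))^4 * (norm (c t k))\<^sup>2)"
        unfolding sum_distrib_left by (intro sum.cong refl) (simp add: r_def power2_eq_square power4_eq_xxxx)
      finally show ?thesis by (simp add: F_def)
    qed
    show "norm (d t k) \<le> \<bar>\<nu> * sym_mult Q k\<bar> * (norm (wave k))\<^sup>2 * norm (c t k) + norm (wave k) * (\<Sum>p\<in>modes N. (norm (c t p))\<^sup>2)"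
      (is "_ \<le> ?B") if t: "t \<in> {0..T}" for t k
    proof (cases "k \<in> F")
      case True
      let ?h = "- r k *\<^sub>R c t k - conv F (c t) k"
      \<comment> \<open>The derivative is tested against itself: \<open>d t k\<close> is divergence
        free by \<open>div_d\<close>, so the pressure drops out of the pairing and only
        \<open>?h\<close> needs a bound.\<close>
      have "(norm (d t k))\<^sup>2 = d t k \<bullet> (?h - g t k)"
        unfolding power2_norm_eq_inner by (rule arg_cong[OF d_eq])
      also have "\<dots> = d t k \<bullet> ?h"
        using g_orth[OF t True div_d[OF t True]] by (simp only: inner_diff_right inner_commute[of "d t k" "g t k"])
      also have "\<dots> \<le> norm (d t k) * norm ?h" by (rule norm_cauchy_schwarz)
      finally have "norm (d t k) \<le> norm ?h"
        by (cases "d t k = 0") (simp_all add: power2_eq_square)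
      also have "\<dots> \<le> norm (r k *\<^sub>R c t k) + norm (conv F (c t) k)"
        using norm_triangle_ineq4[of "- r k *\<^sub>R c t k" "conv F (c t) k"] by simp
      also have "norm (r k *\<^sub>R c t k) = \<bar>\<nu> * sym_mult Q k\<bar> * (norm (wave k))\<^sup>2 * norm (c t k)"
        by (simp add: r_def abs_mult)
      also have "norm (conv F (c t) k) \<le> norm (wave k) * (\<Sum>p\<in>F. (norm (c t p))\<^sup>2)"
        by (rule norm_conv_le[OF F(2) div_c[OF t]])
      finally show ?thesis by (simp add: F_def)
    next
      case False
      have "0 \<le> norm (wave k) * (\<Sum>p\<in>modes N. (norm (c t p))\<^sup>2)" by (intro mult_nonneg_nonneg sum_nonneg) auto
      then show ?thesis using False by (simp add: c_def d_def)
    qed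
  qed
  then show ?thesis using u by (intro that) (auto simp: F_def)
qed

lemma norm_L2_class:
  assumes "square_integrable f"
  shows "(norm (L2_class f))\<^sup>2 = (LINT x|torus. (norm (f x))\<^sup>2)"
proof -
  have "ae_equal f f" using assms by (simp add: ae_equal_def)
  then have "L2_class f \<bullet> L2_class f = (LINT x|torus. f x \<bullet> f x)" by (intro inner_L2x.abs_eq)
  then show ?thesis by (simp only: power2_norm_eq_inner)
qed

lemma L2_class_diff:
  assumes "square_integrable f" "square_integrable g"
  shows "L2_class f - L2_class g = L2_class (\<lambda>x. f x - g x)"
  using assms by (subst minus_L2x.abs_eq) (simp_all add: ae_equal_def)

lemma norm_L2_class_trig:
  assumes "symmetric F" "hermitian a"
  shows "(norm (L2_class (trig F a)))\<^sup>2 = (2 * pi)\<^sup>2 * (\<Sum>k\<in>F. (norm (a k))\<^sup>2)"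
  by (simp only: norm_L2_class[OF square_integrable_trig] integral_trig_square[OF assms])

lemma L2_class_trig_diff: "L2_class (trig F a) - L2_class (trig F b) = L2_class (trig F (\<lambda>k. a k - b k))"
  by (simp add: L2_class_diff square_integrable_trig trig_diff)

section \<open>Subsequences of random indices\<close>

text \<open>Coordinates of Schoenberg's space-filling curve: base-3 digits 0 and 2 of the argument are read
  off by a continuous 2-periodic function, and distributed over countably many binary expansions.\<close>

definition digit_wave :: "real \<Rightarrow> real" where
  "digit_wave y = max 0 (min 1 (1/2 - cos (pi * y)))"

definition schoenberg :: "nat \<Rightarrow> real \<Rightarrow> real" where
  "schoenberg j y = (\<Sum>m. (1/2) ^ Suc m * digit_wave (3 ^ prod_encode (j, m) * y))"

lemma isCont_schoenberg: "isCont (schoenberg j) y"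
proof -
  define f where "f m y = (1/2) ^ Suc m * digit_wave (3 ^ prod_encode (j, m) * y)" for m y
  have bd: "norm (f m y) \<le> (1/2) ^ Suc m" for m y
    by (simp add: f_def digit_wave_def abs_mult mult_left_le)
  have "uniform_limit UNIV (\<lambda>n x. \<Sum>m<n. f m x) (\<lambda>x. \<Sum>m. f m x) sequentially"
    by (rule Weierstrass_m_test[OF bd]) (intro summable_mult summable_Suc_iff[THEN iffD2] summable_geometric, simp)
  then have "continuous_on UNIV (\<lambda>x. \<Sum>m. f m x)"
    by (rule uniform_limit_theorem[rotated])
      (auto simp: f_def digit_wave_def intro!: always_eventually continuous_intros)
  moreover have "schoenberg j = (\<lambda>x. \<Sum>m. f m x)" by (simp add: schoenberg_def f_def fun_eq_iff)
  ultimately show ?thesis by (simp add: continuous_on_eq_continuous_at)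
qed

text \<open>The bounds on \<open>t\<close> say that its first ternary digit can be taken as 2 * b.
  There the cosine stays on one side of 1/2 or -1/2, so the truncation gives exactly
  \<open>b\<close>; even integers are absorbed by the period 2.\<close>

lemma digit_wave_eq:
  assumes "b = 0 \<or> b = 1" "2 * b / 3 \<le> t" "t \<le> 2 * b / 3 + 1 / 3"
  shows "digit_wave (2 * of_int n + t) = b"
proof -
  have cos_eq: "cos (pi * (2 * of_int n + t)) = cos (pi * t)"
  proof -
    have "pi * (2 * of_int n + t) = pi * t + 2 * pi * of_int n" by (simp add: algebra_simps)
    then show ?thesis by (simp add: cos_add sin_int_2pin cos_int_2pin)
  qed
  show ?thesis
  proof (cases "b = 0")
    case True
    have "cos (pi * (1/3)) \<le> cos (pi * t)"
      using assms True by (intro cos_monotone_0_pi_le) auto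
    then have "1/2 \<le> cos (pi * t)" using cos_60 by simp
    then show ?thesis using True by (simp add: digit_wave_def cos_eq)
  next
    case False
    then have b: "b = 1" using assms(1) by simp
    have "pi * t \<le> pi * 1" using assms b by (intro mult_left_mono) auto
    then have "cos (pi * t) \<le> cos (pi * (2/3))"
      using assms b by (intro cos_monotone_0_pi_le) auto
    also have "\<dots> = - (1/2)" using cos_120 by (simp add: mult.commute)
    finally show ?thesis using b by (simp add: digit_wave_def cos_eq)
  qed
qed

text \<open>With bits defined by differences of truncations, the partial sums telescope to
  \<open>\<lfloor>2 ^ n * z\<rfloor>\<close> divided by \<open>2 ^ n\<close>. The bounds on
  \<open>z\<close> give the starting value \<open>\<lfloor>z\<rfloor> = 0\<close>.\<close>

lemma binary_expansion:
  fixes z :: real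
  assumes "0 \<le> z" "z < 1"
  obtains b :: "nat \<Rightarrow> real" where "\<And>m. b m = 0 \<or> b m = 1" "(\<lambda>m. (1/2) ^ Suc m * b m) sums z"
proof
  define b where "b m = real_of_int (\<lfloor>2 ^ Suc m * z\<rfloor> - 2 * \<lfloor>2 ^ m * z\<rfloor>)" for m
  show "b m = 0 \<or> b m = 1" for m
  proof -
    have "\<lfloor>2 ^ Suc m * z\<rfloor> - 2 * \<lfloor>2 ^ m * z\<rfloor> = 0 \<or> \<lfloor>2 ^ Suc m * z\<rfloor> - 2 * \<lfloor>2 ^ m * z\<rfloor> = 1"
      unfolding power_Suc mult.assoc by linarith
    then show ?thesis by (auto simp: b_def)
  qed
  have partial: "(\<Sum>m<n. (1/2) ^ Suc m * b m) = (1/2) ^ n * of_int \<lfloor>2 ^ n * z\<rfloor>" for n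
  proof (induction n)
    case 0
    have "\<lfloor>z\<rfloor> = 0" using assms by linarith
    then show ?case by simp
  next
    case (Suc n)
    then show ?case by (simp add: b_def field_simps)
  qed
  have "(\<lambda>n. (1/2) ^ n * of_int \<lfloor>2 ^ n * z\<rfloor>) \<longlonglongrightarrow> z"
  proof (rule tendsto_sandwich)
    show "\<forall>\<^sub>F n in sequentially. z - (1/2) ^ n \<le> (1/2) ^ n * of_int \<lfloor>2 ^ n * z\<rfloor>"
    proof (intro always_eventually allI)
      fix n
      have "(1/2) ^ n * (2 ^ n * z - 1) \<le> (1/2) ^ n * of_int \<lfloor>2 ^ n * z\<rfloor>"
        by (intro mult_left_mono) (linarith | simp)+
      then show "z - (1/2) ^ n \<le> (1/2) ^ n * of_int \<lfloor>2 ^ n * z\<rfloor>"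
        by (simp add: field_simps)
    qed
    show "\<forall>\<^sub>F n in sequentially. (1/2) ^ n * of_int \<lfloor>2 ^ n * z\<rfloor> \<le> z"
    proof (intro always_eventually allI)
      fix n
      have "(1/2) ^ n * of_int \<lfloor>2 ^ n * z\<rfloor> \<le> (1/2) ^ n * (2 ^ n * z)"
        by (intro mult_left_mono) (linarith | simp)+
      then show "(1/2) ^ n * of_int \<lfloor>2 ^ n * z\<rfloor> \<le> z"
        by (simp add: field_simps)
    qed
    have "(\<lambda>n. z - (1/2) ^ n) \<longlonglongrightarrow> z - 0"
      by (intro tendsto_intros LIMSEQ_power_zero) simp
    then show "(\<lambda>n. z - (1/2) ^ n) \<longlonglongrightarrow> z" by simp
  qed simp
  then show "(\<lambda>m. (1/2) ^ Suc m * b m) sums z"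
    unfolding sums_def partial .
qed

text \<open>The bits of all numbers \<open>z j\<close> become the ternary digits, 0 or 2, of a
  single real \<open>y\<close>, bit m of \<open>z j\<close> at position
  \<open>prod_encode (j, m)\<close>. Multiplication by \<open>3 ^ n\<close> brings digit n to the
  front, where \<open>digit_wave\<close> reads it.\<close>

lemma schoenberg_surj:
  assumes "\<And>j. 0 \<le> z j" "\<And>j. z j < 1"
  obtains y where "0 \<le> y" "y \<le> 1" "\<And>j. schoenberg j y = z j"
proof -
  have "\<forall>j. \<exists>b :: nat \<Rightarrow> real. (\<forall>m. b m = 0 \<or> b m = 1) \<and> (\<lambda>m. (1/2) ^ Suc m * b m) sums z j"
    using binary_expansion[OF assms] by metis
  then obtain b :: "nat \<Rightarrow> nat \<Rightarrow> real" where b: "\<And>j m. b j m = 0 \<or> b j m = 1" "\<And>j. (\<lambda>m. (1/2) ^ Suc m * b j m) sums z j"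
    by metis
  define \<beta> where "\<beta> n = (case prod_decode n of (j, m) \<Rightarrow> b j m)" for n
  have \<beta>: "\<beta> n = 0 \<or> \<beta> n = 1" for n using b(1) by (auto simp: \<beta>_def split: prod.split)
  have \<beta>_bd: "0 \<le> \<beta> n" "\<beta> n \<le> 1" for n using \<beta>[of n] by auto
  have tail_sum: "summable (\<lambda>i. 2 * \<beta> (n + i) / 3 ^ Suc i)" and
    tail_nonneg: "0 \<le> (\<Sum>i. 2 * \<beta> (n + i) / 3 ^ Suc i)" and
    tail_le: "(\<Sum>i. 2 * \<beta> (n + i) / 3 ^ Suc i) \<le> 1" for n
  proof -
    have g: "(\<lambda>i. 2 / 3 * (1/3 :: real) ^ i) sums (2 / 3 * (1 / (1 - 1/3)))"
      by (intro sums_mult geometric_sums) simp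
    have le: "norm (2 * \<beta> (n + i) / 3 ^ Suc i) \<le> 2 / 3 * (1/3) ^ i" for i
      using \<beta>_bd[of "n + i"] by (simp add: field_simps power_one_over)
    show s: "summable (\<lambda>i. 2 * \<beta> (n + i) / 3 ^ Suc i)"
      by (rule summable_comparison_test'[OF sums_summable[OF g] le])
    show "0 \<le> (\<Sum>i. 2 * \<beta> (n + i) / 3 ^ Suc i)"
      using \<beta>_bd by (intro suminf_nonneg s) simp
    have "(\<Sum>i. 2 * \<beta> (n + i) / 3 ^ Suc i) \<le> (\<Sum>i. 2 / 3 * (1/3) ^ i)"
      by (intro suminf_le s sums_summable[OF g] order_trans[OF _ le]) (simp add: \<beta>_bd)
    then show "(\<Sum>i. 2 * \<beta> (n + i) / 3 ^ Suc i) \<le> 1" using sums_unique[OF g] by simp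
  qed
  define y where "y = (\<Sum>i. 2 * \<beta> i / 3 ^ Suc i)"
  have digit: "digit_wave (3 ^ n * y) = \<beta> n" for n
  proof -
    define t where "t = (\<Sum>i. 2 * \<beta> (n + i) / 3 ^ Suc i)"
    have "y = (\<Sum>i. 2 * \<beta> (i + n) / 3 ^ Suc (i + n)) + (\<Sum>i<n. 2 * \<beta> i / 3 ^ Suc i)"
      unfolding y_def using tail_sum[of 0] by (intro suminf_split_initial_segment) simp
    also have "(\<Sum>i. 2 * \<beta> (i + n) / 3 ^ Suc (i + n)) = (\<Sum>i. (2 * \<beta> (n + i) / 3 ^ Suc i) / 3 ^ n)"
    proof (rule arg_cong[of _ _ suminf], rule ext)
      fix i
      have "(3::real) ^ Suc (i + n) = 3 ^ Suc i * 3 ^ n" by (simp add: power_add)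
      then show "2 * \<beta> (i + n) / 3 ^ Suc (i + n) = (2 * \<beta> (n + i) / 3 ^ Suc i) / 3 ^ n"
        by (simp only: divide_divide_eq_left add.commute[of i n])
    qed
    also have "\<dots> = t / 3 ^ n" unfolding t_def by (rule suminf_divide[OF tail_sum])
    finally have y_eq: "y = t / 3 ^ n + (\<Sum>i<n. 2 * \<beta> i / 3 ^ Suc i)" .
    have "3 ^ n * y = (\<Sum>i<n. 3 ^ n * (2 * \<beta> i / 3 ^ Suc i)) + t"
      unfolding y_eq distrib_left sum_distrib_left by simp
    \<comment> \<open>The earlier digits are all even, so after scaling they contribute an even
      integer.\<close>
    also have "(\<Sum>i<n. 3 ^ n * (2 * \<beta> i / 3 ^ Suc i)) = 2 * of_int (\<Sum>i<n. 3 ^ (n - Suc i) * \<lfloor>\<beta> i\<rfloor>)"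
    proof -
      have "3 ^ n * (2 * \<beta> i / 3 ^ Suc i) = 2 * (3 ^ (n - Suc i) * of_int \<lfloor>\<beta> i\<rfloor>)" if "i < n" for i
      proof -
        have p: "(3::real) ^ n = 3 ^ (n - Suc i) * 3 ^ Suc i" using that power_add[of "3::real" "n - Suc i" "Suc i"] by simp
        have b: "of_int \<lfloor>\<beta> i\<rfloor> = \<beta> i" using \<beta>[of i] by auto
        show ?thesis unfolding p b by simp
      qed
      then show ?thesis by (simp add: sum_distrib_left)
    qed
    finally have eq: "3 ^ n * y = 2 * of_int (\<Sum>i<n. 3 ^ (n - Suc i) * \<lfloor>\<beta> i\<rfloor>) + t" .
    have "t = (\<Sum>i. 2 * \<beta> (n + (i + 1)) / 3 ^ Suc (i + 1)) + (\<Sum>i<1. 2 * \<beta> (n + i) / 3 ^ Suc i)"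
      unfolding t_def by (rule suminf_split_initial_segment[OF tail_sum])
    also have "(\<Sum>i. 2 * \<beta> (n + (i + 1)) / 3 ^ Suc (i + 1)) = (\<Sum>i. (2 * \<beta> (Suc n + i) / 3 ^ Suc i) / 3)"
    proof (rule arg_cong[of _ _ suminf], rule ext)
      fix i
      have "(3::real) ^ Suc (i + 1) = 3 ^ Suc i * 3" by simp
      moreover have "n + (i + 1) = Suc n + i" by simp
      ultimately show "2 * \<beta> (n + (i + 1)) / 3 ^ Suc (i + 1) = (2 * \<beta> (Suc n + i) / 3 ^ Suc i) / 3"
        by (simp only: divide_divide_eq_left)
    qed
    also have "\<dots> = (\<Sum>i. 2 * \<beta> (Suc n + i) / 3 ^ Suc i) / 3" by (rule suminf_divide[OF tail_sum])
    finally have t: "t = 2 * \<beta> n / 3 + (\<Sum>i. 2 * \<beta> (Suc n + i) / 3 ^ Suc i) / 3" by simp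
    show ?thesis unfolding eq
      using tail_nonneg[of "Suc n"] tail_le[of "Suc n"] t by (intro digit_wave_eq \<beta>) linarith+
  qed
  show ?thesis
  proof
    show "0 \<le> y" "y \<le> 1" using tail_nonneg[of 0] tail_le[of 0] by (simp_all add: y_def)
    show "schoenberg j y = z j" for j
      unfolding schoenberg_def digit using sums_unique[OF b(2)[of j]] by (simp add: \<beta>_def)
  qed
qed

text \<open>A Skorohod representation: encoding the data of each array entry as a point of the unit interval
  reduces the selection of a subsequence to Helly's theorem on the real line.\<close>

lemma random_index_subsequence:
  fixes K :: "nat \<Rightarrow> nat" and z :: "nat \<Rightarrow> nat \<Rightarrow> nat \<Rightarrow> real"
  assumes K: "\<And>n. K n > 0" and z: "\<And>n i j. 0 \<le> z n i j" "\<And>n i j. z n i j < 1"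
  obtains s :: "nat \<Rightarrow> nat" and \<Omega> :: "real measure" and I :: "nat \<Rightarrow> real \<Rightarrow> nat"
  where "strict_mono s" "prob_space \<Omega>" "\<And>n. I n \<in> \<Omega> \<rightarrow>\<^sub>M count_space UNIV" "\<And>n \<omega>. I n \<omega> < K (s n)"
    "\<And>n. distr \<Omega> (count_space UNIV) (I n) = distr (uniform_count_measure {..<K (s n)}) (count_space UNIV) (\<lambda>i. i)"
    "AE \<omega> in \<Omega>. \<forall>j. convergent (\<lambda>n. z (s n) (I n \<omega>) j)"
proof -
  \<comment> \<open>Coordinate 0 is a label that separates the indices: without it, indices with
    equal data could share a code and could not be recovered from it.\<close>
  define w where "w n i j = (case j of 0 \<Rightarrow> 1 / (real i + 2) | Suc j \<Rightarrow> z n i j)" for n i j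
  have w: "0 \<le> w n i j" "w n i j < 1" for n i j using z by (simp_all add: w_def split: nat.split)
  have "\<exists>y. 0 \<le> y \<and> y \<le> 1 \<and> (\<forall>j. schoenberg j y = w n i j)" for n i
  proof -
    obtain y where "0 \<le> y" "y \<le> 1" "\<And>j. schoenberg j y = w n i j" using schoenberg_surj[of "w n i", OF w] by blast
    then show ?thesis by blast
  qed
  obtain y where y: "\<And>n i. 0 \<le> y n i" "\<And>n i. y n i \<le> 1" "\<And>n i j. schoenberg j (y n i) = w n i j"
  proof -
    assume *: "\<And>y. (\<And>n i. 0 \<le> y n i) \<Longrightarrow> (\<And>n i. y n i \<le> 1) \<Longrightarrow> (\<And>n i j. schoenberg j (y n i) = w n i j) \<Longrightarrow> thesis"
    show thesis
      by (rule *[of "\<lambda>n i. SOME y. 0 \<le> y \<and> y \<le> 1 \<and> (\<forall>j. schoenberg j y = w n i j)"])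
        (use someI_ex[OF \<open>\<And>n i. \<exists>y. 0 \<le> y \<and> y \<le> 1 \<and> (\<forall>j. schoenberg j y = w n i j)\<close>] in blast)+
  qed
  have y_inj: "i = i'" if "y n i = y n i'" for n i i'
  proof -
    have "w n i 0 = w n i' 0" using y(3)[of 0 n i] y(3)[of 0 n i'] that by metis
    then show ?thesis by (simp add: w_def)
  qed
  let ?U = "\<lambda>n. uniform_count_measure {..<K n}"
  have U: "prob_space (?U n)" for n using K[of n] by (intro prob_space_uniform_count_measure) auto
  have y_meas: "y n \<in> ?U n \<rightarrow>\<^sub>M borel" for n by (simp add: uniform_count_measure_def)
  define \<mu> where "\<mu> n = distr (?U n) borel (y n)" for n
  have \<mu>: "real_distribution (\<mu> n)" for n
    unfolding \<mu>_def by (rule prob_space.real_distribution_distr[OF U y_meas])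
  have supp: "measure (\<mu> n) A = 1" if "\<And>i. i < K n \<Longrightarrow> y n i \<in> A" "A \<in> sets borel" for A n
  proof -
    have "y n -` A \<inter> space (?U n) = space (?U n)" using that by (auto simp: space_uniform_count_measure)
    then show ?thesis
      unfolding \<mu>_def by (subst measure_distr[OF y_meas that(2)]) (simp add: prob_space.prob_space[OF U])
  qed
  have "tight \<mu>"
    unfolding tight_def
  proof (intro conjI allI impI \<mu>)
    fix e :: real assume "e > 0"
    have "measure (\<mu> n) {-1<..1} = 1" for n
    proof (rule supp)
      fix i show "y n i \<in> {-1<..1}" using y(1)[of n i] y(2)[of n i] by simp
    qed simp
    then show "\<exists>a b. a < b \<and> (\<forall>n. 1 - e < measure (\<mu> n) {a<..b})"
      using \<open>e > 0\<close> by (intro exI[of _ "-1"] exI[of _ 1]) simp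
  qed
  then obtain s M where s: "strict_mono s" and M: "real_distribution M" and weak: "weak_conv_m (\<lambda>n. \<mu> (s n)) M"
    using tight_imp_convergent_subsubsequence[of \<mu> "\<lambda>n. n"] by (auto simp: strict_mono_def comp_def)
  obtain \<Omega> :: "real measure" and Y Y' where \<Omega>: "prob_space \<Omega>"
    and Y: "\<And>n. Y n \<in> \<Omega> \<rightarrow>\<^sub>M borel" "\<And>n. distr \<Omega> borel (Y n) = \<mu> (s n)"
    and lim: "\<And>x. x \<in> space \<Omega> \<Longrightarrow> (\<lambda>n. Y n x) \<longlonglongrightarrow> Y' x"
    using Skorohod[OF \<mu> M weak] by metis
  \<comment> \<open>The second alternative in the search makes K n - 1 the default, so the decoded
    index is admissible even at a point that is not a code.\<close>
  define idx where "idx n x = (LEAST i. x = y n i \<or> K n \<le> Suc i)" for n x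
  have idx_meas: "idx n \<in> borel \<rightarrow>\<^sub>M count_space UNIV" for n
    unfolding idx_def by measurable
  have idx_less: "idx n x < K n" for n x
  proof -
    have "idx n x \<le> K n - 1" unfolding idx_def using K[of n] by (intro Least_le) simp
    then show ?thesis using K[of n] by simp
  qed
  have idx_y: "idx n (y n i) = i" if "i < K n" for n i
    unfolding idx_def
  proof (rule Least_equality)
    fix i' assume "y n i = y n i' \<or> K n \<le> Suc i'"
    then show "i \<le> i'" using y_inj that by (metis Suc_leI le_trans not_less_eq_eq order_refl)
  qed simp
  define I where "I n x = idx (s n) (Y n x)" for n x
  show ?thesis
  proof (rule that[OF s \<Omega>])
    show I_meas: "I n \<in> \<Omega> \<rightarrow>\<^sub>M count_space UNIV" for n
      unfolding I_def by (rule measurable_compose[OF Y(1) idx_meas])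
    show "I n \<omega> < K (s n)" for n \<omega> by (simp add: I_def idx_less)
    show "distr \<Omega> (count_space UNIV) (I n) = distr (?U (s n)) (count_space UNIV) (\<lambda>i. i)" for n
    proof -
      have "distr \<Omega> (count_space UNIV) (I n) = distr (distr \<Omega> borel (Y n)) (count_space UNIV) (idx (s n))"
        by (subst distr_distr[OF idx_meas Y(1)]) (simp add: I_def[abs_def] comp_def)
      also have "\<dots> = distr (?U (s n)) (count_space UNIV) (idx (s n) \<circ> y (s n))"
        unfolding Y(2) \<mu>_def by (rule distr_distr[OF idx_meas y_meas])
      also have "\<dots> = distr (?U (s n)) (count_space UNIV) (\<lambda>i. i)"
        by (rule distr_cong) (simp_all add: space_uniform_count_measure idx_y)
      finally show ?thesis .
    qed
    \<comment> \<open>Skorohod's variables are only prescribed in law. Since that law lives on the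
      finite set of codes, almost every value is a code and can be decoded.\<close>
    have "AE x in \<Omega>. Y n x \<in> y (s n) ` {..<K (s n)}" for n
    proof -
      interpret D: real_distribution "\<mu> (s n)" by (rule \<mu>)
      have fin: "y (s n) ` {..<K (s n)} \<in> sets borel" by (intro borel_closed finite_imp_closed) simp
      then have "AE x in \<mu> (s n). x \<in> y (s n) ` {..<K (s n)}"
        by (subst D.AE_in_set_eq_1) (simp_all add: supp)
      then show ?thesis
        unfolding Y(2)[symmetric] using fin by (subst (asm) AE_distr_iff[OF Y(1)]) simp_all
    qed
    then have "AE x in \<Omega>. \<forall>n. Y n x \<in> y (s n) ` {..<K (s n)}" by (simp add: AE_all_countable)
    then show "AE \<omega> in \<Omega>. \<forall>j. convergent (\<lambda>n. z (s n) (I n \<omega>) j)"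
    proof (rule AE_mp, intro AE_I2 impI allI)
      fix x j assume x: "x \<in> space \<Omega>" and *: "\<forall>n. Y n x \<in> y (s n) ` {..<K (s n)}"
      \<comment> \<open>The shift by one skips the label. Continuity of the coordinate functions
        then turns convergence of the codes into convergence of the data.\<close>
      have "schoenberg (Suc j) (Y n x) = z (s n) (I n x) j" for n
      proof -
        obtain i where "i < K (s n)" "Y n x = y (s n) i" using * by blast
        then show ?thesis by (simp add: I_def idx_y y(3) w_def)
      qed
      moreover have "(\<lambda>n. schoenberg (Suc j) (Y n x)) \<longlonglongrightarrow> schoenberg (Suc j) (Y' x)"
        by (rule isCont_tendsto_compose[OF isCont_schoenberg lim[OF x]])
      ultimately show "convergent (\<lambda>n. z (s n) (I n x) j)" by (auto simp: convergent_def)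
    qed
  qed
qed

section \<open>The structure function controls Fourier modes\<close>

text \<open>\<open>f\<close> is an arbitrary function here. The Borel function \<open>g\<close>,
  equal to \<open>f\<close> on the finitely many atoms and zero elsewhere, lies below
  \<open>f\<close>, and its integral is the sample mean.\<close>

lemma nn_integral_empirical_measure_ge:
  fixes f :: "'a::t1_space \<Rightarrow> ennreal"
  assumes "K > 0"
  shows "(\<Sum>i<K. f (v i)) / of_nat K \<le> (\<integral>\<^sup>+ u. f u \<partial>empirical_measure K v)"
proof -
  define g where "g x = (\<Sum>a\<in>v ` {..<K}. f a * indicator {a} x)" for x
  have g: "g \<in> borel_measurable borel"
    unfolding g_def by (intro borel_measurable_sum borel_measurable_times borel_measurable_indicator borel_closed) auto
  have g_eq: "g x = f x * indicator (v ` {..<K}) x" for x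
    by (auto simp: g_def indicator_def if_distrib cong: if_cong)
  have v: "v \<in> uniform_count_measure {..<K} \<rightarrow>\<^sub>M borel" by (simp add: uniform_count_measure_def)
  have "(\<Sum>i<K. f (v i)) / of_nat K = (\<Sum>i<K. f (v i) / of_nat K)"
    by (simp add: divide_ennreal_def sum_distrib_right)
  also have "\<dots> = (\<Sum>i<K. ennreal (1 / real K) * f (v i))"
  proof (intro sum.cong refl)
    fix i
    have "inverse (of_nat K :: ennreal) = ennreal (1 / real K)"
      using assms by (simp add: ennreal_of_nat_eq_real_of_nat inverse_ennreal inverse_eq_divide)
    then show "f (v i) / of_nat K = ennreal (1 / real K) * f (v i)"
      by (simp add: divide_ennreal_def mult.commute)
  qed
  also have "\<dots> = (\<integral>\<^sup>+ i. g (v i) \<partial>uniform_count_measure {..<K})"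
    unfolding uniform_count_measure_def by (subst nn_integral_point_measure_finite) (auto simp: g_eq)
  also have "\<dots> = (\<integral>\<^sup>+ u. g u \<partial>empirical_measure K v)"
    unfolding empirical_measure_def by (subst nn_integral_distr[OF v]) (simp_all add: g)
  also have "\<dots> \<le> (\<integral>\<^sup>+ u. f u \<partial>empirical_measure K v)"
    by (intro nn_integral_mono) (simp add: g_eq indicator_def)
  finally show ?thesis .
qed

text \<open>On [0, 1] the cosine is at least 1/2, because 1 < pi / 3; the mean value theorem then
  gives \<open>t / 2 \<le> sin t\<close>, and the imaginary part alone supplies the bound.\<close>

lemma norm_cis_minus_one_ge:
  assumes "\<bar>\<theta>\<bar> \<le> 1"
  shows "\<theta>\<^sup>2 / 4 \<le> (norm (cis \<theta> - 1))\<^sup>2"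
proof -
  have pos: "t / 2 \<le> sin t" if "0 \<le> t" "t \<le> 1" for t :: real
  proof -
    have "\<exists>x\<in>{0..t}. sin t - sin 0 = cos x * (t - 0)"
      using that by (intro mvt_very_simple) (auto intro!: derivative_eq_intros)
    then obtain x where x: "0 \<le> x" "x \<le> t" "sin t = cos x * t" by auto
    have "cos (pi / 3) \<le> cos x" using x that pi_gt3 by (intro cos_monotone_0_pi_le) auto
    then have "1/2 \<le> cos x" by (simp add: cos_60)
    then have "1/2 * t \<le> cos x * t" using that by (intro mult_right_mono)
    then show ?thesis using x by simp
  qed
  have "(\<theta> / 2)\<^sup>2 \<le> (sin \<theta>)\<^sup>2"
    unfolding abs_le_square_iff[symmetric] using pos[of \<theta>] pos[of "- \<theta>"] assms by (cases "\<theta> \<ge> 0") auto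
  also have "\<dots> \<le> (norm (cis \<theta> - 1))\<^sup>2" by (simp add: cmod_power2)
  finally show ?thesis by (simp add: power_divide)
qed

lemma emeasure_ball_le: "0 < r \<Longrightarrow> emeasure lborel (ball (0::real^2) r) \<le> ennreal (4 * r\<^sup>2)"
proof -
  assume r: "0 < r"
  have "ball (0::real^2) r \<subseteq> cbox (\<chi> i. - r) (\<chi> i. r)"
  proof
    fix x :: "real^2" assume "x \<in> ball 0 r"
    then have "\<bar>x $ i\<bar> \<le> r" for i using component_le_norm_cart[of x i] by simp
    then show "x \<in> cbox (\<chi> i. - r) (\<chi> i. r)" by (auto simp: mem_box_cart abs_le_iff minus_le_iff)
  qed
  then have "emeasure lborel (ball (0::real^2) r) \<le> emeasure lborel (cbox (\<chi> i. - r) (\<chi> i. r) :: (real^2) set)"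
    by (intro emeasure_mono) auto
  also have "\<dots> = ennreal (4 * r\<^sup>2)"
    using r by (subst emeasure_lborel_cbox) (auto simp: Basis_vec_def inner_axis axis_eq_axis
        UNION_singleton_eq_range prod.reindex inj_on_def UNIV_2 power2_eq_square)
  finally show ?thesis .
qed

text \<open>In the quadrant on which both products \<open>k $ i * h $ i\<close> are nonnegative there is no cancellation
  in \<open>wave k \<bullet> h\<close>.\<close>

lemma ball_average_wave_ge:
  assumes r: "0 < r" and k: "norm (wave k) * r \<le> 1"
  shows "ennreal (r^4 * (norm (wave k))\<^sup>2 / 1024) \<le>
    (\<integral>\<^sup>+ h\<in>ball 0 r. ennreal ((norm (cis (wave k \<bullet> h) - 1))\<^sup>2) \<partial>lborel)"
proof -
  \<comment> \<open>\<open>cbox l u\<close> is a square of side r / 4 in that quadrant; its points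
    have norm at most r / sqrt 2 and so lie in the ball.\<close>
  define l u :: "real^2" where "l = (\<chi> i. if k $ i \<ge> 0 then r / 4 else - r / 2)"
    and "u = (\<chi> i. if k $ i \<ge> 0 then r / 2 else - r / 4)"
  have Q: "h \<in> ball 0 r \<and> r\<^sup>2 * (norm (wave k))\<^sup>2 / 64 \<le> (norm (cis (wave k \<bullet> h) - 1))\<^sup>2" if h: "h \<in> cbox l u" for h
  proof -
    have h_i: "\<bar>h $ i\<bar> \<le> r / 2 \<and> r / 4 * \<bar>of_int (k $ i)\<bar> \<le> of_int (k $ i) * h $ i" for i
    proof (cases "k $ i \<ge> 0")
      case True
      then have "r / 4 \<le> h $ i" "h $ i \<le> r / 2" using h[unfolded mem_box_cart, rule_format, of i] by (auto simp: l_def u_def)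
      moreover from this have "r / 4 * of_int (k $ i) \<le> h $ i * of_int (k $ i)"
        using True by (intro mult_right_mono) auto
      ultimately show ?thesis using r True by (simp add: mult.commute)
    next
      case False
      then have *: "- r / 2 \<le> h $ i" "h $ i \<le> - r / 4" using h[unfolded mem_box_cart, rule_format, of i] by (auto simp: l_def u_def)
      have "of_int (- (k $ i)) * (r / 4) \<le> of_int (- (k $ i)) * (- h $ i)"
        using * False by (intro mult_left_mono) auto
      then show ?thesis using r False * by (auto simp: mult.commute)
    qed
    have "(norm h)\<^sup>2 \<le> (r / 2)\<^sup>2 + (r / 2)\<^sup>2"
    proof -
      have "(h $ i)\<^sup>2 \<le> (r / 2)\<^sup>2" for i
        unfolding abs_le_square_iff[symmetric] using h_i[of i] r by simp
      from add_mono[OF this[of 1] this[of 2]] show ?thesis unfolding norm_vec2_sq UNIV_2 by simp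
    qed
    also have "\<dots> < r\<^sup>2" using r by (simp add: power2_eq_square)
    finally have norm_h: "norm h < r" using r by (simp add: power2_less_imp_less)
    have dot: "wave k \<bullet> h = (\<Sum>i\<in>UNIV. of_int (k $ i) * h $ i)" by (simp add: inner_vec_def wave_def)
    have "r / 4 * norm (wave k) \<le> r / 4 * (\<Sum>i\<in>UNIV. \<bar>of_int (k $ i)\<bar>)"
      using r norm_le_l1_cart[of "wave k"] by (intro mult_left_mono) (auto simp: wave_def)
    also have "\<dots> \<le> wave k \<bullet> h" unfolding dot sum_distrib_left by (intro sum_mono) (use h_i in auto)
    finally have "(r / 4 * norm (wave k))\<^sup>2 \<le> (wave k \<bullet> h)\<^sup>2" using r by (intro power_mono) auto
    moreover have "\<bar>wave k \<bullet> h\<bar> \<le> 1"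
      using Cauchy_Schwarz_ineq2[of "wave k" h] norm_h k mult_left_mono[of "norm h" r "norm (wave k)"] by simp
    ultimately show ?thesis
      using norm_cis_minus_one_ge[of "wave k \<bullet> h"] norm_h by (simp add: power_mult_distrib power_divide)
  qed
  \<comment> \<open>The constant 1024 is 64 * 16: the integrand is at least
    \<open>r\<^sup>2 * (norm (wave k))\<^sup>2 / 64\<close> on a square of area
    \<open>r\<^sup>2 / 16\<close>.\<close>
  have "emeasure lborel (cbox l u) = ennreal (r\<^sup>2 / 16)"
    using r by (subst emeasure_lborel_cbox_eq) (auto simp: Basis_vec_def inner_axis axis_eq_axis
        UNION_singleton_eq_range prod.reindex inj_on_def UNIV_2 power2_eq_square l_def u_def)
  then have "ennreal (r^4 * (norm (wave k))\<^sup>2 / 1024) =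
     (\<integral>\<^sup>+ h\<in>cbox l u. ennreal (r\<^sup>2 * (norm (wave k))\<^sup>2 / 64) \<partial>lborel)"
  proof -
    assume Qm: "emeasure lborel (cbox l u) = ennreal (r\<^sup>2 / 16)"
    have "(\<integral>\<^sup>+ h\<in>cbox l u. ennreal (r\<^sup>2 * (norm (wave k))\<^sup>2 / 64) \<partial>lborel) = ennreal (r\<^sup>2 * (norm (wave k))\<^sup>2 / 64) * ennreal (r\<^sup>2 / 16)"
      unfolding Qm[symmetric] by (rule nn_integral_cmult_indicator) simp
    also have "\<dots> = ennreal (r^4 * (norm (wave k))\<^sup>2 / 1024)"
      by (subst ennreal_mult''[symmetric]) (simp_all add: power2_eq_square power4_eq_xxxx mult_ac)
    finally show ?thesis by simp
  qed
  also have "\<dots> \<le> (\<integral>\<^sup>+ h\<in>ball 0 r. ennreal ((norm (cis (wave k \<bullet> h) - 1))\<^sup>2) \<partial>lborel)"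
    using Q by (intro nn_integral_mono) (auto simp: indicator_def intro!: ennreal_leI)
  finally show ?thesis .
qed

lemma inverse_antimono_ennreal: "a \<le> b \<Longrightarrow> inverse b \<le> inverse (a :: ennreal)"
proof (cases "a = 0 \<or> b = \<top>")
  case False
  assume "a \<le> b"
  moreover obtain x y where "a = ennreal x" "0 < x" "b = ennreal y" "0 \<le> y"
    using False \<open>a \<le> b\<close> by (cases a; cases b) (auto simp: top_unique)
  ultimately show ?thesis by (simp add: inverse_ennreal)
qed auto

lemma sigma_finite_torus: "sigma_finite_measure torus"
  unfolding torus_def by (intro sigma_finite_measure_restrict_space lborel.sigma_finite_measure_axioms) simp

text \<open>By Parseval, the increment over \<open>h\<close> weights mode k with the square of
  \<open>norm (cis (wave k \<bullet> h) - 1)\<close>. After the integrals are exchanged,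
  \<open>ball_average_wave_ge\<close> treats the modes with \<open>norm (wave k) * r \<le> 1\<close>
  and the others are discarded. The constant 4096 is 1024 times the factor 4 of
  \<open>emeasure_ball_le\<close>.\<close>

lemma mean_increment_trig_ge:
  assumes F: "symmetric F" and a: "hermitian a" and r: "0 < r"
  shows "ennreal (r\<^sup>2 / 4096 * (2 * pi)\<^sup>2 * (\<Sum>k\<in>{k\<in>F. norm (wave k) * r \<le> 1}. (norm (wave k))\<^sup>2 * (norm (a k))\<^sup>2)) \<le>
    mean_increment r (L2_class (trig F a))"
proof -
  let ?f = "trig F a"
  let ?B = "ball (0::real^2) r"
  let ?m = "emeasure lborel ?B"
  let ?L = "{k\<in>F. norm (wave k) * r \<le> 1}"
  let ?w = "\<lambda>k h. ennreal ((norm (cis (wave k \<bullet> h) - 1))\<^sup>2)"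
  let ?c = "\<lambda>k. ennreal ((2 * pi)\<^sup>2 * (norm (a k))\<^sup>2)"
  let ?d = "\<lambda>k. ennreal (r^4 * (norm (wave k))\<^sup>2 / 1024)"
  have fin: "finite F" using F by (simp add: symmetric_def)
  interpret T: sigma_finite_measure torus by (rule sigma_finite_torus)
  interpret pair_sigma_finite "lborel :: (real^2) measure" torus ..
  define e where "e h x = ennreal ((norm (?f (x + h) - ?f x))\<^sup>2)" for h x
  have cont: "continuous_on UNIV (\<lambda>(h, x). (norm (?f (x + h) - ?f x))\<^sup>2)"
    unfolding case_prod_unfold
    by (intro continuous_intros continuous_on_compose2[OF continuous_trig[of UNIV F a]]) auto
  have meas: "(\<lambda>(h, x). e h x) \<in> borel_measurable (lborel \<Otimes>\<^sub>M torus)"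
  proof -
    have "(\<lambda>(h, x). (norm (?f (x + h) - ?f x))\<^sup>2) \<in> borel_measurable (borel \<Otimes>\<^sub>M borel)"
      using borel_measurable_continuous_onI[OF cont] by (simp add: borel_prod)
    moreover have "(\<lambda>x. x) \<in> lborel \<Otimes>\<^sub>M torus \<rightarrow>\<^sub>M borel \<Otimes>\<^sub>M borel"
    proof -
      have "(\<lambda>x. x) \<in> torus \<rightarrow>\<^sub>M borel" by (intro measurable_torus) simp
      then have "(\<lambda>x. (fst x, snd x)) \<in> lborel \<Otimes>\<^sub>M torus \<rightarrow>\<^sub>M borel \<Otimes>\<^sub>M borel"
        by (intro measurable_Pair measurable_compose[OF measurable_snd]) simp_all
      then show ?thesis by simp
    qed
    ultimately have "(\<lambda>(h, x). (norm (?f (x + h) - ?f x))\<^sup>2) \<in> borel_measurable (lborel \<Otimes>\<^sub>M torus)"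
      using measurable_compose by blast
    then show ?thesis unfolding e_def case_prod_unfold by measurable
  qed
  have inner_int: "(\<integral>\<^sup>+ x. e h x \<partial>torus) = ennreal ((2 * pi)\<^sup>2) * (\<Sum>k\<in>F. ennreal ((norm (a k))\<^sup>2) * ?w k h)" for h
  proof -
    define b where "b k = (\<chi> j. (cis (wave k \<bullet> h) - 1) * a k $ j)" for k
    have b: "hermitian b" using a by (simp add: hermitian_def b_def wave_minus cis_cnj algebra_simps)
    have "?f (x + h) - ?f x = trig F b x" for x
      unfolding trig_shift trig_diff by (simp add: b_def vec_eq_iff trig_def algebra_simps)
    then have "(\<integral>\<^sup>+ x. e h x \<partial>torus) = (\<integral>\<^sup>+ x. ennreal ((norm (trig F b x))\<^sup>2) \<partial>torus)" by (simp add: e_def)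
    also have "\<dots> = ennreal (LINT x|torus. (norm (trig F b x))\<^sup>2)"
      by (intro nn_integral_eq_integral integrable_torus_continuous continuous_intros continuous_trig) auto
    also have "\<dots> = ennreal ((2 * pi)\<^sup>2 * (\<Sum>k\<in>F. (norm (a k))\<^sup>2 * (norm (cis (wave k \<bullet> h) - 1))\<^sup>2))"
      unfolding integral_trig_square[OF F b] b_def norm_vec_scale by (simp only: power_mult_distrib mult.commute)
    also have "\<dots> = ennreal ((2 * pi)\<^sup>2) * (\<Sum>k\<in>F. ennreal ((norm (a k))\<^sup>2) * ?w k h)"
      by (simp add: ennreal_mult'' sum_ennreal[symmetric] sum_nonneg del: sum_ennreal)
    finally show ?thesis .
  qed
  have wm: "(\<lambda>h. ?w k h) \<in> borel_measurable lborel" for k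
    by (intro measurable_compose[OF _ measurable_ennreal] borel_measurable_continuous_onI continuous_intros) (simp add: borel_measurable_continuous_onI continuous_intros)
  have im: "indicator ?B \<in> borel_measurable lborel" by (intro borel_measurable_indicator) simp
  have meas2: "(\<lambda>(h, x). e h x * indicator ?B h) \<in> borel_measurable (lborel \<Otimes>\<^sub>M torus)"
    using meas unfolding case_prod_unfold by (intro borel_measurable_times_ennreal measurable_compose[OF measurable_fst im])
  have "mean_increment r (L2_class ?f) = (\<integral>\<^sup>+ x. (\<integral>\<^sup>+ h\<in>?B. e h x \<partial>lborel) / ?m \<partial>torus)"
    unfolding e_def by (rule mean_increment.abs_eq) (simp add: ae_equal_def square_integrable_trig)
  also have "\<dots> = (\<integral>\<^sup>+ x. (\<integral>\<^sup>+ h. e h x * indicator ?B h \<partial>lborel) \<partial>torus) / ?m"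
  proof -
    have "(\<lambda>x. \<integral>\<^sup>+ h. e h x * indicator ?B h \<partial>lborel) \<in> borel_measurable torus"
    proof (rule lborel.borel_measurable_nn_integral)
      from measurable_pair_swap[OF meas2]
      show "(\<lambda>(x, h). e h x * indicator ?B h) \<in> borel_measurable (torus \<Otimes>\<^sub>M lborel)"
        by (simp add: case_prod_unfold)
    qed
    then show ?thesis by (rule nn_integral_divide)
  qed
  also have "(\<integral>\<^sup>+ x. (\<integral>\<^sup>+ h. e h x * indicator ?B h \<partial>lborel) \<partial>torus) = (\<integral>\<^sup>+ h. (\<integral>\<^sup>+ x. e h x * indicator ?B h \<partial>torus) \<partial>lborel)"
    by (rule Fubini'[OF meas2])
  also have "\<dots> = (\<integral>\<^sup>+ h. (\<Sum>k\<in>F. ?c k * (?w k h * indicator ?B h)) \<partial>lborel)"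
  proof (intro nn_integral_cong)
    fix h :: "real^2"
    have "(\<lambda>x. e h x) \<in> borel_measurable torus" using measurable_Pair2[OF meas, of h] by simp
    then show "(\<integral>\<^sup>+ x. e h x * indicator ?B h \<partial>torus) = (\<Sum>k\<in>F. ?c k * (?w k h * indicator ?B h))"
      by (subst nn_integral_multc) (auto simp: inner_int sum_distrib_left sum_distrib_right ennreal_mult'' mult_ac)
  qed
  also have "\<dots> = (\<Sum>k\<in>F. ?c k * (\<integral>\<^sup>+ h\<in>?B. ?w k h \<partial>lborel))"
  proof -
    have wm2: "(\<lambda>h. ?w k h * indicator ?B h) \<in> borel_measurable lborel" for k
      by (intro borel_measurable_times_ennreal wm im)
    then show ?thesis
      by (subst nn_integral_sum) (intro borel_measurable_times_ennreal borel_measurable_const wm2 sum.cong refl nn_integral_cmult)+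
  qed
  also have "\<dots> / ?m \<ge> (\<Sum>k\<in>?L. ?c k * ?d k) / ennreal (4 * r\<^sup>2)"
    unfolding divide_ennreal_def
  proof (intro mult_mono inverse_antimono_ennreal)
    have "(\<Sum>k\<in>?L. ?c k * ?d k) \<le>
      (\<Sum>k\<in>?L. ?c k * (\<integral>\<^sup>+ h\<in>?B. ?w k h \<partial>lborel))"
      using ball_average_wave_ge[OF r] by (intro sum_mono mult_left_mono) auto
    also have "\<dots> \<le> (\<Sum>k\<in>F. ?c k * (\<integral>\<^sup>+ h\<in>?B. ?w k h \<partial>lborel))"
      using fin by (intro sum_mono2) auto
    finally show "(\<Sum>k\<in>?L. ?c k * ?d k) \<le>
      (\<Sum>k\<in>F. ?c k * (\<integral>\<^sup>+ h\<in>?B. ?w k h \<partial>lborel))" .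
    show "?m \<le> ennreal (4 * r\<^sup>2)" by (rule emeasure_ball_le[OF r])
  qed auto
  also have "(\<Sum>k\<in>?L. ?c k * ?d k) / ennreal (4 * r\<^sup>2) =
     ennreal (r\<^sup>2 / 4096 * (2 * pi)\<^sup>2 * (\<Sum>k\<in>?L. (norm (wave k))\<^sup>2 * (norm (a k))\<^sup>2))"
  proof -
    have alg: "x * y * (r^4 * w / 1024) / (4 * r\<^sup>2) = r\<^sup>2 / 4096 * x * (w * y)" for x y w :: real
    proof -
      have gen: "x * y * (s * s * w / 1024) / (4 * s) = s / 4096 * x * (w * y)" if "s > 0" for s :: real
        using that by (simp add: field_simps)
      have "r^4 = r\<^sup>2 * r\<^sup>2" by (simp flip: power_add)
      then show ?thesis using gen[of "r\<^sup>2"] r by (simp only: zero_less_power)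
    qed
    have "(\<Sum>k\<in>?L. ?c k * ?d k) =
      ennreal (\<Sum>k\<in>?L. (2 * pi)\<^sup>2 * (norm (a k))\<^sup>2 * (r^4 * (norm (wave k))\<^sup>2 / 1024))"
    proof (subst sum_ennreal[symmetric])
      show "(\<Sum>k\<in>?L. ?c k * ?d k) =
        (\<Sum>k\<in>?L. ennreal ((2 * pi)\<^sup>2 * (norm (a k))\<^sup>2 * (r^4 * (norm (wave k))\<^sup>2 / 1024)))"
        by (intro sum.cong refl ennreal_mult''[symmetric]) simp
    qed simp
    moreover have "ennreal (\<Sum>k\<in>?L. (2 * pi)\<^sup>2 * (norm (a k))\<^sup>2 * (r^4 * (norm (wave k))\<^sup>2 / 1024)) / ennreal (4 * r\<^sup>2) = ennreal ((\<Sum>k\<in>?L. (2 * pi)\<^sup>2 * (norm (a k))\<^sup>2 * (r^4 * (norm (wave k))\<^sup>2 / 1024)) / (4 * r\<^sup>2))"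
      using r by (intro divide_ennreal sum_nonneg) auto
    ultimately have 1: "(\<Sum>k\<in>?L. ?c k * ?d k) / ennreal (4 * r\<^sup>2) =
      ennreal ((\<Sum>k\<in>?L. (2 * pi)\<^sup>2 * (norm (a k))\<^sup>2 * (r^4 * (norm (wave k))\<^sup>2 / 1024)) / (4 * r\<^sup>2))"
      by (simp only:)
    have 2: "(\<Sum>k\<in>?L. (2 * pi)\<^sup>2 * (norm (a k))\<^sup>2 * (r^4 * (norm (wave k))\<^sup>2 / 1024)) / (4 * r\<^sup>2) =
      r\<^sup>2 / 4096 * (2 * pi)\<^sup>2 * (\<Sum>k\<in>?L. (norm (wave k))\<^sup>2 * (norm (a k))\<^sup>2)"
      unfolding sum_divide_distrib sum_distrib_left by (rule sum.cong[OF refl]) (rule alg)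
    show ?thesis unfolding 1 2 ..
  qed
  finally show ?thesis .
qed

lemma ennreal_sqrt_leD:
  assumes "ennreal_sqrt x \<le> ennreal y" "0 \<le> y"
  shows "x \<le> ennreal (y\<^sup>2)"
proof (cases x)
  case (real s)
  then have "sqrt s \<le> y" using assms by (simp add: ennreal_sqrt_def)
  then have "(sqrt s)\<^sup>2 \<le> y\<^sup>2" using real by (intro power_mono) auto
  then show ?thesis using real by simp
next
  case top
  then show ?thesis using assms by (simp add: ennreal_sqrt_def top_unique)
qed

text \<open>The scale r = 1 / R selects exactly the modes up to R. Dividing
  \<open>C\<^sup>2 * r powr (2 * \<alpha>)\<close> by
  \<open>r\<^sup>2 / 4096 * (2 * pi)\<^sup>2\<close> gives the constant and the exponent 2 - 2 *
  \<alpha>.\<close>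

lemma structure_function_low_modes:
  assumes K: "K > 0" and F: "symmetric F" and a: "\<And>i. hermitian (a i)" and R: "R > 0" and C: "C > 0"
    and S2: "S2 (empirical_measure K (\<lambda>i. L2_class (trig F (a i)))) (1 / R) \<le> ennreal (C * (1 / R) powr \<alpha>)"
  shows "(\<Sum>i<K. \<Sum>k\<in>{k\<in>F. norm (wave k) \<le> R}. (norm (wave k))\<^sup>2 * (norm (a i k))\<^sup>2) / real K \<le>
    1024 * C\<^sup>2 / pi\<^sup>2 * R powr (2 - 2 * \<alpha>)"
proof -
  define r where "r = 1 / R"
  have r: "r > 0" using R by (simp add: r_def)
  have set_eq: "{k\<in>F. norm (wave k) * r \<le> 1} = {k\<in>F. norm (wave k) \<le> R}"
    using R by (auto simp: r_def field_simps)
  define s where "s i = (\<Sum>k\<in>{k\<in>F. norm (wave k) \<le> R}. (norm (wave k))\<^sup>2 * (norm (a i k))\<^sup>2)" for i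
  have s: "0 \<le> s i" for i unfolding s_def by (intro sum_nonneg) auto
  define c where "c = r\<^sup>2 / 4096 * (2 * pi)\<^sup>2"
  have c: "c > 0" using r by (simp add: c_def)
  have "ennreal ((\<Sum>i<K. c * s i) / real K) = (\<Sum>i<K. ennreal (c * s i)) / of_nat K"
    using c s K by (subst sum_ennreal) (simp_all add: ennreal_of_nat_eq_real_of_nat divide_ennreal sum_nonneg)
  also have "\<dots> \<le> (\<Sum>i<K. mean_increment r (L2_class (trig F (a i)))) / of_nat K"
    using mean_increment_trig_ge[OF F a r] unfolding set_eq s_def c_def
    by (intro divide_right_mono_ennreal sum_mono)
  also have "\<dots> \<le> (\<integral>\<^sup>+ u. mean_increment r u \<partial>empirical_measure K (\<lambda>i. L2_class (trig F (a i))))"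
    by (rule nn_integral_empirical_measure_ge[OF K])
  also have "\<dots> \<le> ennreal ((C * r powr \<alpha>)\<^sup>2)"
    using S2 C unfolding S2_def r_def[symmetric] by (intro ennreal_sqrt_leD) auto
  finally have "(\<Sum>i<K. c * s i) / real K \<le> (C * r powr \<alpha>)\<^sup>2" by simp
  then have "c * ((\<Sum>i<K. s i) / real K) \<le> (C * r powr \<alpha>)\<^sup>2" by (simp add: sum_distrib_left)
  then have "(\<Sum>i<K. s i) / real K \<le> (C * r powr \<alpha>)\<^sup>2 / c" using c by (simp add: field_simps)
  also have "(C * r powr \<alpha>)\<^sup>2 / c = 1024 * C\<^sup>2 / pi\<^sup>2 * R powr (2 - 2 * \<alpha>)"
  proof -
    have "(r powr \<alpha>)\<^sup>2 = R powr (- 2 * \<alpha>)"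
    proof -
      have "r = R powr (- 1)" using R by (simp add: r_def powr_minus divide_inverse)
      then have "(r powr \<alpha>)\<^sup>2 = (R powr (- 1)) powr (\<alpha> + \<alpha>)"
        by (simp only: power2_eq_square powr_add)
      also have "\<dots> = R powr (- 1 * (\<alpha> + \<alpha>))" by (rule powr_powr)
      finally show ?thesis by simp
    qed
    moreover have "R powr (2 - 2 * \<alpha>) = R\<^sup>2 * R powr (- 2 * \<alpha>)"
      using R by (simp add: powr_diff powr_minus divide_inverse powr_numeral)
    ultimately show ?thesis using R by (simp add: c_def r_def power_mult_distrib power_divide)
  qed
  finally show ?thesis by (simp add: s_def)
qed

text \<open>On the shell from \<open>2 ^ m\<close> to \<open>2 ^ Suc m\<close> the weight is at
  least \<open>4 ^ m\<close>, while the hypothesis at the outer radius bounds the weighted sum by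
  \<open>A * (4 * q) ^ Suc m\<close>. The shells are therefore dominated by a geometric
  series.\<close>

lemma dyadic_tail:
  fixes b :: "int^2 \<Rightarrow> real"
  assumes fin: "finite F" and b: "\<And>k. k \<in> F \<Longrightarrow> 0 \<le> b k" and \<alpha>: "0 < \<alpha>" and A: "0 \<le> A"
    and low: "\<And>R. R > 0 \<Longrightarrow> (\<Sum>k\<in>{k\<in>F. norm (wave k) \<le> R}. (norm (wave k))\<^sup>2 * b k) \<le> A * R powr (2 - 2 * \<alpha>)"
  defines "q \<equiv> 2 powr (- 2 * \<alpha>)"
  shows "(\<Sum>k\<in>{k\<in>F. 2 ^ n < norm (wave k)}. b k) \<le> 4 * A / (1 - q) * q ^ n"
proof -
  have q: "0 < q" "q < 1" using \<alpha> by (simp_all add: q_def powr_less_one)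
  have shell: "(\<Sum>k\<in>{k\<in>F. 2 ^ m < norm (wave k) \<and> norm (wave k) \<le> 2 ^ Suc m}. b k) \<le> 4 * A * q ^ m" for m
  proof -
    let ?S = "{k\<in>F. 2 ^ m < norm (wave k) \<and> norm (wave k) \<le> 2 ^ Suc m}"
    have "4 ^ m * (\<Sum>k\<in>?S. b k) \<le> (\<Sum>k\<in>?S. (norm (wave k))\<^sup>2 * b k)"
      unfolding sum_distrib_left
    proof (intro sum_mono mult_right_mono)
      fix k assume "k \<in> ?S"
      then have "(2 ^ m)\<^sup>2 \<le> (norm (wave k))\<^sup>2" by (intro power_mono) auto
      then show "4 ^ m \<le> (norm (wave k))\<^sup>2" by (simp add: power_even_eq[symmetric] power_mult)
    qed (use b in auto)
    also have "\<dots> \<le> (\<Sum>k\<in>{k\<in>F. norm (wave k) \<le> 2 ^ Suc m}. (norm (wave k))\<^sup>2 * b k)"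
      using fin b by (intro sum_mono2) auto
    also have "\<dots> \<le> A * (2 ^ Suc m) powr (2 - 2 * \<alpha>)" by (rule low) simp
    also have "(2 ^ Suc m :: real) powr (2 - 2 * \<alpha>) = 4 ^ Suc m * q ^ Suc m"
    proof -
      have "(2 ^ Suc m :: real) powr (2 - 2 * \<alpha>) = (2 powr (2 - 2 * \<alpha>)) ^ Suc m"
        by (simp add: powr_realpow[symmetric] powr_powr mult.commute del: power_Suc)
      also have "2 powr (2 - 2 * \<alpha>) = 4 * q"
        by (simp add: q_def powr_diff powr_minus divide_inverse powr_numeral)
      finally show ?thesis by (simp add: power_mult_distrib)
    qed
    also have "A * (4 ^ Suc m * q ^ Suc m) \<le> 4 ^ m * (4 * A * q ^ m)"
      using q A by (simp add: mult_left_le_one_le mult_nonneg_nonneg mult_left_mono)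
    finally show ?thesis by simp
  qed
  have partial: "(\<Sum>k\<in>{k\<in>F. 2 ^ n < norm (wave k) \<and> norm (wave k) \<le> 2 ^ (n + J)}. b k) \<le> 4 * A * (\<Sum>j<J. q ^ (n + j))" for J
  proof (induction J)
    case (Suc J)
    have "{k\<in>F. 2 ^ n < norm (wave k) \<and> norm (wave k) \<le> 2 ^ (n + Suc J)} =
      {k\<in>F. 2 ^ n < norm (wave k) \<and> norm (wave k) \<le> 2 ^ (n + J)} \<union> {k\<in>F. 2 ^ (n + J) < norm (wave k) \<and> norm (wave k) \<le> 2 ^ Suc (n + J)}"
    proof -
      have "(2::real) ^ (n + J) \<le> 2 ^ (n + Suc J)" "(2::real) ^ n \<le> 2 ^ (n + J)" by (intro power_increasing; simp)+
      then show ?thesis by (auto intro: order_trans dest: le_less_trans[OF \<open>(2::real) ^ n \<le> 2 ^ (n + J)\<close>])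
    qed
    then have "(\<Sum>k\<in>{k\<in>F. 2 ^ n < norm (wave k) \<and> norm (wave k) \<le> 2 ^ (n + Suc J)}. b k) =
      (\<Sum>k\<in>{k\<in>F. 2 ^ n < norm (wave k) \<and> norm (wave k) \<le> 2 ^ (n + J)}. b k) +
      (\<Sum>k\<in>{k\<in>F. 2 ^ (n + J) < norm (wave k) \<and> norm (wave k) \<le> 2 ^ Suc (n + J)}. b k)"
      using fin by (simp add: sum.union_disjoint disjoint_iff)
    also have "\<dots> \<le> 4 * A * (\<Sum>j<J. q ^ (n + j)) + 4 * A * q ^ (n + J)"
      by (intro add_mono Suc.IH shell)
    finally show ?case by (simp add: algebra_simps)
  next
    case 0
    have "{k\<in>F. 2 ^ n < norm (wave k) \<and> norm (wave k) \<le> 2 ^ (n + 0)} = {}" by auto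
    then show ?case by (simp only: sum.empty) simp
  qed
  obtain J where J: "\<And>k. k \<in> F \<Longrightarrow> norm (wave k) \<le> 2 ^ (n + J)"
  proof -
    obtain B where B: "\<And>k. k \<in> F \<Longrightarrow> norm (wave k) \<le> B"
      using finite_imageI[OF fin, of "\<lambda>k. norm (wave k)"] by (meson Max_ge imageI)
    obtain J where "B < 2 ^ J" using real_arch_pow[of 2 B] by auto
    moreover have "(2::real) ^ J \<le> 2 ^ (n + J)" by (intro power_increasing) auto
    ultimately show ?thesis using B that by (meson less_imp_le order_trans)
  qed
  have "(\<Sum>k\<in>{k\<in>F. 2 ^ n < norm (wave k)}. b k) = (\<Sum>k\<in>{k\<in>F. 2 ^ n < norm (wave k) \<and> norm (wave k) \<le> 2 ^ (n + J)}. b k)"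
    using J by (intro sum.cong) auto
  also have "\<dots> \<le> 4 * A * (\<Sum>j<J. q ^ (n + j))" by (rule partial)
  also have "\<dots> \<le> 4 * A * (q ^ n / (1 - q))"
  proof (intro mult_left_mono)
    have "(\<Sum>j<J. q ^ (n + j)) = q ^ n * (\<Sum>j<J. q ^ j)" by (simp add: power_add sum_distrib_left)
    also have "(\<Sum>j<J. q ^ j) = (1 - q ^ J) / (1 - q)" using q by (simp add: sum_gp_strict)
    also have "q ^ n * ((1 - q ^ J) / (1 - q)) \<le> q ^ n * (1 / (1 - q))"
      using q by (intro mult_left_mono divide_right_mono) auto
    finally show "(\<Sum>j<J. q ^ (n + j)) \<le> q ^ n / (1 - q)" by simp
  qed (use A in simp)
  finally show ?thesis by (simp add: mult.commute)
qed

section \<open>Differential inequalities in time and decay of the enstrophy\<close>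

lemma has_derivative_norm_sq:
  fixes c :: "real \<Rightarrow> 'a::real_inner"
  assumes "(c has_vector_derivative d) (at t within S)"
  shows "((\<lambda>s. (norm (c s))\<^sup>2) has_real_derivative 2 * (c t \<bullet> d)) (at t within S)"
  using has_derivative_inner[OF assms[unfolded has_vector_derivative_def] assms[unfolded has_vector_derivative_def]]
  unfolding has_field_derivative_def power2_norm_eq_inner
  by (rule has_derivative_eq_rhs) (auto simp: inner_commute fun_eq_iff)

lemma nonincreasing_within:
  fixes f :: "real \<Rightarrow> real"
  assumes "\<And>t. t \<in> {0..T} \<Longrightarrow> (f has_real_derivative f' t) (at t within {0..T})" "\<And>t. t \<in> {0..T} \<Longrightarrow> f' t \<le> 0"
    and "0 \<le> s" "s \<le> t" "t \<le> T"
  shows "f t \<le> f s"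
proof -
  have "\<exists>x\<in>{s..t}. f t - f s = f' x * (t - s)"
  proof (rule mvt_very_simple[OF assms(4)])
    fix x assume "s \<le> x" "x \<le> t"
    then have "(f has_derivative (*) (f' x)) (at x within {0..T})"
      using assms(1)[of x] assms(3,5) by (simp add: has_field_derivative_def)
    then show "(f has_derivative (*) (f' x)) (at x within {s..t})"
      by (rule has_derivative_subset) (use assms(3,5) in auto)
  qed
  then obtain x where "x \<in> {s..t}" "f t - f s = f' x * (t - s)" by blast
  then show ?thesis using assms(2)[of x] assms(3-5) mult_nonpos_nonneg[of "f' x" "t - s"] by simp
qed

text \<open>Gronwall's argument with the integrating factor \<open>exp (\<kappa> * t)\<close>:
  \<open>(z t - B) * exp (\<kappa> * t)\<close> does not increase. The sign of \<open>B\<close> lets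
  the term \<open>- B\<close> at time 0 be dropped.\<close>

lemma linear_decay:
  fixes z :: "real \<Rightarrow> real"
  assumes z: "\<And>t. t \<in> {0..T} \<Longrightarrow> (z has_real_derivative z' t) (at t within {0..T})"
    and le: "\<And>t. t \<in> {0..T} \<Longrightarrow> z' t \<le> - \<kappa> * z t + \<kappa> * B"
    and "0 \<le> B" and t: "t \<in> {0..T}"
  shows "z t \<le> B + exp (- \<kappa> * t) * z 0"
proof -
  have "(z t - B) * exp (\<kappa> * t) \<le> (z 0 - B) * exp (\<kappa> * 0)"
  proof (rule nonincreasing_within[where f' = "\<lambda>t. (z' t + \<kappa> * (z t - B)) * exp (\<kappa> * t)" and T = T and f = "\<lambda>t. (z t - B) * exp (\<kappa> * t)"])
    fix t assume t: "t \<in> {0..T}"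
    show "((\<lambda>t. (z t - B) * exp (\<kappa> * t)) has_real_derivative (z' t + \<kappa> * (z t - B)) * exp (\<kappa> * t)) (at t within {0..T})"
      by (rule derivative_eq_intros z[OF t] refl)+ (simp add: algebra_simps)
    show "(z' t + \<kappa> * (z t - B)) * exp (\<kappa> * t) \<le> 0"
      using le[OF t] by (intro mult_nonpos_nonneg) (simp_all add: algebra_simps)
  qed (use t in auto)
  then have "(z t - B) * exp (\<kappa> * t) \<le> z 0" using \<open>0 \<le> B\<close> by simp
  then have "exp (- \<kappa> * t) * ((z t - B) * exp (\<kappa> * t)) \<le> exp (- \<kappa> * t) * z 0" by (intro mult_left_mono) auto
  moreover have "exp (- \<kappa> * t) * ((z t - B) * exp (\<kappa> * t)) = (z t - B) * exp (- \<kappa> * t + \<kappa> * t)"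
    by (simp only: exp_add mult_ac)
  moreover have "exp (- \<kappa> * t + \<kappa> * t) = 1" by simp
  ultimately have "z t - B \<le> exp (- \<kappa> * t) * z 0" by (simp only: mult_1_right)
  then show ?thesis by linarith
qed

text \<open>The viscous damping of all modes above \<open>2 * m\<close>, combined with the structure function bound
  \<open>low\<close> on the modes below \<open>R\<close>, forces the enstrophy down to the level of the low modes.\<close>

lemma mean_enstrophy_bound:
  fixes c d :: "nat \<Rightarrow> real \<Rightarrow> int^2 \<Rightarrow> complex^2"
  assumes fin: "finite F" and K: "K > 0" and \<nu>: "0 \<le> \<nu>" and R: "R > 0"
    and deriv: "\<And>i t k. i < K \<Longrightarrow> t \<in> {0..T} \<Longrightarrow> ((\<lambda>s. c i s k) has_vector_derivative d i t k) (at t within {0..T})"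
    and balance: "\<And>i t. i < K \<Longrightarrow> t \<in> {0..T} \<Longrightarrow> (\<Sum>k\<in>F. (norm (wave k))\<^sup>2 * (c i t k \<bullet> d i t k)) =
        - \<nu> * (\<Sum>k\<in>F. q k * (norm (wave k))^4 * (norm (c i t k))\<^sup>2)"
    and q: "\<And>k. 0 \<le> q k" "\<And>k. norm (wave k) > 2 * m \<Longrightarrow> q k = 1"
    and low: "\<And>t. t \<in> {0..T} \<Longrightarrow> (\<Sum>i<K. \<Sum>k\<in>{k\<in>F. norm (wave k) \<le> R}. (norm (wave k))\<^sup>2 * (norm (c i t k))\<^sup>2) / real K \<le> B"
    and m: "8 * \<nu> * m\<^sup>2 \<le> \<nu> * R\<^sup>2"
    and t: "t \<in> {0..T}"
  shows "(\<Sum>i<K. \<Sum>k\<in>F. (norm (wave k))\<^sup>2 * (norm (c i t k))\<^sup>2) / real K \<le>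
    2 * B + exp (- (\<nu> * R\<^sup>2) * t) * ((\<Sum>i<K. \<Sum>k\<in>F. (norm (wave k))\<^sup>2 * (norm (c i 0 k))\<^sup>2) / real K)"
proof (rule linear_decay[OF _ _ _ t])
  let ?z' = "\<lambda>t. (\<Sum>i<K. \<Sum>k\<in>F. (norm (wave k))\<^sup>2 * (2 * (c i t k \<bullet> d i t k))) / real K"
  show "((\<lambda>t. (\<Sum>i<K. \<Sum>k\<in>F. (norm (wave k))\<^sup>2 * (norm (c i t k))\<^sup>2) / real K) has_real_derivative ?z' t) (at t within {0..T})"
    if "t \<in> {0..T}" for t
    by (intro DERIV_cdivide DERIV_sum DERIV_cmult has_derivative_norm_sq deriv that) auto
  show "?z' t \<le> - (\<nu> * R\<^sup>2) * ((\<Sum>i<K. \<Sum>k\<in>F. (norm (wave k))\<^sup>2 * (norm (c i t k))\<^sup>2) / real K) + \<nu> * R\<^sup>2 * (2 * B)"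
    if t: "t \<in> {0..T}" for t
  proof -
    \<comment> \<open>Damping is complete above 2 * m; below, its absence costs at most
      \<open>4 * m\<^sup>2\<close> times the enstrophy weight. Above R the fourth power dominates
      \<open>R\<^sup>2\<close> times the weight, and the modes below R are left to the hypothesis
      \<open>low\<close>.\<close>
    have mode: "(R\<^sup>2 - 4 * m\<^sup>2) * (norm (wave k))\<^sup>2 - (if norm (wave k) \<le> R then R\<^sup>2 * (norm (wave k))\<^sup>2 else 0) \<le> q k * (norm (wave k))^4" for k
    proof -
      let ?w = "(norm (wave k))\<^sup>2"
      have 1: "?w * ?w - 4 * m\<^sup>2 * ?w \<le> q k * (norm (wave k))^4"
      proof (cases "norm (wave k) > 2 * m")
        case True
        have "norm (wave k) ^ 4 = ?w * ?w" by (simp add: power4_eq_xxxx power2_eq_square)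
        moreover have "0 \<le> 4 * m\<^sup>2 * ?w" by simp
        ultimately show ?thesis unfolding q(2)[OF True] by simp
      next
        case False
        then have "?w \<le> (2 * m)\<^sup>2" by (intro power_mono) auto
        then have "?w * ?w \<le> 4 * m\<^sup>2 * ?w" by (intro mult_right_mono) (auto simp: power_mult_distrib)
        moreover have "0 \<le> q k * (norm (wave k))^4" using q(1) by simp
        ultimately show ?thesis by linarith
      qed
      have 2: "R\<^sup>2 * ?w - (if norm (wave k) \<le> R then R\<^sup>2 * ?w else 0) \<le> ?w * ?w"
      proof (cases "norm (wave k) \<le> R")
        case False
        then have "R\<^sup>2 \<le> ?w" using R by (intro power_mono) auto
        then have "R\<^sup>2 * ?w \<le> ?w * ?w" by (intro mult_right_mono) auto
        then show ?thesis using False by simp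
      qed simp
      show ?thesis using 1 2 by (simp add: left_diff_distrib)
    qed
    have each: "(\<Sum>k\<in>F. (norm (wave k))\<^sup>2 * (2 * (c i t k \<bullet> d i t k))) \<le>
       - (2 * \<nu> * (R\<^sup>2 - 4 * m\<^sup>2)) * (\<Sum>k\<in>F. (norm (wave k))\<^sup>2 * (norm (c i t k))\<^sup>2) +
       2 * \<nu> * R\<^sup>2 * (\<Sum>k\<in>{k\<in>F. norm (wave k) \<le> R}. (norm (wave k))\<^sup>2 * (norm (c i t k))\<^sup>2)" if i: "i < K" for i
    proof -
      have "(\<Sum>k\<in>F. ((R\<^sup>2 - 4 * m\<^sup>2) * (norm (wave k))\<^sup>2 - (if norm (wave k) \<le> R then R\<^sup>2 * (norm (wave k))\<^sup>2 else 0)) * (norm (c i t k))\<^sup>2) \<le>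
        (\<Sum>k\<in>F. q k * (norm (wave k))^4 * (norm (c i t k))\<^sup>2)"
        by (intro sum_mono mult_right_mono mode) auto
      also have "(\<Sum>k\<in>F. ((R\<^sup>2 - 4 * m\<^sup>2) * (norm (wave k))\<^sup>2 - (if norm (wave k) \<le> R then R\<^sup>2 * (norm (wave k))\<^sup>2 else 0)) * (norm (c i t k))\<^sup>2) =
         (R\<^sup>2 - 4 * m\<^sup>2) * (\<Sum>k\<in>F. (norm (wave k))\<^sup>2 * (norm (c i t k))\<^sup>2) -
         R\<^sup>2 * (\<Sum>k\<in>{k\<in>F. norm (wave k) \<le> R}. (norm (wave k))\<^sup>2 * (norm (c i t k))\<^sup>2)"
        using fin unfolding sum.inter_filter[OF fin] sum_distrib_left sum_subtractf[symmetric]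
        by (intro sum.cong refl) (simp add: algebra_simps)
      finally have "2 * \<nu> * ((R\<^sup>2 - 4 * m\<^sup>2) * (\<Sum>k\<in>F. (norm (wave k))\<^sup>2 * (norm (c i t k))\<^sup>2) -
         R\<^sup>2 * (\<Sum>k\<in>{k\<in>F. norm (wave k) \<le> R}. (norm (wave k))\<^sup>2 * (norm (c i t k))\<^sup>2)) \<le>
         2 * \<nu> * (\<Sum>k\<in>F. q k * (norm (wave k))^4 * (norm (c i t k))\<^sup>2)"
        using \<nu> by (intro mult_left_mono) auto
      moreover have "(\<Sum>k\<in>F. (norm (wave k))\<^sup>2 * (2 * (c i t k \<bullet> d i t k))) = - (2 * \<nu> * (\<Sum>k\<in>F. q k * (norm (wave k))^4 * (norm (c i t k))\<^sup>2))"
        using balance[OF i t] by (simp add: sum_distrib_left[of 2] mult.left_commute[of _ 2] flip: sum_distrib_left)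
      ultimately show ?thesis by (simp add: algebra_simps)
    qed
    define Z L where "Z = (\<Sum>i<K. \<Sum>k\<in>F. (norm (wave k))\<^sup>2 * (norm (c i t k))\<^sup>2)"
      and "L = (\<Sum>i<K. \<Sum>k\<in>{k\<in>F. norm (wave k) \<le> R}. (norm (wave k))\<^sup>2 * (norm (c i t k))\<^sup>2)"
    have "(\<Sum>i<K. \<Sum>k\<in>F. (norm (wave k))\<^sup>2 * (2 * (c i t k \<bullet> d i t k))) \<le> - (2 * \<nu> * (R\<^sup>2 - 4 * m\<^sup>2)) * Z + 2 * \<nu> * R\<^sup>2 * L"
      unfolding Z_def L_def sum_distrib_left[of _ _ "{..<K}"] sum.distrib[symmetric] by (intro sum_mono each) simp
    also have "\<dots> \<le> - (\<nu> * R\<^sup>2) * Z + 2 * \<nu> * R\<^sup>2 * (B * real K)"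
    proof (rule add_mono)
      have "0 \<le> Z" unfolding Z_def by (intro sum_nonneg) auto
      \<comment> \<open>The loss \<open>8 * \<nu> * m\<^sup>2\<close> consumes at most half of the
        rate \<open>2 * \<nu> * R\<^sup>2\<close>. This halving of the rate against an unchanged
        source is the origin of the factor 2 in \<open>2 * B\<close>.\<close>
      moreover have "- (2 * \<nu> * (R\<^sup>2 - 4 * m\<^sup>2)) \<le> - (\<nu> * R\<^sup>2)" using m by (simp add: algebra_simps)
      ultimately show "- (2 * \<nu> * (R\<^sup>2 - 4 * m\<^sup>2)) * Z \<le> - (\<nu> * R\<^sup>2) * Z" by (intro mult_right_mono)
      have "L \<le> B * real K" using low[OF t] K by (simp add: L_def field_simps)
      then show "2 * \<nu> * R\<^sup>2 * L \<le> 2 * \<nu> * R\<^sup>2 * (B * real K)" using \<nu> by (intro mult_left_mono) auto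
    qed
    finally have "?z' t \<le> (- (\<nu> * R\<^sup>2) * Z + 2 * \<nu> * R\<^sup>2 * (B * real K)) / real K" by (rule divide_right_mono) simp
    also have "\<dots> = - (\<nu> * R\<^sup>2) * (Z / real K) + \<nu> * R\<^sup>2 * (2 * B)" using K by (simp add: field_simps)
    finally show ?thesis by (simp add: Z_def)
  qed
  have "0 \<le> (\<Sum>i<K. \<Sum>k\<in>{k\<in>F. norm (wave k) \<le> R}. (norm (wave k))\<^sup>2 * (norm (c i t k))\<^sup>2) / real K"
    by (intro divide_nonneg_nonneg sum_nonneg) auto
  then show "0 \<le> 2 * B" using low[OF t] by simp
qed

section \<open>Ensembles of spectral viscosity solutions\<close>

lemma sv_energy_nonincreasing:
  assumes c: "sv_coefficients T N \<nu> q c d" and \<nu>: "0 \<le> \<nu>" and q: "\<And>k. 0 \<le> q k" and st: "0 \<le> s" "s \<le> t" "t \<le> T"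
  shows "(\<Sum>k\<in>modes N. (norm (c t k))\<^sup>2) \<le> (\<Sum>k\<in>modes N. (norm (c s k))\<^sup>2)"
proof (rule nonincreasing_within[OF _ _ st])
  let ?e' = "\<lambda>t. \<Sum>k\<in>modes N. 2 * (c t k \<bullet> d t k)"
  show "((\<lambda>t. \<Sum>k\<in>modes N. (norm (c t k))\<^sup>2) has_real_derivative ?e' t) (at t within {0..T})"
    if "t \<in> {0..T}" for t
    using c that unfolding sv_coefficients_def by (intro DERIV_sum has_derivative_norm_sq) blast
  show "?e' t \<le> 0" if "t \<in> {0..T}" for t
  proof -
    have "(\<Sum>k\<in>modes N. c t k \<bullet> d t k) = - \<nu> * (\<Sum>k\<in>modes N. q k * (norm (wave k))\<^sup>2 * (norm (c t k))\<^sup>2)"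
      using c that unfolding sv_coefficients_def by blast
    also have "\<dots> \<le> 0" using \<nu> q by (simp add: sum_nonneg)
    finally show ?thesis by (simp flip: sum_distrib_left)
  qed
qed

text \<open>The constant depends on \<open>k\<close>, \<open>\<epsilon>\<close> and the energy bound
  only: the viscosity coefficient is at most \<open>\<epsilon>\<close>, and the convection enters
  through \<open>norm (wave k)\<close> and the energy. This independence of \<open>N\<close> is the
  equicontinuity in time used for compactness.\<close>

lemma sv_coefficients_lipschitz:
  assumes c: "sv_coefficients T N \<nu> q c d" and \<nu>: "0 \<le> \<nu>" "\<nu> \<le> \<epsilon>" and q: "\<And>k. 0 \<le> q k" "\<And>k. q k \<le> 1"
    and E: "\<And>t. t \<in> {0..T} \<Longrightarrow> (\<Sum>k\<in>modes N. (norm (c t k))\<^sup>2) \<le> E"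
    and st: "s \<in> {0..T}" "t \<in> {0..T}"
  shows "norm (c t k - c s k) \<le> (\<epsilon> * (norm (wave k))\<^sup>2 * sqrt E + norm (wave k) * E) * \<bar>t - s\<bar>"
proof -
  have coeff: "norm (c t k) \<le> sqrt E" if t: "t \<in> {0..T}" for t
  proof (cases "k \<in> modes N")
    case True
    have "(norm (c t k))\<^sup>2 \<le> (\<Sum>k\<in>modes N. (norm (c t k))\<^sup>2)"
      using True finite_modes by (intro member_le_sum) auto
    then show ?thesis using E[OF t] by (intro real_le_rsqrt) simp
  next
    case False
    have "0 \<le> (\<Sum>k\<in>modes N. (norm (c t k))\<^sup>2)" by (intro sum_nonneg) simp
    then have "0 \<le> E" using E[OF t] by linarith
    then show ?thesis using False c by (simp add: sv_coefficients_def)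
  qed
  have d: "norm (d t k) \<le> \<epsilon> * (norm (wave k))\<^sup>2 * sqrt E + norm (wave k) * E" if t: "t \<in> {0..T}" for t
  proof -
    have "\<bar>\<nu> * q k\<bar> \<le> \<epsilon>" using \<nu> q[of k] mult_mono[of \<nu> \<epsilon> "q k" 1] by (simp add: abs_mult)
    then have "\<bar>\<nu> * q k\<bar> * (norm (wave k))\<^sup>2 * norm (c t k) \<le> \<epsilon> * (norm (wave k))\<^sup>2 * sqrt E"
      using coeff[OF t] \<nu> by (intro mult_mono) auto
    moreover have "norm (wave k) * (\<Sum>p\<in>modes N. (norm (c t p))\<^sup>2) \<le> norm (wave k) * E"
      by (intro mult_left_mono E[OF t]) auto
    moreover have "norm (d t k) \<le> \<bar>\<nu> * q k\<bar> * (norm (wave k))\<^sup>2 * norm (c t k) + norm (wave k) * (\<Sum>p\<in>modes N. (norm (c t p))\<^sup>2)"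
      using c t unfolding sv_coefficients_def by blast
    ultimately show ?thesis by linarith
  qed
  have "norm (c t k - c s k) \<le> (\<epsilon> * (norm (wave k))\<^sup>2 * sqrt E + norm (wave k) * E) * norm (t - s)"
  proof (rule differentiable_bound[of "{0..T}" "\<lambda>t. c t k" "\<lambda>t h. h *\<^sub>R d t k"])
    fix t assume t: "t \<in> {0..T}"
    show "((\<lambda>t. c t k) has_derivative (\<lambda>h. h *\<^sub>R d t k)) (at t within {0..T})"
      using c t unfolding sv_coefficients_def has_vector_derivative_def by blast
    show "onorm (\<lambda>h. h *\<^sub>R d t k) \<le> \<epsilon> * (norm (wave k))\<^sup>2 * sqrt E + norm (wave k) * E"
    proof (rule onorm_le)
      fix h :: real
      have "\<bar>h\<bar> * norm (d t k) \<le> \<bar>h\<bar> * (\<epsilon> * (norm (wave k))\<^sup>2 * sqrt E + norm (wave k) * E)"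
        by (intro mult_left_mono d[OF t]) simp
      then show "norm (h *\<^sub>R d t k) \<le> (\<epsilon> * (norm (wave k))\<^sup>2 * sqrt E + norm (wave k) * E) * norm h"
        by (simp only: norm_scaleR real_norm_def mult.commute)
    qed
  qed (use st in auto)
  then show ?thesis by simp
qed

lemma norm_wave_modes_le: "k \<in> modes N \<Longrightarrow> (norm (wave k))\<^sup>2 \<le> 2 * (real N)\<^sup>2"
proof -
  assume "k \<in> modes N"
  then have "\<bar>real_of_int (k $ i)\<bar> \<le> \<bar>real N\<bar>" for i
    using modes_iff[of k N] by (metis abs_of_nat of_int_abs of_int_le_iff of_int_of_nat_eq)
  then have "(real_of_int (k $ i))\<^sup>2 \<le> (real N)\<^sup>2" for i unfolding abs_le_square_iff .
  from add_mono[OF this[of 1] this[of 2]] show ?thesis by (simp add: norm_wave_sq)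
qed

text \<open>The cutoff \<open>R\<close> is chosen so that the damping rate \<open>\<nu> * R\<^sup>2\<close> is \<open>N powr (\<alpha> / 2)\<close>: this is fast enough to
  forget an initial enstrophy of order \<open>N\<^sup>2\<close>, while \<open>\<nu> * R powr (2 - 2 * \<alpha>)\<close> still vanishes.\<close>

lemma mean_energy_dissipation_le:
  fixes c d :: "nat \<Rightarrow> real \<Rightarrow> int^2 \<Rightarrow> complex^2"
  assumes K: "K > 0" and N: "N \<ge> 1" and \<epsilon>: "\<epsilon> > 0" and A: "A \<ge> 0"
    and c: "\<And>i. i < K \<Longrightarrow> sv_coefficients T N (\<epsilon> / N) q (c i) (d i)"
    and q: "\<And>k. 0 \<le> q k" "\<And>k. q k \<le> 1" "\<And>k. norm (wave k) > 2 * m \<Longrightarrow> q k = 1"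
    and E: "\<And>i t. i < K \<Longrightarrow> t \<in> {0..T} \<Longrightarrow> (\<Sum>k\<in>modes N. (norm (c i t k))\<^sup>2) \<le> E"
    and low: "\<And>R t. R > 0 \<Longrightarrow> t \<in> {0..T} \<Longrightarrow>
      (\<Sum>i<K. \<Sum>k\<in>{k\<in>modes N. norm (wave k) \<le> R}. (norm (wave k))\<^sup>2 * (norm (c i t k))\<^sup>2) / real K \<le> A * R powr (2 - 2 * \<alpha>)"
    and m: "8 * (\<epsilon> / N * m\<^sup>2) \<le> N powr (\<alpha> / 2)"
    and t: "0 < t1" "t1 \<le> t2" "t2 \<le> T"
  shows "(\<Sum>i<K. \<Sum>k\<in>modes N. (norm (c i t1 k))\<^sup>2) / real K - (\<Sum>i<K. \<Sum>k\<in>modes N. (norm (c i t2 k))\<^sup>2) / real K \<le>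
    T * (2 * (\<epsilon> / N) * (2 * (A * (N powr (1 + \<alpha> / 2) / \<epsilon>) powr (1 - \<alpha>)) + exp (- (N powr (\<alpha> / 2)) * t1) * (2 * (real N)\<^sup>2 * E)))"
    (is "_ \<le> T * ?B")
proof -
  define \<nu> where "\<nu> = \<epsilon> / N"
  define R where "R = sqrt (N powr (1 + \<alpha> / 2) / \<epsilon>)"
  have \<nu>: "\<nu> > 0" using \<epsilon> N by (simp add: \<nu>_def)
  have R: "R > 0" using \<epsilon> N by (simp add: R_def)
  have rate: "\<nu> * R\<^sup>2 = N powr (\<alpha> / 2)"
    using \<epsilon> N by (simp add: R_def \<nu>_def powr_add)
  have R_powr: "R powr (2 - 2 * \<alpha>) = (N powr (1 + \<alpha> / 2) / \<epsilon>) powr (1 - \<alpha>)"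
  proof -
    have "R = (N powr (1 + \<alpha> / 2) / \<epsilon>) powr (1 / 2)" using \<epsilon> by (simp add: R_def powr_half_sqrt)
    then have "R powr (2 - 2 * \<alpha>) = (N powr (1 + \<alpha> / 2) / \<epsilon>) powr (1 / 2 * (2 - 2 * \<alpha>))" by (simp only: powr_powr)
    also have "1 / 2 * (2 - 2 * \<alpha>) = 1 - \<alpha>" by simp
    finally show ?thesis .
  qed
  define Z where "Z t = (\<Sum>i<K. \<Sum>k\<in>modes N. (norm (wave k))\<^sup>2 * (norm (c i t k))\<^sup>2) / real K" for t
  have deriv: "((\<lambda>s. c i s k) has_vector_derivative d i t k) (at t within {0..T})" if "i < K" "t \<in> {0..T}" for i t k
    using c[OF that(1)] that(2) unfolding sv_coefficients_def by blast
  \<comment> \<open>The initial enstrophy is bounded by the energy times the largest squared wave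
    number; the exponential factor has to absorb this power of N.\<close>
  have Z0: "Z 0 \<le> 2 * (real N)\<^sup>2 * E"
  proof -
    have "(\<Sum>k\<in>modes N. (norm (wave k))\<^sup>2 * (norm (c i 0 k))\<^sup>2) \<le> 2 * (real N)\<^sup>2 * E" if i: "i < K" for i
    proof -
      have "(\<Sum>k\<in>modes N. (norm (wave k))\<^sup>2 * (norm (c i 0 k))\<^sup>2) \<le> (\<Sum>k\<in>modes N. 2 * (real N)\<^sup>2 * (norm (c i 0 k))\<^sup>2)"
        by (intro sum_mono mult_right_mono norm_wave_modes_le) auto
      also have "\<dots> \<le> 2 * (real N)\<^sup>2 * E"
        unfolding sum_distrib_left[symmetric] using E[OF i, of 0] t by (intro mult_left_mono) auto
      finally show ?thesis .
    qed
    then have "(\<Sum>i<K. \<Sum>k\<in>modes N. (norm (wave k))\<^sup>2 * (norm (c i 0 k))\<^sup>2) \<le> (\<Sum>i<K. 2 * (real N)\<^sup>2 * E)"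
      by (intro sum_mono) auto
    then show ?thesis using K by (simp add: Z_def field_simps)
  qed
  have Z: "Z t \<le> 2 * (A * (N powr (1 + \<alpha> / 2) / \<epsilon>) powr (1 - \<alpha>)) + exp (- (N powr (\<alpha> / 2)) * t1) * (2 * (real N)\<^sup>2 * E)"
    if t': "t \<in> {t1..T}" for t
  proof -
    have tT: "t \<in> {0..T}" using t t' by auto
    have "Z t \<le> 2 * (A * R powr (2 - 2 * \<alpha>)) + exp (- (\<nu> * R\<^sup>2) * t) * Z 0"
      unfolding Z_def
    proof (rule mean_enstrophy_bound[OF finite_modes K _ R deriv _ q(1) q(3) low[OF R] _ tT])
      show "(\<Sum>k\<in>modes N. (norm (wave k))\<^sup>2 * (c i t k \<bullet> d i t k)) = - \<nu> * (\<Sum>k\<in>modes N. q k * (norm (wave k))^4 * (norm (c i t k))\<^sup>2)"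
        if "i < K" "t \<in> {0..T}" for i t
        using c[OF that(1)] that(2) unfolding sv_coefficients_def \<nu>_def by blast
      show "8 * \<nu> * m\<^sup>2 \<le> \<nu> * R\<^sup>2" using m rate by (simp add: \<nu>_def)
    qed (use \<nu> in auto)
    also have "exp (- (\<nu> * R\<^sup>2) * t) * Z 0 \<le> exp (- (N powr (\<alpha> / 2)) * t1) * (2 * (real N)\<^sup>2 * E)"
    proof (intro mult_mono Z0)
      show "exp (- (\<nu> * R\<^sup>2) * t) \<le> exp (- (N powr (\<alpha> / 2)) * t1)"
        unfolding rate using t' by (simp add: mult_left_mono)
      show "0 \<le> Z 0" unfolding Z_def by (intro divide_nonneg_nonneg sum_nonneg) auto
    qed simp
    finally show ?thesis by (simp only: R_powr)
  qed
  let ?e = "\<lambda>t. (\<Sum>i<K. \<Sum>k\<in>modes N. (norm (c i t k))\<^sup>2) / real K"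
  let ?e' = "\<lambda>t. (\<Sum>i<K. \<Sum>k\<in>modes N. 2 * (c i t k \<bullet> d i t k)) / real K"
  \<comment> \<open>The mean value theorem takes the place of integrating the energy balance: the
    loss is the dissipation rate at one time x, and \<open>Z\<close> bounds that rate at every time
    after t1.\<close>
  have "\<exists>x\<in>{t1..t2}. ?e t2 - ?e t1 = ?e' x * (t2 - t1)"
  proof (rule mvt_very_simple[OF t(2)])
    fix x assume x: "t1 \<le> x" "x \<le> t2"
    have "(?e has_real_derivative ?e' x) (at x within {0..T})"
      using x t by (intro DERIV_cdivide DERIV_sum has_derivative_norm_sq deriv) auto
    then show "(?e has_derivative (*) (?e' x)) (at x within {t1..t2})"
      unfolding has_field_derivative_def by (rule has_derivative_subset) (use t in auto)
  qed
  then obtain x where x: "x \<in> {t1..t2}" and eq: "?e t2 - ?e t1 = ?e' x * (t2 - t1)" by blast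
  have xT: "x \<in> {0..T}" using x t by auto
  have "- ?e' x = (\<Sum>i<K. 2 * \<nu> * (\<Sum>k\<in>modes N. q k * (norm (wave k))\<^sup>2 * (norm (c i x k))\<^sup>2)) / real K"
  proof -
    have "(\<Sum>k\<in>modes N. 2 * (c i x k \<bullet> d i x k)) = - (2 * \<nu> * (\<Sum>k\<in>modes N. q k * (norm (wave k))\<^sup>2 * (norm (c i x k))\<^sup>2))" if "i < K" for i
      using c[OF that] xT unfolding sv_coefficients_def \<nu>_def[symmetric] sum_distrib_left[symmetric] by simp
    then show ?thesis by (simp add: sum_negf)
  qed
  also have "\<dots> \<le> (\<Sum>i<K. 2 * \<nu> * (\<Sum>k\<in>modes N. (norm (wave k))\<^sup>2 * (norm (c i x k))\<^sup>2)) / real K"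
  proof (intro divide_right_mono sum_mono mult_left_mono)
    fix i k
    have "q k * ((norm (wave k))\<^sup>2 * (norm (c i x k))\<^sup>2) \<le> 1 * ((norm (wave k))\<^sup>2 * (norm (c i x k))\<^sup>2)"
      by (intro mult_right_mono q) auto
    then show "q k * (norm (wave k))\<^sup>2 * (norm (c i x k))\<^sup>2 \<le> (norm (wave k))\<^sup>2 * (norm (c i x k))\<^sup>2"
      by (simp add: mult.assoc)
  qed (use \<nu> in auto)
  also have "\<dots> = 2 * \<nu> * Z x" by (simp add: Z_def sum_distrib_left)
  also have "\<dots> \<le> ?B"
    using Z[of x] x t \<nu> unfolding \<nu>_def[symmetric] by (intro mult_left_mono) auto
  finally have e': "- ?e' x \<le> ?B" .
  have B: "0 \<le> ?B"
  proof -
    have "0 \<le> 2 * \<nu> * Z x" unfolding Z_def using \<nu> by (intro mult_nonneg_nonneg divide_nonneg_nonneg sum_nonneg) auto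
    then show ?thesis using \<open>2 * \<nu> * Z x \<le> ?B\<close> by linarith
  qed
  have "?e t1 - ?e t2 = (- ?e' x) * (t2 - t1)" using eq by (simp add: algebra_simps)
  also have "\<dots> \<le> ?B * (t2 - t1)" using e' t by (intro mult_right_mono) auto
  also have "\<dots> \<le> ?B * T" using B t by (intro mult_left_mono) auto
  finally show ?thesis by (simp only: mult.commute)
qed

text \<open>Since \<open>(1 + \<alpha> / 2) * (1 - \<alpha>)\<close> equals
  \<open>1 - (\<alpha> / 2 + \<alpha>\<^sup>2 / 2)\<close>, division by N leaves a negative power in
  the first term. In the second, the exponential with t1 > 0 beats the remaining factor N.\<close>

lemma dissipation_bound_tendsto_0:
  fixes \<alpha> :: real
  assumes "0 < \<alpha>" "\<alpha> < 1" "0 < \<epsilon>" "0 < t1"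
  shows "(\<lambda>N. T * (2 * (\<epsilon> / real N) * (2 * (A * (real N powr (1 + \<alpha> / 2) / \<epsilon>) powr (1 - \<alpha>)) +
    exp (- (real N powr (\<alpha> / 2)) * t1) * (2 * (real N)\<^sup>2 * E)))) \<longlonglongrightarrow> 0"
proof -
  have 1: "(\<lambda>N. (real N powr (1 + \<alpha> / 2) / \<epsilon>) powr (1 - \<alpha>) / real N) \<longlonglongrightarrow> 0"
  proof -
    have "(\<lambda>N. real N powr (- (\<alpha> / 2 + \<alpha>\<^sup>2 / 2)) * (1 / \<epsilon>) powr (1 - \<alpha>)) \<longlonglongrightarrow> 0 * (1 / \<epsilon>) powr (1 - \<alpha>)"
    proof (intro tendsto_mult tendsto_const tendsto_neg_powr filterlim_real_sequentially)
      have "0 < \<alpha> / 2 + \<alpha>\<^sup>2 / 2" using assms by (intro add_pos_pos) auto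
      then show "- (\<alpha> / 2 + \<alpha>\<^sup>2 / 2) < 0" by simp
    qed
    moreover have "\<forall>\<^sub>F N in sequentially. real N powr (- (\<alpha> / 2 + \<alpha>\<^sup>2 / 2)) * (1 / \<epsilon>) powr (1 - \<alpha>) = (real N powr (1 + \<alpha> / 2) / \<epsilon>) powr (1 - \<alpha>) / real N"
      using eventually_gt_at_top[of 0]
    proof eventually_elim
      case (elim N)
      have "(real N powr (1 + \<alpha> / 2) / \<epsilon>) powr (1 - \<alpha>) = real N powr ((1 + \<alpha> / 2) * (1 - \<alpha>)) * (1 / \<epsilon>) powr (1 - \<alpha>)"
        using assms by (simp add: powr_mult[symmetric] powr_powr[symmetric])
      moreover have "(1 + \<alpha> / 2) * (1 - \<alpha>) = 1 + - (\<alpha> / 2 + \<alpha>\<^sup>2 / 2)" by (simp add: power2_eq_square field_simps)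
      ultimately show ?case using elim by (simp only: powr_add) simp
    qed
    ultimately show ?thesis using Lim_transform_eventually by fastforce
  qed
  have 2: "(\<lambda>N. exp (- (real N powr (\<alpha> / 2)) * t1) * real N) \<longlonglongrightarrow> 0"
    using assms by real_asymp
  have "(\<lambda>N. T * (2 * \<epsilon> * (2 * A * ((real N powr (1 + \<alpha> / 2) / \<epsilon>) powr (1 - \<alpha>) / real N) +
     2 * E * (exp (- (real N powr (\<alpha> / 2)) * t1) * real N)))) \<longlonglongrightarrow> T * (2 * \<epsilon> * (2 * A * 0 + 2 * E * 0))"
    by (intro tendsto_intros 1 2)
  moreover have "\<forall>\<^sub>F N in sequentially. T * (2 * \<epsilon> * (2 * A * ((real N powr (1 + \<alpha> / 2) / \<epsilon>) powr (1 - \<alpha>) / real N) +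
     2 * E * (exp (- (real N powr (\<alpha> / 2)) * t1) * real N))) =
     T * (2 * (\<epsilon> / real N) * (2 * (A * (real N powr (1 + \<alpha> / 2) / \<epsilon>) powr (1 - \<alpha>)) +
      exp (- (real N powr (\<alpha> / 2)) * t1) * (2 * (real N)\<^sup>2 * E)))"
    using eventually_gt_at_top[of 0]
  proof eventually_elim
    case (elim N)
    have gen: "T * (2 * \<epsilon> * (2 * A * (x / n) + 2 * E * (y * n))) = T * (2 * (\<epsilon> / n) * (2 * (A * x) + y * (2 * n\<^sup>2 * E)))" if "n > 0" for x y n :: real
      using that by (simp add: field_simps power2_eq_square)
    show ?case using elim by (intro gen) simp
  qed
  ultimately show ?thesis using Lim_transform_eventually by fastforce
qed

text \<open>This is the interface to the compactness argument, which no longer sees the equation: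
  uniform energy, a Lipschitz bound for each mode, a geometric tail of the mean energy, and
  vanishing energy loss between positive times.\<close>

lemma sv_ensemble_coefficients:
  fixes T M \<epsilon> C \<alpha> :: real and S :: "nat \<Rightarrow> real \<Rightarrow> L2x \<Rightarrow> L2x" and v :: "nat \<Rightarrow> nat \<Rightarrow> L2x"
  assumes T: "T > 0" and params: "SV_parameters \<epsilon> m Q" and S: "SV_solution_map T \<epsilon> Q J S"
    and K: "\<And>N. N \<ge> 1 \<Longrightarrow> K N > 0"
    and adm: "\<And>N i. N \<ge> 1 \<Longrightarrow> i < K N \<Longrightarrow> admissible (v N i)"
    and init: "\<And>N i. N \<ge> 1 \<Longrightarrow> i < K N \<Longrightarrow> norm (S N 0 (v N i)) < M"
    and C: "C > 0" and \<alpha>: "0 < \<alpha>" "\<alpha> < 1"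
    and S2_bound: "\<And>N r t. N \<ge> 1 \<Longrightarrow> r > 0 \<Longrightarrow> t \<in> {0..T} \<Longrightarrow>
      S2 (empirical_measure (K N) (\<lambda>i. S N t (v N i))) r \<le> ennreal (C * r powr \<alpha>)"
  obtains c :: "nat \<Rightarrow> nat \<Rightarrow> real \<Rightarrow> int^2 \<Rightarrow> complex^2" and L :: "int^2 \<Rightarrow> real" and A q :: real where
    "\<And>N i t. N \<ge> 1 \<Longrightarrow> i < K N \<Longrightarrow> t \<in> {0..T} \<Longrightarrow> S N t (v N i) = L2_class (trig (modes N) (c N i t))"
    "\<And>N i t. N \<ge> 1 \<Longrightarrow> i < K N \<Longrightarrow> hermitian (c N i t)"
    "\<And>N i t k. N \<ge> 1 \<Longrightarrow> i < K N \<Longrightarrow> k \<notin> modes N \<Longrightarrow> c N i t k = 0"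
    "\<And>N i t. N \<ge> 1 \<Longrightarrow> i < K N \<Longrightarrow> t \<in> {0..T} \<Longrightarrow> (\<Sum>k\<in>modes N. (norm (c N i t k))\<^sup>2) \<le> (M / (2 * pi))\<^sup>2"
    "\<And>N i s t k. N \<ge> 1 \<Longrightarrow> i < K N \<Longrightarrow> s \<in> {0..T} \<Longrightarrow> t \<in> {0..T} \<Longrightarrow> norm (c N i t k - c N i s k) \<le> L k * \<bar>t - s\<bar>"
    "0 < q" "q < 1"
    "\<And>N n t. N \<ge> 1 \<Longrightarrow> t \<in> {0..T} \<Longrightarrow>
      (\<Sum>i<K N. \<Sum>k\<in>{k\<in>modes N. 2 ^ n < norm (wave k)}. (norm (c N i t k))\<^sup>2) / real (K N) \<le> A * q ^ n"
    "\<And>t1 t2. 0 < t1 \<Longrightarrow> t1 \<le> t2 \<Longrightarrow> t2 \<le> T \<Longrightarrow>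
      (\<lambda>N. (\<Sum>i<K N. \<Sum>k\<in>modes N. (norm (c N i t1 k))\<^sup>2) / real (K N) -
        (\<Sum>i<K N. \<Sum>k\<in>modes N. (norm (c N i t2 k))\<^sup>2) / real (K N)) \<longlonglongrightarrow> 0"
proof -
  have \<epsilon>: "\<epsilon> > 0" and Q: "\<And>N k. N \<ge> 1 \<Longrightarrow> 0 \<le> Q N k \<and> Q N k \<le> 1 \<and> (norm (wave k) > 2 * m N \<longrightarrow> Q N k = 1)"
    and m_bdd: "bdd_above ((\<lambda>N. \<epsilon> / real N * (m N)\<^sup>2) ` {1..})"
    using params unfolding SV_parameters_def by auto
  have q: "0 \<le> sym_mult (Q N) k" "sym_mult (Q N) k \<le> 1" "norm (wave k) > 2 * m N \<Longrightarrow> sym_mult (Q N) k = 1"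
    if "N \<ge> 1" for N k
    using Q[OF that, of k] Q[OF that, of "- k"] by (auto simp: sym_mult_def wave_minus)
  have "\<exists>c d. sv_coefficients T N (\<epsilon> / real N) (sym_mult (Q N)) c d \<and> (\<forall>t\<in>{0..T}. S N t (v N i) = L2_class (trig (modes N) (c t)))"
    if N: "N \<ge> 1" "i < K N" for N i
  proof -
    obtain u where u: "SV_solution T N (\<epsilon> / real N) (Q N) (J N (v N i)) u" "\<forall>t\<in>{0..T}. S N t (v N i) = L2_class (u t)"
      using S adm[OF N] N(1) unfolding SV_solution_map_def by blast
    show ?thesis by (rule SV_solution_sv_coefficients[OF T u(1)]) (use u(2) in auto)
  qed
  then have "\<forall>N i. \<exists>cd. N \<ge> 1 \<and> i < K N \<longrightarrow> sv_coefficients T N (\<epsilon> / real N) (sym_mult (Q N)) (fst cd) (snd cd) \<and>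
      (\<forall>t\<in>{0..T}. S N t (v N i) = L2_class (trig (modes N) (fst cd t)))"
    by (metis fst_conv snd_conv)
  then obtain cd where cd: "\<And>N i. N \<ge> 1 \<Longrightarrow> i < K N \<Longrightarrow> sv_coefficients T N (\<epsilon> / real N) (sym_mult (Q N)) (fst (cd N i)) (snd (cd N i)) \<and>
      (\<forall>t\<in>{0..T}. S N t (v N i) = L2_class (trig (modes N) (fst (cd N i) t)))"
    by metis
  define c d where "c N i = fst (cd N i)" and "d N i = snd (cd N i)" for N i
  have c: "sv_coefficients T N (\<epsilon> / real N) (sym_mult (Q N)) (c N i) (d N i)" if "N \<ge> 1" "i < K N" for N i
    using cd[OF that] by (simp add: c_def d_def)
  have solution: "S N t (v N i) = L2_class (trig (modes N) (c N i t))" if "N \<ge> 1" "i < K N" "t \<in> {0..T}" for N i t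
    using cd[OF that(1,2)] that(3) by (simp add: c_def)
  have herm: "hermitian (c N i t)" if "N \<ge> 1" "i < K N" for N i t
    using c[OF that] by (simp add: sv_coefficients_def)
  \<comment> \<open>The area \<open>(2 * pi)\<^sup>2\<close> of the torus is the constant in
    Parseval's identity, so a field of norm below M has coefficient energy at most
    \<open>E\<close>.\<close>
  define E where "E = (M / (2 * pi))\<^sup>2"
  have energy: "(\<Sum>k\<in>modes N. (norm (c N i t k))\<^sup>2) \<le> E" if N: "N \<ge> 1" "i < K N" and t: "t \<in> {0..T}" for N i t
  proof -
    have "(\<Sum>k\<in>modes N. (norm (c N i t k))\<^sup>2) \<le> (\<Sum>k\<in>modes N. (norm (c N i 0 k))\<^sup>2)"
      using \<epsilon> t by (intro sv_energy_nonincreasing[OF c[OF N] _ q(1)[OF N(1)]]) auto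
    moreover have "(2 * pi)\<^sup>2 * (\<Sum>k\<in>modes N. (norm (c N i 0 k))\<^sup>2) \<le> M\<^sup>2"
    proof -
      have "(norm (S N 0 (v N i)))\<^sup>2 \<le> M\<^sup>2" using init[OF N] by (intro power_mono) auto
      then show ?thesis
        using solution[OF N, of 0] T norm_L2_class_trig[OF symmetric_modes herm[OF N]] by simp
    qed
    then have "(\<Sum>k\<in>modes N. (norm (c N i 0 k))\<^sup>2) \<le> E"
      by (simp add: E_def power_divide pos_le_divide_eq mult.commute)
    ultimately show ?thesis by linarith
  qed
  define L where "L k = \<epsilon> * (norm (wave k))\<^sup>2 * sqrt E + norm (wave k) * E" for k
  have lip: "norm (c N i t k - c N i s k) \<le> L k * \<bar>t - s\<bar>" if N: "N \<ge> 1" "i < K N" and st: "s \<in> {0..T}" "t \<in> {0..T}" for N i s t k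
    unfolding L_def
  proof (rule sv_coefficients_lipschitz[OF c[OF N] _ _ q(1,2)[OF N(1)] energy[OF N] st])
    show "0 \<le> \<epsilon> / real N" "\<epsilon> / real N \<le> \<epsilon>" using \<epsilon> N(1) by (auto simp: divide_le_eq mult_le_cancel_left1)
  qed
  define A where "A = 1024 * C\<^sup>2 / pi\<^sup>2"
  have A: "0 \<le> A" by (simp add: A_def)
  have low: "(\<Sum>i<K N. \<Sum>k\<in>{k\<in>modes N. norm (wave k) \<le> R}. (norm (wave k))\<^sup>2 * (norm (c N i t k))\<^sup>2) / real (K N) \<le> A * R powr (2 - 2 * \<alpha>)"
    if N: "N \<ge> 1" and R: "R > 0" and t: "t \<in> {0..T}" for N R t
  proof -
    \<comment> \<open>Padding by zero: \<open>structure_function_low_modes\<close> asks for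
      hermitian coefficients at every index, and the empirical measure only sees the indices below
      \<open>K N\<close>.\<close>
    define a where "a i = (if i < K N then c N i t else (\<lambda>k. 0))" for i
    have a: "hermitian (a i)" for i using herm[OF N] by (simp add: a_def hermitian_def)
    have "empirical_measure (K N) (\<lambda>i. S N t (v N i)) = empirical_measure (K N) (\<lambda>i. L2_class (trig (modes N) (a i)))"
      unfolding empirical_measure_def
      by (intro distr_cong refl) (auto simp: space_uniform_count_measure solution[OF N _ t] a_def)
    then have "(\<Sum>i<K N. \<Sum>k\<in>{k\<in>modes N. norm (wave k) \<le> R}. (norm (wave k))\<^sup>2 * (norm (a i k))\<^sup>2) / real (K N) \<le> A * R powr (2 - 2 * \<alpha>)"
      unfolding A_def using S2_bound[OF N, of "1 / R" t] R t
      by (intro structure_function_low_modes[OF K[OF N] symmetric_modes a R C]) auto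
    then show ?thesis by (simp add: a_def)
  qed
  define r where "r = 2 powr (- 2 * \<alpha>)"
  show ?thesis
  proof (rule that[of c L r "4 * A / (1 - r)"])
    show "S N t (v N i) = L2_class (trig (modes N) (c N i t))" if "N \<ge> 1" "i < K N" "t \<in> {0..T}" for N i t
      by (rule solution[OF that])
    show "hermitian (c N i t)" if "N \<ge> 1" "i < K N" for N i t by (rule herm[OF that])
    show "c N i t k = 0" if "N \<ge> 1" "i < K N" "k \<notin> modes N" for N i t k
      using c[OF that(1,2)] that(3) by (simp add: sv_coefficients_def)
    show "(\<Sum>k\<in>modes N. (norm (c N i t k))\<^sup>2) \<le> (M / (2 * pi))\<^sup>2" if "N \<ge> 1" "i < K N" "t \<in> {0..T}" for N i t
      using energy[OF that] by (simp add: E_def)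
    show "norm (c N i t k - c N i s k) \<le> L k * \<bar>t - s\<bar>" if "N \<ge> 1" "i < K N" "s \<in> {0..T}" "t \<in> {0..T}" for N i s t k
      by (rule lip[OF that])
    show "0 < r" "r < 1" using \<alpha> by (simp_all add: r_def powr_less_one)
    show "(\<Sum>i<K N. \<Sum>k\<in>{k\<in>modes N. 2 ^ n < norm (wave k)}. (norm (c N i t k))\<^sup>2) / real (K N) \<le> 4 * A / (1 - r) * r ^ n"
      if N: "N \<ge> 1" and t: "t \<in> {0..T}" for N n t
    proof -
      \<comment> \<open>The dyadic estimate is applied to sample means of squared coefficients,
        since the structure function bound holds for the mean and not for each sample.\<close>
      have "(\<Sum>k\<in>{k\<in>modes N. 2 ^ n < norm (wave k)}. (\<Sum>i<K N. (norm (c N i t k))\<^sup>2) / real (K N)) \<le> 4 * A / (1 - r) * r ^ n"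
        unfolding r_def
      proof (rule dyadic_tail[OF finite_modes _ \<alpha>(1) A])
        show "(\<Sum>k\<in>{k\<in>modes N. norm (wave k) \<le> R}. (norm (wave k))\<^sup>2 * ((\<Sum>i<K N. (norm (c N i t k))\<^sup>2) / real (K N))) \<le> A * R powr (2 - 2 * \<alpha>)"
          if "R > 0" for R
        proof -
          have "(\<Sum>k\<in>{k\<in>modes N. norm (wave k) \<le> R}. (norm (wave k))\<^sup>2 * ((\<Sum>i<K N. (norm (c N i t k))\<^sup>2) / real (K N))) =
            (\<Sum>i<K N. \<Sum>k\<in>{k\<in>modes N. norm (wave k) \<le> R}. (norm (wave k))\<^sup>2 * (norm (c N i t k))\<^sup>2) / real (K N)"
            by (subst sum.swap) (simp add: sum_divide_distrib sum_distrib_left)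
          then show ?thesis using low[OF N that t] by simp
        qed
      qed (simp add: sum_nonneg)
      also have "(\<Sum>k\<in>{k\<in>modes N. 2 ^ n < norm (wave k)}. (\<Sum>i<K N. (norm (c N i t k))\<^sup>2) / real (K N)) =
        (\<Sum>i<K N. \<Sum>k\<in>{k\<in>modes N. 2 ^ n < norm (wave k)}. (norm (c N i t k))\<^sup>2) / real (K N)"
        by (subst sum.swap) (simp add: sum_divide_distrib)
      finally show ?thesis .
    qed
    show "(\<lambda>N. (\<Sum>i<K N. \<Sum>k\<in>modes N. (norm (c N i t1 k))\<^sup>2) / real (K N) -
        (\<Sum>i<K N. \<Sum>k\<in>modes N. (norm (c N i t2 k))\<^sup>2) / real (K N)) \<longlonglongrightarrow> 0" (is "?D \<longlonglongrightarrow> 0")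
      if t: "0 < t1" "t1 \<le> t2" "t2 \<le> T" for t1 t2
    proof (rule tendsto_sandwich[OF _ _ tendsto_const dissipation_bound_tendsto_0[OF \<alpha> \<epsilon> t(1), of T A E]])
      \<comment> \<open>The product of the viscosity with \<open>(m N)\<^sup>2\<close> stays bounded
        while \<open>real N powr (\<alpha> / 2)\<close> grows, so the required relation between
        \<open>m\<close> and the damping rate holds for all large N.\<close>
      obtain Bm where Bm: "\<And>N. N \<ge> 1 \<Longrightarrow> \<epsilon> / real N * (m N)\<^sup>2 \<le> Bm"
        using m_bdd unfolding bdd_above_def by auto
      have "filterlim (\<lambda>N. real N powr (\<alpha> / 2)) at_top sequentially"
        using \<alpha> by real_asymp
      then have "\<forall>\<^sub>F N in sequentially. 8 * Bm \<le> real N powr (\<alpha> / 2)" by (simp add: filterlim_at_top)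
      with eventually_ge_at_top[of 1]
      show "\<forall>\<^sub>F N in sequentially. ?D N \<le> T * (2 * (\<epsilon> / real N) * (2 * (A * (real N powr (1 + \<alpha> / 2) / \<epsilon>) powr (1 - \<alpha>)) +
        exp (- (real N powr (\<alpha> / 2)) * t1) * (2 * (real N)\<^sup>2 * E)))"
      proof eventually_elim
        case (elim N)
        show ?case
        proof (rule mean_energy_dissipation_le[OF K[OF elim(1)] elim(1) \<epsilon> A c[OF elim(1)] q[OF elim(1)] energy[OF elim(1)] low[OF elim(1)] _ t])
          show "8 * (\<epsilon> / real N * (m N)\<^sup>2) \<le> real N powr (\<alpha> / 2)" using Bm[OF elim(1)] elim(2) by simp
        qed
      qed
      show "\<forall>\<^sub>F N in sequentially. 0 \<le> ?D N"
        using eventually_ge_at_top[of 1]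
      proof eventually_elim
        case (elim N)
        have "(\<Sum>i<K N. \<Sum>k\<in>modes N. (norm (c N i t2 k))\<^sup>2) \<le> (\<Sum>i<K N. \<Sum>k\<in>modes N. (norm (c N i t1 k))\<^sup>2)"
          using \<epsilon> t by (intro sum_mono sv_energy_nonincreasing[OF c[OF elim] _ q(1)[OF elim]]) auto
        then show ?case by (simp add: divide_right_mono flip: diff_divide_distrib)
      qed
    qed
  qed
qed

section \<open>Completeness of the velocity space\<close>

lemma L2_class_rep: "L2_class (rep_L2x u) = u" and square_integrable_rep: "square_integrable (rep_L2x u)"
  using Quotient_abs_rep[OF Quotient_L2x, of u] Quotient_rep_reflp[OF Quotient_L2x, of u]
  by (simp_all add: ae_equal_def)

lemma nn_integral_norm_sq:
  assumes "square_integrable f"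
  shows "(\<integral>\<^sup>+ x. ennreal ((norm (f x))\<^sup>2) \<partial>torus) = ennreal ((norm (L2_class f))\<^sup>2)"
  unfolding norm_L2_class[OF assms] using assms
  by (intro nn_integral_eq_integral) (auto simp: square_integrable_def)

lemma emeasure_torus_finite: "emeasure torus (space torus) < \<infinity>"
  unfolding torus_def by (simp add: space_restrict_space emeasure_restrict_space emeasure_lborel_cbox_eq)

text \<open>A substitute for the Cauchy-Schwarz inequality. With \<open>p = 2 ^ j\<close>,
  increments whose squares decay fast enough become summable themselves, at the price of the
  summable constant \<open>(1/2) ^ j\<close>.\<close>

lemma le_scaled_square:
  fixes a p :: real
  assumes "0 \<le> a" "0 < p"
  shows "a \<le> p * a\<^sup>2 + 1 / p"
proof -
  have "0 \<le> (p * a - 1)\<^sup>2 + p * a" using assms by simp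
  also have "\<dots> = p * (p * a\<^sup>2 + 1 / p - a)"
    using assms by (simp add: field_simps power2_eq_square)
  finally show ?thesis using assms by (simp add: zero_le_mult_iff)
qed

text \<open>The Riesz-Fischer argument: increments of representatives are absolutely summable almost
  everywhere, which gives a pointwise limit, and Fatou's lemma bounds its distance from each member
  of the sequence.\<close>

lemma fast_Cauchy_L2x_convergent:
  fixes X :: "nat \<Rightarrow> L2x"
  assumes fast: "\<And>i j. i \<ge> j \<Longrightarrow> norm (X i - X j) \<le> (1/2) ^ j"
  shows "convergent X"
proof -
  define f where "f j = rep_L2x (X j)" for j
  have f: "square_integrable (f j)" and X: "L2_class (f j) = X j" for j
    by (simp_all add: f_def L2_class_rep square_integrable_rep)
  have f_meas: "f j \<in> borel_measurable borel" for j using f by (simp add: square_integrable_def)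
  have f_meas_torus[measurable]: "f j \<in> borel_measurable torus" for j by (rule measurable_torus[OF f_meas])
  have diff: "(\<integral>\<^sup>+ x. ennreal ((norm (f i x - f j x))\<^sup>2) \<partial>torus) \<le> ennreal (((1/2) ^ j)\<^sup>2)" if "i \<ge> j" for i j
  proof -
    have "(\<integral>\<^sup>+ x. ennreal ((norm (f i x - f j x))\<^sup>2) \<partial>torus) = ennreal ((norm (X i - X j))\<^sup>2)"
      using nn_integral_norm_sq[OF square_integrable_diff[OF f f]] L2_class_diff[OF f f] by (simp add: X)
    also have "\<dots> \<le> ennreal (((1/2) ^ j)\<^sup>2)"
      using fast[OF that] by (intro ennreal_leI power_mono) auto
    finally show ?thesis .
  qed
  have "(\<integral>\<^sup>+ x. (\<Sum>j. ennreal (norm (f (Suc j) x - f j x))) \<partial>torus) = (\<Sum>j. \<integral>\<^sup>+ x. ennreal (norm (f (Suc j) x - f j x)) \<partial>torus)"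
    by (intro nn_integral_suminf) measurable
  also have "\<dots> \<le> (\<Sum>j. ennreal ((1/2) ^ j) * (1 + emeasure torus (space torus)))"
  proof (intro suminf_le)
    fix j
    have "norm (f (Suc j) x - f j x) \<le> 2 ^ j * (norm (f (Suc j) x - f j x))\<^sup>2 + (1/2) ^ j" for x
      using le_scaled_square[of "norm (f (Suc j) x - f j x)" "2 ^ j"] by (simp add: power_one_over)
    then have "(\<integral>\<^sup>+ x. ennreal (norm (f (Suc j) x - f j x)) \<partial>torus) \<le>
      (\<integral>\<^sup>+ x. ennreal (2 ^ j) * ennreal ((norm (f (Suc j) x - f j x))\<^sup>2) + ennreal ((1/2) ^ j) \<partial>torus)"
      by (intro nn_integral_mono) (simp add: ennreal_mult'[symmetric] ennreal_plus[symmetric] ennreal_leI del: ennreal_plus)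
    also have "\<dots> = ennreal (2 ^ j) * (\<integral>\<^sup>+ x. ennreal ((norm (f (Suc j) x - f j x))\<^sup>2) \<partial>torus) + ennreal ((1/2) ^ j) * emeasure torus (space torus)"
      by (subst nn_integral_add) (auto intro!: nn_integral_cmult)
    also have "\<dots> \<le> ennreal (2 ^ j) * ennreal (((1/2) ^ j)\<^sup>2) + ennreal ((1/2) ^ j) * emeasure torus (space torus)"
      using diff[of j "Suc j"] by (intro add_right_mono mult_left_mono) auto
    also have "ennreal (2 ^ j) * ennreal (((1/2) ^ j)\<^sup>2) = ennreal ((1/2) ^ j)"
      by (subst ennreal_mult'[symmetric]) (simp_all add: power2_eq_square power_one_over)
    finally show "(\<integral>\<^sup>+ x. ennreal (norm (f (Suc j) x - f j x)) \<partial>torus) \<le> ennreal ((1/2) ^ j) * (1 + emeasure torus (space torus))"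
      by (simp add: distrib_left)
  qed simp_all
  also have "\<dots> = ennreal 2 * (1 + emeasure torus (space torus))"
  proof -
    have "(\<Sum>j. ennreal ((1/2) ^ j)) = ennreal 2"
      using geometric_sums[of "1/2 :: real"] by (intro suminf_ennreal_eq) auto
    then show ?thesis by simp
  qed
  also have "\<dots> < \<infinity>" using emeasure_torus_finite by (simp add: ennreal_mult_less_top)
  finally have "AE x in torus. (\<Sum>j. ennreal (norm (f (Suc j) x - f j x))) \<noteq> \<infinity>"
    by (intro nn_integral_noteq_infinite) auto
  then have conv: "AE x in torus. convergent (\<lambda>j. f j x)"
  proof eventually_elim
    case (elim x)
    then have "summable (\<lambda>j. norm (f (Suc j) x - f j x))" by (intro summable_suminf_not_top) auto
    then have "summable (\<lambda>j. f (Suc j) x - f j x)" by (rule summable_norm_cancel)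
    then have "convergent (\<lambda>n. \<Sum>j<n. f (Suc j) x - f j x)" by (simp add: summable_iff_convergent)
    then have "convergent (\<lambda>n. f n x - f 0 x)" by (simp only: sum_lessThan_telescope[of "\<lambda>j. f j x"])
    then have "convergent (\<lambda>n. (f n x - f 0 x) + f 0 x)" by (intro convergent_add convergent_const)
    then show ?case by simp
  qed
  \<comment> \<open>The limit is taken at every point. Periodicity survives even where the sequence
    diverges, because the sequences at x and at its translate coincide.\<close>
  define g where "g x = lim (\<lambda>j. f j x)" for x
  have g_meas: "g \<in> borel_measurable borel"
    unfolding g_def by (rule borel_measurable_lim_metric) (rule f_meas)
  have g_per: "periodic g" using f by (simp add: periodic_def g_def square_integrable_def)
  have tail: "(\<integral>\<^sup>+ x. ennreal ((norm (g x - f j x))\<^sup>2) \<partial>torus) \<le> ennreal (((1/2) ^ j)\<^sup>2)" for j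
  proof -
    have "(\<integral>\<^sup>+ x. ennreal ((norm (g x - f j x))\<^sup>2) \<partial>torus) = (\<integral>\<^sup>+ x. liminf (\<lambda>i. ennreal ((norm (f i x - f j x))\<^sup>2)) \<partial>torus)"
    proof (rule nn_integral_cong_AE)
      show "AE x in torus. ennreal ((norm (g x - f j x))\<^sup>2) = liminf (\<lambda>i. ennreal ((norm (f i x - f j x))\<^sup>2))"
        using conv
      proof eventually_elim
        case (elim x)
        then have "(\<lambda>i. f i x) \<longlonglongrightarrow> g x" by (simp add: g_def convergent_LIMSEQ_iff)
        then have "(\<lambda>i. ennreal ((norm (f i x - f j x))\<^sup>2)) \<longlonglongrightarrow> ennreal ((norm (g x - f j x))\<^sup>2)"
          by (intro tendsto_ennrealI tendsto_intros)
        then show ?case by (intro lim_imp_Liminf[symmetric]) auto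
      qed
    qed
    also have "\<dots> \<le> liminf (\<lambda>i. \<integral>\<^sup>+ x. ennreal ((norm (f i x - f j x))\<^sup>2) \<partial>torus)"
      by (intro nn_integral_liminf) measurable
    also have "\<dots> \<le> liminf (\<lambda>i. ennreal (((1/2) ^ j)\<^sup>2))"
      by (intro Liminf_mono eventually_mono[OF eventually_ge_at_top[of j]] diff)
    also have "\<dots> = ennreal (((1/2) ^ j)\<^sup>2)" by (intro lim_imp_Liminf) auto
    finally show ?thesis .
  qed
  have gf: "square_integrable (\<lambda>x. g x - f j x)" for j
    unfolding square_integrable_def
  proof (intro conjI)
    show "(\<lambda>x. g x - f j x) \<in> borel_measurable borel" by (intro borel_measurable_diff g_meas f_meas)
    show "periodic (\<lambda>x. g x - f j x)" using g_per f[of j] by (simp add: periodic_def square_integrable_def)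
    have [measurable]: "g \<in> borel_measurable torus" by (rule measurable_torus[OF g_meas])
    have "(\<integral>\<^sup>+ x. ennreal (norm ((norm (g x - f j x))\<^sup>2)) \<partial>torus) < \<infinity>"
      using le_less_trans[OF tail[of j] ennreal_less_top] by simp
    then show "integrable torus (\<lambda>x. (norm (g x - f j x))\<^sup>2)"
      by (intro integrableI_bounded) measurable
  qed
  have g: "square_integrable g" using square_integrable_add[OF gf[of 0] f[of 0]] by simp
  have "norm (X j - L2_class g) \<le> (1/2) ^ j" for j
  proof -
    have "ennreal ((norm (L2_class g - X j))\<^sup>2) \<le> ennreal (((1/2) ^ j)\<^sup>2)"
      using tail[of j] unfolding nn_integral_norm_sq[OF gf] L2_class_diff[OF g f, symmetric] X .
    then have "(norm (L2_class g - X j))\<^sup>2 \<le> ((1/2) ^ j)\<^sup>2" by simp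
    then have "norm (L2_class g - X j) \<le> (1/2) ^ j" by (rule power2_le_imp_le) simp
    then show ?thesis by (simp add: norm_minus_commute)
  qed
  then have "(\<lambda>j. X j - L2_class g) \<longlonglongrightarrow> 0"
    by (intro Lim_null_comparison[of "\<lambda>j. X j - L2_class g" "\<lambda>j. (1/2) ^ j"] always_eventually LIMSEQ_power_zero) auto
  then show ?thesis unfolding convergent_def using LIM_zero_cancel by blast
qed

instance L2x :: complete_space
proof
  fix X :: "nat \<Rightarrow> L2x" assume X: "Cauchy X"
  have "\<exists>n0. \<forall>m\<ge>n0. \<forall>n\<ge>n0. norm (X m - X n) \<le> (1/2) ^ j" for j
    using X[unfolded Cauchy_def, rule_format, of "(1/2) ^ j"] by (auto simp: dist_norm intro: less_imp_le)
  then obtain n0 where n0: "\<And>j m n. m \<ge> n0 j \<Longrightarrow> n \<ge> n0 j \<Longrightarrow> norm (X m - X n) \<le> (1/2) ^ j"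
    by metis
  \<comment> \<open>Adding the partial sums of \<open>n0\<close> makes \<open>r\<close> strictly
    increasing and at least \<open>n0 j\<close> at once.\<close>
  define r where "r j = j + (\<Sum>i\<le>j. n0 i)" for j
  have r: "strict_mono r" by (auto simp: strict_mono_Suc_iff r_def)
  have r_ge: "n0 j \<le> r j" for j
    using member_le_sum[of j "{..j}" n0] by (simp add: r_def)
  have "norm ((X \<circ> r) i - (X \<circ> r) j) \<le> (1/2) ^ j" if "i \<ge> j" for i j
    using n0[of j "r i" "r j"] r_ge[of j] strict_mono_less_eq[OF r, of j i] that by simp
  then have "convergent (X \<circ> r)" by (rule fast_Cauchy_L2x_convergent)
  then obtain l where "(X \<circ> r) \<longlonglongrightarrow> l" by (auto simp: convergent_def)
  then have "X \<longlonglongrightarrow> l" by (rule Cauchy_converges_subseq[OF X r])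
  then show "convergent X" by (auto simp: convergent_def)
qed

section \<open>Strong limits of ensembles\<close>

instance L2x :: banach ..

text \<open>The Lipschitz constant is common to all n, so one nearby rational time approximates the
  whole sequence within e / 3.\<close>

lemma lipschitz_convergent_all_times:
  fixes f :: "nat \<Rightarrow> real \<Rightarrow> 'a::banach"
  assumes T: "T > 0" and conv: "\<And>r. of_rat r \<in> {0..T} \<Longrightarrow> convergent (\<lambda>n. f n (of_rat r))"
    and lip: "\<And>n s t. s \<in> {0..T} \<Longrightarrow> t \<in> {0..T} \<Longrightarrow> norm (f n t - f n s) \<le> L * \<bar>t - s\<bar>"
    and t: "t \<in> {0..T}"
  shows "convergent (\<lambda>n. f n t)"
proof (rule Cauchy_convergent, rule CauchyI)
  fix e :: real assume e: "e > 0"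
  define \<delta> where "\<delta> = e / (3 * (\<bar>L\<bar> + 1))"
  have \<delta>: "\<delta> > 0" using e by (simp add: \<delta>_def)
  have "max 0 (t - \<delta>) < min T (t + \<delta>)" using T t \<delta> by auto
  then obtain r where r: "max 0 (t - \<delta>) < of_rat r" "of_rat r < min T (t + \<delta>)" using of_rat_dense by blast
  then have rT: "of_rat r \<in> {0..T}" by auto
  have near: "norm (f n t - f n (of_rat r)) \<le> e / 3" for n
  proof -
    have "norm (f n t - f n (of_rat r)) \<le> L * \<bar>t - of_rat r\<bar>" by (rule lip[OF rT t])
    also have "\<dots> \<le> (\<bar>L\<bar> + 1) * \<delta>" using r by (intro mult_mono) (auto simp: abs_le_iff)
    also have "\<dots> = e / 3"
    proof -
      have "a * (e / (3 * a)) = e / 3" if "a > 0" for a :: real using that by simp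
      from this[of "\<bar>L\<bar> + 1"] show ?thesis unfolding \<delta>_def by simp
    qed
    finally show ?thesis .
  qed
  have "Cauchy (\<lambda>n. f n (of_rat r))" by (rule convergent_Cauchy[OF conv[OF rT]])
  from CauchyD[OF this, of "e / 3"] e obtain M where M: "\<And>m n. m \<ge> M \<Longrightarrow> n \<ge> M \<Longrightarrow> norm (f m (of_rat r) - f n (of_rat r)) < e / 3"
    by auto
  have "norm (f m t - f n t) < e" if "m \<ge> M" "n \<ge> M" for m n
  proof -
    have "f m t - f n t = (f m t - f m (of_rat r)) + (f m (of_rat r) - f n (of_rat r)) - (f n t - f n (of_rat r))" by simp
    also have "norm \<dots> \<le> norm (f m t - f m (of_rat r)) + norm (f m (of_rat r) - f n (of_rat r)) + norm (f n t - f n (of_rat r))"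
      by (intro order_trans[OF norm_triangle_ineq4] add_right_mono norm_triangle_ineq)
    also have "\<dots> < e" using near[of m] near[of n] M[OF that] by linarith
    finally show ?thesis .
  qed
  then show "\<exists>M. \<forall>m\<ge>M. \<forall>n\<ge>M. norm (f m t - f n t) < e" by blast
qed

lemma convergent_complex_vec:
  fixes f :: "nat \<Rightarrow> complex^2"
  assumes "\<And>j. convergent (\<lambda>n. Re (f n $ j))" "\<And>j. convergent (\<lambda>n. Im (f n $ j))"
  shows "convergent f"
proof -
  have "\<exists>l. (\<lambda>n. f n $ j) \<longlonglongrightarrow> l" for j
  proof -
    obtain a b where "(\<lambda>n. Re (f n $ j)) \<longlonglongrightarrow> a" "(\<lambda>n. Im (f n $ j)) \<longlonglongrightarrow> b"
      using assms[of j] by (auto simp: convergent_def)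
    then have "(\<lambda>n. f n $ j) \<longlonglongrightarrow> Complex a b" by (simp add: tendsto_complex_iff)
    then show ?thesis by blast
  qed
  then obtain l where "\<And>j. (\<lambda>n. f n $ j) \<longlonglongrightarrow> l j" by metis
  then have "f \<longlonglongrightarrow> (\<chi> j. l j)" by (intro vec_tendstoI) simp
  then show ?thesis by (auto simp: convergent_def)
qed

text \<open>The joint law is a coupling. Measurability of the pair refers to the Borel sets of the
  product space, which on a general metric space can be more than the product of the Borel
  \<sigma>-algebras.\<close>

lemma W1_le_coupling:
  fixes X Y :: "'w \<Rightarrow> 'a::metric_space"
  assumes \<Omega>: "prob_space \<Omega>" and XY: "(\<lambda>\<omega>. (X \<omega>, Y \<omega>)) \<in> \<Omega> \<rightarrow>\<^sub>M borel"
  shows "W1 (distr \<Omega> borel X) (distr \<Omega> borel Y) \<le> (\<integral>\<^sup>+ \<omega>. ennreal (dist (X \<omega>) (Y \<omega>)) \<partial>\<Omega>)"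
proof -
  let ?\<pi> = "distr \<Omega> borel (\<lambda>\<omega>. (X \<omega>, Y \<omega>))"
  have fst: "fst \<in> (borel :: ('a \<times> 'a) measure) \<rightarrow>\<^sub>M borel" and snd: "snd \<in> (borel :: ('a \<times> 'a) measure) \<rightarrow>\<^sub>M borel"
    by (intro borel_measurable_continuous_onI continuous_intros)+
  have "?\<pi> \<in> couplings (distr \<Omega> borel X) (distr \<Omega> borel Y)"
    unfolding couplings_def borel_probs_def using prob_space.prob_space_distr[OF \<Omega> XY]
    by (simp add: distr_distr[OF fst XY] distr_distr[OF snd XY] comp_def)
  then have "W1 (distr \<Omega> borel X) (distr \<Omega> borel Y) \<le> (\<integral>\<^sup>+ z. ennreal (dist (fst z) (snd z)) \<partial>?\<pi>)"
    unfolding W1_def by (rule INF_lower)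
  also have "\<dots> = (\<integral>\<^sup>+ \<omega>. ennreal (dist (X \<omega>) (Y \<omega>)) \<partial>\<Omega>)"
  proof (subst nn_integral_distr[OF XY])
    have "(\<lambda>z :: 'a \<times> 'a. dist (fst z) (snd z)) \<in> borel_measurable borel"
      by (intro borel_measurable_continuous_onI continuous_intros)
    then show "(\<lambda>z. ennreal (dist (fst z) (snd z))) \<in> borel_measurable (distr \<Omega> borel (\<lambda>\<omega>. (X \<omega>, Y \<omega>)))" by simp
  qed simp
  finally show ?thesis .
qed

text \<open>The resolutions \<open>N\<close> are an arbitrary sequence, so that the same results
  serve the full family and its subsequences. The assumptions are made for every index i and not
  only below \<open>K n\<close>.\<close>

locale trig_ensemble =
  fixes T E A q :: real and N K :: "nat \<Rightarrow> nat"
    and c :: "nat \<Rightarrow> nat \<Rightarrow> real \<Rightarrow> int^2 \<Rightarrow> complex^2" and L :: "int^2 \<Rightarrow> real"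
  assumes T: "T > 0" and E: "0 \<le> E" and K: "\<And>n. K n > 0" and q: "0 < q" "q < 1"
    and herm: "\<And>n i t. hermitian (c n i t)"
    and supp: "\<And>n i t k. k \<notin> modes (N n) \<Longrightarrow> c n i t k = 0"
    and energy: "\<And>n i t. t \<in> {0..T} \<Longrightarrow> (\<Sum>k\<in>modes (N n). (norm (c n i t k))\<^sup>2) \<le> E"
    and lip: "\<And>n i s t k. s \<in> {0..T} \<Longrightarrow> t \<in> {0..T} \<Longrightarrow> norm (c n i t k - c n i s k) \<le> L k * \<bar>t - s\<bar>"
    and tail: "\<And>n p t. t \<in> {0..T} \<Longrightarrow>
      (\<Sum>i<K n. \<Sum>k\<in>{k\<in>modes (N n). 2 ^ p < norm (wave k)}. (norm (c n i t k))\<^sup>2) / real (K n) \<le> A * q ^ p"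
begin

definition U :: "nat \<Rightarrow> nat \<Rightarrow> real \<Rightarrow> L2x" where
  "U n i t = L2_class (trig (modes (N n)) (c n i t))"

abbreviation B :: "real measure" where "B \<equiv> restrict_space lborel {0..T}"

lemma modes_mono: "m \<le> n \<Longrightarrow> modes m \<subseteq> modes n"
  by (auto simp: modes_def)

lemma U_eq: "N n \<le> p \<Longrightarrow> U n i t = L2_class (trig (modes p) (c n i t))"
  unfolding U_def using supp by (subst trig_mono_neutral[OF finite_modes modes_mono[of "N n" p]]) auto

lemma norm_U: "(norm (U n i t))\<^sup>2 = (2 * pi)\<^sup>2 * (\<Sum>k\<in>modes (N n). (norm (c n i t k))\<^sup>2)"
  unfolding U_def by (rule norm_L2_class_trig[OF symmetric_modes herm])

lemma norm_U_diff:
  "N n \<le> p \<Longrightarrow> N m \<le> p \<Longrightarrow> (norm (U n i t - U m j s))\<^sup>2 = (2 * pi)\<^sup>2 * (\<Sum>k\<in>modes p. (norm (c n i t k - c m j s k))\<^sup>2)"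
  unfolding U_eq[of n p] U_eq[of m p] L2_class_trig_diff
  by (rule norm_L2_class_trig[OF symmetric_modes hermitian_diff[OF herm herm]])

lemma norm_U_le: "t \<in> {0..T} \<Longrightarrow> norm (U n i t) \<le> 2 * pi * sqrt E"
proof -
  assume t: "t \<in> {0..T}"
  have "(norm (U n i t))\<^sup>2 \<le> (2 * pi)\<^sup>2 * E" unfolding norm_U by (intro mult_left_mono energy t) auto
  also have "\<dots> = (2 * pi * sqrt E)\<^sup>2" using E by (simp add: power_mult_distrib)
  finally show ?thesis by (rule power2_le_imp_le) (use E in auto)
qed

lemma norm_coeff_le: "t \<in> {0..T} \<Longrightarrow> norm (c n i t k) \<le> sqrt E"
proof (cases "k \<in> modes (N n)")
  case True
  assume t: "t \<in> {0..T}"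
  have "(norm (c n i t k))\<^sup>2 \<le> (\<Sum>k\<in>modes (N n). (norm (c n i t k))\<^sup>2)"
    using True finite_modes by (intro member_le_sum) auto
  then show ?thesis using energy[OF t, of n i] by (intro real_le_rsqrt) simp
qed (use supp E in auto)

lemma continuous_coeff: "continuous_on {0..T} (\<lambda>t. c n i t k)"
proof (rule continuous_onI)
  fix t e :: real assume t: "t \<in> {0..T}" and e: "e > 0"
  show "\<exists>d>0. \<forall>s\<in>{0..T}. dist s t < d \<longrightarrow> dist (c n i s k) (c n i t k) \<le> e"
  proof (intro exI[of _ "e / (\<bar>L k\<bar> + 1)"] conjI ballI impI)
    fix s assume s: "s \<in> {0..T}" "dist s t < e / (\<bar>L k\<bar> + 1)"
    have "norm (c n i s k - c n i t k) \<le> L k * \<bar>s - t\<bar>" by (rule lip[OF t s(1)])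
    also have "\<dots> \<le> (\<bar>L k\<bar> + 1) * (e / (\<bar>L k\<bar> + 1))" using s(2) e by (intro mult_mono) (auto simp: dist_real_def)
    also have "\<dots> = e" by simp
    finally show "dist (c n i s k) (c n i t k) \<le> e" by (simp add: dist_norm)
  qed (use e in simp)
qed

lemma continuous_U: "continuous_on {0..T} (U n i)"
  unfolding continuous_on_def
proof
  fix t assume t: "t \<in> {0..T}"
  have "((\<lambda>s. (2 * pi)\<^sup>2 * (\<Sum>k\<in>modes (N n). (norm (c n i s k - c n i t k))\<^sup>2)) \<longlongrightarrow>
    (2 * pi)\<^sup>2 * (\<Sum>k\<in>modes (N n). (norm (c n i t k - c n i t k))\<^sup>2)) (at t within {0..T})"
    by (intro tendsto_intros continuous_coeff[unfolded continuous_on_def, rule_format, OF t])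
  then have "((\<lambda>s. (norm (U n i s - U n i t))\<^sup>2) \<longlongrightarrow> 0) (at t within {0..T})"
    by (simp add: norm_U_diff[OF order_refl order_refl])
  then have "((\<lambda>s. sqrt ((norm (U n i s - U n i t))\<^sup>2)) \<longlongrightarrow> sqrt 0) (at t within {0..T})" by (intro tendsto_intros)
  then have "((\<lambda>s. U n i s - U n i t) \<longlongrightarrow> 0) (at t within {0..T})" by (simp add: tendsto_norm_zero_iff)
  then show "(U n i \<longlongrightarrow> U n i t) (at t within {0..T})" by (rule LIM_zero_cancel)
qed

lemma measurable_B: "continuous_on {0..T} f \<Longrightarrow> f \<in> B \<rightarrow>\<^sub>M borel" for f :: "real \<Rightarrow> 'z::topological_space"
proof -
  assume "continuous_on {0..T} f"
  then have "f \<in> restrict_space borel {0..T} \<rightarrow>\<^sub>M borel" by (rule borel_measurable_continuous_on_restrict)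
  moreover have "sets B = sets (restrict_space borel {0..T})" by (intro sets_restrict_space_cong) simp
  ultimately show ?thesis using measurable_cong_sets by blast
qed

text \<open>The data handed to the representation are countable: mode, component, real or imaginary
  part, rational time. The exceptional null set is therefore chosen before the time, and the
  Lipschitz bound extends convergence to all times off that set.\<close>

lemma convergent_random_subsequence:
  obtains s :: "nat \<Rightarrow> nat" and \<Omega> :: "real measure" and I :: "nat \<Rightarrow> real \<Rightarrow> nat"
  where "strict_mono s" "prob_space \<Omega>" "\<And>n. I n \<in> \<Omega> \<rightarrow>\<^sub>M count_space UNIV" "\<And>n \<omega>. I n \<omega> < K (s n)"
    "\<And>n. distr \<Omega> (count_space UNIV) (I n) = distr (uniform_count_measure {..<K (s n)}) (count_space UNIV) (\<lambda>i. i)"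
    "AE \<omega> in \<Omega>. \<forall>t\<in>{0..T}. \<forall>k. convergent (\<lambda>n. c (s n) (I n \<omega>) t k)"
proof -
  define x :: "nat \<Rightarrow> nat \<Rightarrow> (int^2) \<times> bool \<times> bool \<times> rat \<Rightarrow> real" where
    "x n i = (\<lambda>(k, a, b, r). if of_rat r \<in> {0..T}
      then let w = c n i (of_rat r) k $ (if a then 1 else 2) in if b then Re w else Im w else 0)" for n i
  have x_le: "\<bar>x n i j\<bar> \<le> sqrt E" for n i j
  proof -
    obtain k a b r where j: "j = (k, a, b, r)" by (cases j) auto
    have "\<bar>Re (c n i t k $ l)\<bar> \<le> sqrt E" "\<bar>Im (c n i t k $ l)\<bar> \<le> sqrt E" if "t \<in> {0..T}" for t l
      using norm_coeff_le[OF that, of n i k] Finite_Cartesian_Product.norm_nth_le[of "c n i t k" l]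
        abs_Re_le_cmod[of "c n i t k $ l"] abs_Im_le_cmod[of "c n i t k $ l"] by linarith+
    then show ?thesis using E by (simp add: x_def j Let_def)
  qed
  \<comment> \<open>An affine rescaling into [0, 1). The added 1 keeps the upper bound strict and
    the denominator positive when E = 0.\<close>
  define z where "z n i j = (x n i (from_nat j) / (sqrt E + 1) + 1) / 2" for n i j
  have z: "0 \<le> z n i j" "z n i j < 1" for n i j
    using x_le[of n i "from_nat j"] E by (auto simp: z_def abs_le_iff field_simps add_nonneg_pos)
  obtain s and \<Omega> :: "real measure" and I where s: "strict_mono s" "prob_space \<Omega>" "\<And>n. I n \<in> \<Omega> \<rightarrow>\<^sub>M count_space UNIV" "\<And>n \<omega>. I n \<omega> < K (s n)"
    "\<And>n. distr \<Omega> (count_space UNIV) (I n) = distr (uniform_count_measure {..<K (s n)}) (count_space UNIV) (\<lambda>i. i)"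
    and conv: "AE \<omega> in \<Omega>. \<forall>j. convergent (\<lambda>n. z (s n) (I n \<omega>) j)"
    by (rule random_index_subsequence[of K z, OF K z]) blast
  have "AE \<omega> in \<Omega>. \<forall>t\<in>{0..T}. \<forall>k. convergent (\<lambda>n. c (s n) (I n \<omega>) t k)"
    using conv
  proof eventually_elim
    case (elim \<omega>)
    have x: "convergent (\<lambda>n. x (s n) (I n \<omega>) j)" for j
    proof -
      have "convergent (\<lambda>n. (2 * z (s n) (I n \<omega>) (to_nat j) - 1) * (sqrt E + 1))"
        using elim by (intro convergent_mult convergent_diff convergent_const) auto
      moreover have "(2 * z n i (to_nat j) - 1) * (sqrt E + 1) = x n i j" for n i
      proof -
        have "sqrt E + 1 \<noteq> 0" using real_sqrt_ge_zero[OF E] by linarith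
        then show ?thesis by (simp add: z_def field_simps)
      qed
      ultimately show ?thesis by simp
    qed
    show ?case
    proof (intro ballI allI)
      fix t k assume t: "t \<in> {0..T}"
      show "convergent (\<lambda>n. c (s n) (I n \<omega>) t k)"
      proof (rule lipschitz_convergent_all_times[OF T _ lip t])
        fix r assume r: "of_rat r \<in> {0..T}"
        show "convergent (\<lambda>n. c (s n) (I n \<omega>) (of_rat r) k)"
        proof (rule convergent_complex_vec)
          fix j :: 2
          have "j = (if j = 1 then 1 else 2)" using exhaust_2[of j] by auto
          then show "convergent (\<lambda>n. Re (c (s n) (I n \<omega>) (of_rat r) k $ j))" "convergent (\<lambda>n. Im (c (s n) (I n \<omega>) (of_rat r) k $ j))"
            using x[of "(k, j = 1, True, r)"] x[of "(k, j = 1, False, r)"] r by (auto simp: x_def Let_def split: if_splits)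
        qed
      qed
    qed
  qed
  then show ?thesis using that s by blast
qed

lemma integral_random_index:
  fixes f :: "nat \<Rightarrow> real"
  assumes "I \<in> \<Omega> \<rightarrow>\<^sub>M count_space UNIV"
    and "distr \<Omega> (count_space UNIV) I = distr (uniform_count_measure {..<k}) (count_space UNIV) (\<lambda>i. i)"
  shows "(LINT \<omega>|\<Omega>. f (I \<omega>)) = (\<Sum>i<k. f i) / real k"
proof -
  have "(LINT \<omega>|\<Omega>. f (I \<omega>)) = integral\<^sup>L (distr \<Omega> (count_space UNIV) I) f"
    by (rule integral_distr[symmetric]) (use assms(1) in auto)
  also have "\<dots> = integral\<^sup>L (uniform_count_measure {..<k}) f"
    unfolding assms(2) by (subst integral_distr) (auto simp: uniform_count_measure_def)
  also have "\<dots> = (\<Sum>i<k. f i) / real k" by (simp add: integral_uniform_count_measure)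
  finally show ?thesis .
qed

lemma distr_random_index:
  fixes v :: "nat \<Rightarrow> 'z::topological_space"
  assumes "I \<in> \<Omega> \<rightarrow>\<^sub>M count_space UNIV"
    and "distr \<Omega> (count_space UNIV) I = distr (uniform_count_measure {..<k}) (count_space UNIV) (\<lambda>i. i)"
  shows "distr \<Omega> borel (\<lambda>\<omega>. v (I \<omega>)) = empirical_measure k v"
proof -
  have "distr \<Omega> borel (\<lambda>\<omega>. v (I \<omega>)) = distr (distr \<Omega> (count_space UNIV) I) borel v"
    by (subst distr_distr[OF _ assms(1)]) (auto simp: comp_def)
  also have "\<dots> = empirical_measure k v"
    unfolding assms(2) empirical_measure_def
    by (subst distr_distr) (auto simp: comp_def uniform_count_measure_def)
  finally show ?thesis .
qed

end


text \<open>The index \<open>I n\<close> is independent of time: it selects a whole path, so the law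
  of the selected field is the empirical measure at each t.\<close>

locale random_trig_ensemble = trig_ensemble +
  fixes \<Omega> :: "real measure" and I :: "nat \<Rightarrow> real \<Rightarrow> nat"
  assumes \<Omega>: "prob_space \<Omega>"
    and I_meas: "\<And>n. I n \<in> \<Omega> \<rightarrow>\<^sub>M count_space UNIV"
    and I_law: "\<And>n. distr \<Omega> (count_space UNIV) (I n) = distr (uniform_count_measure {..<K n}) (count_space UNIV) (\<lambda>i. i)"
    and conv: "AE \<omega> in \<Omega>. \<forall>t\<in>{0..T}. \<forall>k. convergent (\<lambda>n. c n (I n \<omega>) t k)"
begin

sublocale prob_space \<Omega> by (rule \<Omega>)

sublocale B: finite_measure B
  using T by (intro finite_measureI) (simp add: emeasure_restrict_space space_restrict_space)

sublocale pair_sigma_finite B \<Omega> ..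

abbreviation \<Lambda> :: "(real \<times> real) measure" where "\<Lambda> \<equiv> B \<Otimes>\<^sub>M \<Omega>"

lemma space_B: "space B = {0..T}" by (simp add: space_restrict_space)

lemma \<Omega>_sigma: "sigma_finite_measure \<Omega>"
  by (rule prob_space_imp_sigma_finite[OF \<Omega>])

lemma finite_\<Lambda>: "emeasure \<Lambda> (space \<Lambda>) < \<infinity>"
proof -
  have "emeasure \<Lambda> (space \<Lambda>) = emeasure B (space B) * emeasure \<Omega> (space \<Omega>)"
    unfolding space_pair_measure
    by (rule sigma_finite_measure.emeasure_pair_measure_Times[OF \<Omega>_sigma sets.top sets.top])
  also have "\<dots> < \<infinity>" using B.emeasure_finite[of "{0..T}"] by (simp add: emeasure_space_1 less_top[symmetric] space_B)
  finally show ?thesis .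
qed

lemma AE_\<Lambda>_snd:
  assumes "AE \<omega> in \<Omega>. P \<omega>"
  shows "AE x in \<Lambda>. P (snd x)"
proof -
  obtain N where N: "N \<in> null_sets \<Omega>" "{\<omega>\<in>space \<Omega>. \<not> P \<omega>} \<subseteq> N" using assms by (auto elim: AE_E simp: null_sets_def)
  have "AE x in \<Lambda>. snd x \<notin> N"
  proof (rule AE_I')
    show "space B \<times> N \<in> null_sets \<Lambda>"
    proof (rule null_setsI)
      have "emeasure \<Lambda> (space B \<times> N) = emeasure B (space B) * emeasure \<Omega> N"
        using N(1) by (intro sigma_finite_measure.emeasure_pair_measure_Times[OF \<Omega>_sigma sets.top]) (simp only: null_setsD2)
      then show "emeasure \<Lambda> (space B \<times> N) = 0" using N(1) by auto
      show "space B \<times> N \<in> sets \<Lambda>" using N(1) by (intro pair_measureI sets.top) (simp only: null_setsD2)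
    qed
    show "{x \<in> space \<Lambda>. \<not> snd x \<notin> N} \<subseteq> space B \<times> N" by (auto simp: space_pair_measure)
  qed
  then show ?thesis
  proof (rule AE_mp, intro AE_I2 impI)
    fix x assume "x \<in> space \<Lambda>" "snd x \<notin> N"
    then show "P (snd x)" using N(2) by (auto simp: space_pair_measure)
  qed
qed

text \<open>The index takes countably many values, so measurability is checked with the index
  fixed.\<close>

lemma measurable_index:
  assumes "\<And>i. f i \<in> \<Lambda> \<rightarrow>\<^sub>M M"
  shows "(\<lambda>x. f (I n (snd x)) x) \<in> \<Lambda> \<rightarrow>\<^sub>M M"
  by (rule measurable_compose_countable[OF assms measurable_compose[OF measurable_snd I_meas]])

definition V :: "nat \<Rightarrow> real \<times> real \<Rightarrow> L2x" where
  "V n x = U n (I n (snd x)) (fst x)"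

definition y :: "nat \<Rightarrow> real \<times> real \<Rightarrow> int^2 \<Rightarrow> complex^2" where
  "y n x k = c n (I n (snd x)) (fst x) k"

lemma V_meas: "V n \<in> \<Lambda> \<rightarrow>\<^sub>M borel"
  unfolding V_def[abs_def]
  by (rule measurable_index[of "\<lambda>i x. U n i (fst x)"]) (intro measurable_compose[OF measurable_fst measurable_B] continuous_U)

lemma y_meas: "(\<lambda>x. y n x k) \<in> \<Lambda> \<rightarrow>\<^sub>M borel"
  unfolding y_def
  by (rule measurable_index[of "\<lambda>i x. c n i (fst x) k"]) (intro measurable_compose[OF measurable_fst measurable_B] continuous_coeff)

text \<open>On a space without a known countable base, measurability of both terms does not make
  their difference measurable. Fixing the two indices one after the other leaves a continuous
  function of time.\<close>

lemma V_diff_meas: "(\<lambda>x. norm (V n x - V m x)) \<in> \<Lambda> \<rightarrow>\<^sub>M borel"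
  unfolding V_def
proof (rule measurable_index[of "\<lambda>i x. norm (U n i (fst x) - U m (I m (snd x)) (fst x))"])
  fix i
  show "(\<lambda>x. norm (U n i (fst x) - U m (I m (snd x)) (fst x))) \<in> \<Lambda> \<rightarrow>\<^sub>M borel"
    by (rule measurable_index[of "\<lambda>j x. norm (U n i (fst x) - U m j (fst x))"])
      (intro measurable_compose[OF measurable_fst measurable_B] continuous_intros continuous_U)
qed

definition y_lim :: "real \<times> real \<Rightarrow> int^2 \<Rightarrow> complex^2" where
  "y_lim x k = lim (\<lambda>n. y n x k)"

lemma y_lim_meas: "(\<lambda>x. y_lim x k) \<in> \<Lambda> \<rightarrow>\<^sub>M borel"
  unfolding y_lim_def by (intro borel_measurable_lim_metric y_meas)

lemma y_tendsto: "AE x in \<Lambda>. \<forall>k. (\<lambda>n. y n x k) \<longlonglongrightarrow> y_lim x k"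
  using AE_\<Lambda>_snd[OF conv] AE_space
proof eventually_elim
  case (elim x)
  then have "fst x \<in> {0..T}" by (auto simp: space_pair_measure space_B)
  with elim show ?case by (auto simp: y_lim_def y_def convergent_LIMSEQ_iff)
qed

lemma low_modes_tendsto:
  assumes "finite H"
  shows "(\<lambda>n. \<integral>\<^sup>+ x. ennreal (\<Sum>k\<in>H. (norm (y n x k - y_lim x k))\<^sup>2) \<partial>\<Lambda>) \<longlonglongrightarrow> 0"
proof -
  have "(\<lambda>n. \<integral>\<^sup>+ x. ennreal (\<Sum>k\<in>H. (norm (y n x k - y_lim x k))\<^sup>2) \<partial>\<Lambda>) \<longlonglongrightarrow> (\<integral>\<^sup>+ x. 0 \<partial>\<Lambda>)"
  proof (rule nn_integral_dominated_convergence)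
    let ?w = "ennreal (\<Sum>k\<in>H. (2 * sqrt E)\<^sup>2)"
    show "(\<integral>\<^sup>+ x. ?w \<partial>\<Lambda>) < \<infinity>" using finite_\<Lambda> by (simp add: ennreal_mult_less_top)
    show "(\<lambda>x. ennreal (\<Sum>k\<in>H. (norm (y n x k - y_lim x k))\<^sup>2)) \<in> borel_measurable \<Lambda>" for n
      using y_meas[measurable] y_lim_meas[measurable] by measurable
    show "AE x in \<Lambda>. ennreal (\<Sum>k\<in>H. (norm (y n x k - y_lim x k))\<^sup>2) \<le> ?w" for n
      using y_tendsto AE_space
    proof eventually_elim
      case (elim x)
      then have t: "fst x \<in> {0..T}" by (auto simp: space_pair_measure space_B)
      have y: "norm (y n x k) \<le> sqrt E" for n k unfolding y_def by (rule norm_coeff_le[OF t])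
      moreover have "norm (y_lim x k) \<le> sqrt E" for k
        using elim(1) y by (intro Lim_norm_ubound[of sequentially "\<lambda>n. y n x k"]) auto
      ultimately have "norm (y n x k - y_lim x k) \<le> 2 * sqrt E" for k
        using norm_triangle_ineq4[of "y n x k" "y_lim x k"] by (smt (verit))
      then show ?case by (intro ennreal_leI sum_mono power_mono) auto
    qed
    show "AE x in \<Lambda>. (\<lambda>n. ennreal (\<Sum>k\<in>H. (norm (y n x k - y_lim x k))\<^sup>2)) \<longlonglongrightarrow> 0"
      using y_tendsto
    proof eventually_elim
      case (elim x)
      have "(\<lambda>n. ennreal (\<Sum>k\<in>H. (norm (y n x k - y_lim x k))\<^sup>2)) \<longlonglongrightarrow> ennreal (\<Sum>k\<in>H. (norm (y_lim x k - y_lim x k))\<^sup>2)"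
        using elim by (intro tendsto_ennrealI tendsto_intros) auto
      then show ?case by simp
    qed
  qed simp_all
  then show ?thesis by simp
qed

text \<open>At fixed t the expectation over the random index is the sample mean, so
  \<open>tail\<close> applies; the time integral contributes the factor T.\<close>

lemma high_modes_le:
  "(\<integral>\<^sup>+ x. ennreal (\<Sum>k\<in>{k\<in>modes (N n). 2 ^ p < norm (wave k)}. (norm (y n x k))\<^sup>2) \<partial>\<Lambda>) \<le> ennreal (T * (A * q ^ p))"
proof -
  let ?H = "{k\<in>modes (N n). 2 ^ p < norm (wave k)}"
  have "(\<integral>\<^sup>+ x. ennreal (\<Sum>k\<in>?H. (norm (y n x k))\<^sup>2) \<partial>\<Lambda>) =
    (\<integral>\<^sup>+ t. (\<integral>\<^sup>+ \<omega>. ennreal (\<Sum>k\<in>?H. (norm (y n (t, \<omega>) k))\<^sup>2) \<partial>\<Omega>) \<partial>B)"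
    using y_meas[measurable] by (intro sigma_finite_measure.nn_integral_fst[OF \<Omega>_sigma, symmetric]) measurable
  also have "\<dots> \<le> (\<integral>\<^sup>+ t. ennreal (A * q ^ p) \<partial>B)"
  proof (intro nn_integral_mono)
    fix t assume "t \<in> space B"
    then have t: "t \<in> {0..T}" by (simp add: space_B)
    let ?f = "\<lambda>i. \<Sum>k\<in>?H. (norm (c n i t k))\<^sup>2"
    have "(\<integral>\<^sup>+ \<omega>. ennreal (?f (I n \<omega>)) \<partial>\<Omega>) = ennreal (LINT \<omega>|\<Omega>. ?f (I n \<omega>))"
    proof (rule nn_integral_eq_integral)
      have "?f i \<le> E" for i
        using energy[OF t, of n i] sum_mono2[OF finite_modes, of ?H "N n" "\<lambda>k. (norm (c n i t k))\<^sup>2"] by fastforce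
      then show "integrable \<Omega> (\<lambda>\<omega>. ?f (I n \<omega>))"
        by (intro integrable_const_bound[of _ E] AE_I2 measurable_compose[OF I_meas]) (auto simp: sum_nonneg)
    qed (auto simp: sum_nonneg)
    also have "\<dots> = ennreal ((\<Sum>i<K n. ?f i) / real (K n))" by (simp only: integral_random_index[OF I_meas I_law, where f = ?f])
    also have "\<dots> \<le> ennreal (A * q ^ p)" by (intro ennreal_leI tail[OF t])
    finally show "(\<integral>\<^sup>+ \<omega>. ennreal (\<Sum>k\<in>?H. (norm (y n (t, \<omega>) k))\<^sup>2) \<partial>\<Omega>) \<le> ennreal (A * q ^ p)" by (simp add: y_def)
  qed
  also have "\<dots> = ennreal (T * (A * q ^ p))"
    using T by (simp add: space_B emeasure_restrict_space ennreal_mult'[symmetric] mult.commute)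
  finally show ?thesis .
qed

text \<open>Fields are compared with each other and not with a limit, because the coefficient limits
  \<open>y_lim\<close> are not yet known to belong to an element of \<open>L2x\<close>. Low modes
  pass through \<open>y_lim\<close>; high modes are bounded separately for n and m.\<close>

lemma V_diff_le:
  fixes p :: nat
  assumes x: "fst x \<in> {0..T}"
  defines "g \<equiv> \<lambda>n. (2 * pi)\<^sup>2 * (2 * (\<Sum>k\<in>modes (2 ^ p). (norm (y n x k - y_lim x k))\<^sup>2) +
    2 * (\<Sum>k\<in>{k\<in>modes (N n). 2 ^ p < norm (wave k)}. (norm (y n x k))\<^sup>2))"
  shows "(norm (V n x - V m x))\<^sup>2 \<le> g n + g m"
proof -
  define M where "M = max (2 ^ p) (max (N n) (N m))"
  let ?H = "modes (2 ^ p)"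
  have "norm (a - b) ^ 2 \<le> 2 * norm a ^ 2 + 2 * norm b ^ 2" for a b :: "complex^2"
  proof -
    have "(norm (a - b))\<^sup>2 \<le> (norm a + norm b)\<^sup>2" by (intro power_mono norm_triangle_ineq4) auto
    also have "\<dots> \<le> 2 * (norm a)\<^sup>2 + 2 * (norm b)\<^sup>2"
      using sum_squares_bound[of "norm a" "norm b"] by (simp add: power2_sum)
    finally show ?thesis .
  qed
  note sq = this
  \<comment> \<open>Outside the square \<open>modes (2 ^ p)\<close> some component exceeds
    \<open>2 ^ p\<close>, hence so does the Euclidean norm. This matches the square truncation with
    the Euclidean tail.\<close>
  have high: "2 ^ p < norm (wave k)" if k: "k \<notin> ?H" for k
  proof -
    obtain i where "int (2 ^ p) < \<bar>k $ i\<bar>" using k by (auto simp: modes_iff not_le)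
    then have "real_of_int (int (2 ^ p)) < real_of_int \<bar>k $ i\<bar>" by (simp only: of_int_less_iff)
    then have "2 ^ p < \<bar>wave k $ i\<bar>" by (simp add: wave_def)
    also have "\<dots> \<le> norm (wave k)" by (rule component_le_norm_cart)
    finally show ?thesis .
  qed
  have tail: "(\<Sum>k\<in>modes M - ?H. (norm (y n x k))\<^sup>2) \<le> (\<Sum>k\<in>{k\<in>modes (N n). 2 ^ p < norm (wave k)}. (norm (y n x k))\<^sup>2)" for n
  proof -
    have "(\<Sum>k\<in>modes M - ?H. (norm (y n x k))\<^sup>2) = (\<Sum>k\<in>(modes M - ?H) \<inter> modes (N n). (norm (y n x k))\<^sup>2)"
    proof (intro sum.mono_neutral_right ballI)
      fix k assume "k \<in> modes M - ?H - (modes M - ?H) \<inter> modes (N n)"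
      then have "k \<notin> modes (N n)" by blast
      then show "(norm (y n x k))\<^sup>2 = 0" using supp[of k n] by (simp add: y_def)
    qed (use finite_modes in auto)
    also have "\<dots> \<le> (\<Sum>k\<in>{k\<in>modes (N n). 2 ^ p < norm (wave k)}. (norm (y n x k))\<^sup>2)"
      using finite_modes high by (intro sum_mono2) auto
    finally show ?thesis .
  qed
  have "(norm (V n x - V m x))\<^sup>2 = (2 * pi)\<^sup>2 * (\<Sum>k\<in>modes M. (norm (y n x k - y m x k))\<^sup>2)"
    unfolding V_def y_def by (rule norm_U_diff) (auto simp: M_def)
  moreover have "(\<Sum>k\<in>modes M. (norm (y n x k - y m x k))\<^sup>2) \<le>
    2 * (\<Sum>k\<in>?H. (norm (y n x k - y_lim x k))\<^sup>2) + 2 * (\<Sum>k\<in>?H. (norm (y m x k - y_lim x k))\<^sup>2) +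
    (2 * (\<Sum>k\<in>{k\<in>modes (N n). 2 ^ p < norm (wave k)}. (norm (y n x k))\<^sup>2) +
    2 * (\<Sum>k\<in>{k\<in>modes (N m). 2 ^ p < norm (wave k)}. (norm (y m x k))\<^sup>2))"
    unfolding sum.subset_diff[OF modes_mono finite_modes, of "2 ^ p" M, OF max.cobounded1[of "2 ^ p" "max (N n) (N m)", folded M_def]]
      add.commute[of "sum _ (modes M - ?H)"]
  proof (rule add_mono)
    show "(\<Sum>k\<in>?H. (norm (y n x k - y m x k))\<^sup>2) \<le> 2 * (\<Sum>k\<in>?H. (norm (y n x k - y_lim x k))\<^sup>2) + 2 * (\<Sum>k\<in>?H. (norm (y m x k - y_lim x k))\<^sup>2)"
      unfolding sum_distrib_left sum.distrib[symmetric]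
    proof (rule sum_mono)
      fix k
      show "(norm (y n x k - y m x k))\<^sup>2 \<le> 2 * (norm (y n x k - y_lim x k))\<^sup>2 + 2 * (norm (y m x k - y_lim x k))\<^sup>2"
        using sq[of "y n x k - y_lim x k" "y m x k - y_lim x k"] by simp
    qed
    have "(\<Sum>k\<in>modes M - ?H. (norm (y n x k - y m x k))\<^sup>2) \<le> 2 * (\<Sum>k\<in>modes M - ?H. (norm (y n x k))\<^sup>2) + 2 * (\<Sum>k\<in>modes M - ?H. (norm (y m x k))\<^sup>2)"
      unfolding sum_distrib_left sum.distrib[symmetric] by (rule sum_mono) (rule sq)
    then show "(\<Sum>k\<in>modes M - ?H. (norm (y n x k - y m x k))\<^sup>2) \<le>
      2 * (\<Sum>k\<in>{k\<in>modes (N n). 2 ^ p < norm (wave k)}. (norm (y n x k))\<^sup>2) + 2 * (\<Sum>k\<in>{k\<in>modes (N m). 2 ^ p < norm (wave k)}. (norm (y m x k))\<^sup>2)"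
      using tail[of n] tail[of m] by linarith
  qed
  ultimately have "(norm (V n x - V m x))\<^sup>2 \<le> (2 * pi)\<^sup>2 *
    (2 * (\<Sum>k\<in>?H. (norm (y n x k - y_lim x k))\<^sup>2) + 2 * (\<Sum>k\<in>?H. (norm (y m x k - y_lim x k))\<^sup>2) +
    (2 * (\<Sum>k\<in>{k\<in>modes (N n). 2 ^ p < norm (wave k)}. (norm (y n x k))\<^sup>2) +
    2 * (\<Sum>k\<in>{k\<in>modes (N m). 2 ^ p < norm (wave k)}. (norm (y m x k))\<^sup>2)))"
    by (simp only: mult_left_mono zero_le_power2)
  then show ?thesis by (simp add: g_def distrib_left)
qed

end

section \<open>From the Cauchy property to the limit measures\<close>

context random_trig_ensemble
begin

lemma V_Cauchy:
  assumes e: "0 < e"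
  obtains n0 where "\<And>n m. n \<ge> n0 \<Longrightarrow> m \<ge> n0 \<Longrightarrow>
    (\<integral>\<^sup>+ x. ennreal ((norm (V n x - V m x))\<^sup>2) \<partial>\<Lambda>) \<le> ennreal e"
proof -
  note [measurable] = y_meas y_lim_meas
  define \<gamma> where "\<gamma> = 2 * (2 * pi)\<^sup>2"
  have \<gamma>: "\<gamma> > 0" by (simp add: \<gamma>_def)
  \<comment> \<open>Low and high modes of n and of m give four terms, each at most
    \<open>\<gamma> * \<delta> = e / 4\<close>.\<close>
  define \<delta> where "\<delta> = e / (4 * \<gamma>)"
  have \<delta>: "\<delta> > 0" using e \<gamma> by (simp add: \<delta>_def)
  \<comment> \<open>First p is fixed to make the high modes small for every n at once; the finite
    set \<open>modes (2 ^ p)\<close> then determines \<open>n0\<close>.\<close>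
  have "(\<lambda>p. T * (A * q ^ p)) \<longlonglongrightarrow> T * (A * 0)"
    using q by (intro tendsto_intros LIMSEQ_power_zero) auto
  then have "\<forall>\<^sub>F p in sequentially. T * (A * q ^ p) < \<delta>" using \<delta> by (auto dest: order_tendstoD)
  then obtain p where p: "T * (A * q ^ p) < \<delta>" by (auto simp: eventually_sequentially)
  let ?low = "\<lambda>n x. \<Sum>k\<in>modes (2 ^ p). (norm (y n x k - y_lim x k))\<^sup>2"
  let ?high = "\<lambda>n x. \<Sum>k\<in>{k\<in>modes (N n). 2 ^ p < norm (wave k)}. (norm (y n x k))\<^sup>2"
  have "\<forall>\<^sub>F n in sequentially. (\<integral>\<^sup>+ x. ennreal (?low n x) \<partial>\<Lambda>) < ennreal \<delta>"
    using low_modes_tendsto[OF finite_modes, of "2 ^ p"] \<delta> by (intro order_tendstoD) auto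
  then obtain n0 where n0: "\<And>n. n \<ge> n0 \<Longrightarrow> (\<integral>\<^sup>+ x. ennreal (?low n x) \<partial>\<Lambda>) < ennreal \<delta>"
    by (auto simp: eventually_sequentially)
  define G where "G n x = ennreal \<gamma> * ennreal (?low n x) + ennreal \<gamma> * ennreal (?high n x)" for n x
  have G_meas[measurable]: "G n \<in> borel_measurable \<Lambda>" for n unfolding G_def by measurable
  have G_int: "(\<integral>\<^sup>+ x. G n x \<partial>\<Lambda>) \<le> ennreal (e / 2)" if "n \<ge> n0" for n
  proof -
    have "(\<integral>\<^sup>+ x. G n x \<partial>\<Lambda>) = ennreal \<gamma> * (\<integral>\<^sup>+ x. ennreal (?low n x) \<partial>\<Lambda>) + ennreal \<gamma> * (\<integral>\<^sup>+ x. ennreal (?high n x) \<partial>\<Lambda>)"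
    proof -
      have "(\<integral>\<^sup>+ x. ennreal \<gamma> * ennreal (?low n x) \<partial>\<Lambda>) = ennreal \<gamma> * (\<integral>\<^sup>+ x. ennreal (?low n x) \<partial>\<Lambda>)"
        by (rule nn_integral_cmult) measurable
      moreover have "(\<integral>\<^sup>+ x. ennreal \<gamma> * ennreal (?high n x) \<partial>\<Lambda>) = ennreal \<gamma> * (\<integral>\<^sup>+ x. ennreal (?high n x) \<partial>\<Lambda>)"
        by (rule nn_integral_cmult) measurable
      moreover have "(\<integral>\<^sup>+ x. G n x \<partial>\<Lambda>) = (\<integral>\<^sup>+ x. ennreal \<gamma> * ennreal (?low n x) \<partial>\<Lambda>) + (\<integral>\<^sup>+ x. ennreal \<gamma> * ennreal (?high n x) \<partial>\<Lambda>)"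
        unfolding G_def by (rule nn_integral_add) measurable
      ultimately show ?thesis by (simp only:)
    qed
    also have "\<dots> \<le> ennreal \<gamma> * ennreal \<delta> + ennreal \<gamma> * ennreal \<delta>"
      using n0[OF that] order_trans[OF high_modes_le[of n p] ennreal_leI[OF less_imp_le[OF p]]]
      by (intro add_mono mult_left_mono) auto
    also have "\<dots> = ennreal (e / 2)"
    proof -
      have "\<gamma> * \<delta> = e / 4" using \<gamma> by (simp add: \<delta>_def)
      then have "ennreal \<gamma> * ennreal \<delta> = ennreal (e / 4)" using \<gamma> by (simp only: ennreal_mult'[symmetric] less_imp_le)
      then show ?thesis using e by (simp add: ennreal_plus[symmetric] del: ennreal_plus)
    qed
    finally show ?thesis .
  qed
  have "(\<integral>\<^sup>+ x. ennreal ((norm (V n x - V m x))\<^sup>2) \<partial>\<Lambda>) \<le> ennreal e" if "n \<ge> n0" "m \<ge> n0" for n m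
  proof -
    have "(\<integral>\<^sup>+ x. ennreal ((norm (V n x - V m x))\<^sup>2) \<partial>\<Lambda>) \<le> (\<integral>\<^sup>+ x. G n x + G m x \<partial>\<Lambda>)"
    proof (rule nn_integral_mono)
      fix x assume "x \<in> space \<Lambda>"
      then have x: "fst x \<in> {0..T}" by (auto simp: space_pair_measure space_B)
      have nn: "0 \<le> ?low n x" "0 \<le> ?high n x" for n by (intro sum_nonneg; simp)+
      have G: "G n x = ennreal ((2 * pi)\<^sup>2 * (2 * ?low n x + 2 * ?high n x))" for n
      proof -
        have "G n x = ennreal (\<gamma> * ?low n x + \<gamma> * ?high n x)"
          unfolding G_def using nn[of n] \<gamma> by (simp only: ennreal_plus mult_nonneg_nonneg less_imp_le ennreal_mult)
        also have "\<gamma> * ?low n x + \<gamma> * ?high n x = (2 * pi)\<^sup>2 * (2 * ?low n x + 2 * ?high n x)"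
          by (simp add: \<gamma>_def algebra_simps)
        finally show ?thesis .
      qed
      have "0 \<le> (2 * pi)\<^sup>2 * (2 * ?low n x + 2 * ?high n x)" for n using nn[of n] by simp
      then show "ennreal ((norm (V n x - V m x))\<^sup>2) \<le> G n x + G m x"
        unfolding G using V_diff_le[OF x, of n m p]
        by (subst ennreal_plus[symmetric]) (auto intro: ennreal_leI simp del: ennreal_plus)
    qed
    also have "\<dots> = (\<integral>\<^sup>+ x. G n x \<partial>\<Lambda>) + (\<integral>\<^sup>+ x. G m x \<partial>\<Lambda>)" by (rule nn_integral_add) measurable
    also have "\<dots> \<le> ennreal (e / 2) + ennreal (e / 2)" by (intro add_mono G_int that)
    also have "\<dots> = ennreal e" using e by (simp add: ennreal_plus[symmetric] del: ennreal_plus)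
    finally show ?thesis .
  qed
  then show ?thesis using that by blast
qed

text \<open>Mean-square Cauchy estimates are improved to convergence almost everywhere along a fast
  subsequence, and completeness of \<open>L2x\<close> provides the limit.\<close>

lemma strong_limit:
  obtains r X where "strict_mono (r :: nat \<Rightarrow> nat)" "X \<in> \<Lambda> \<rightarrow>\<^sub>M borel"
    "\<And>x. x \<in> space \<Lambda> \<Longrightarrow> norm (X x) \<le> 2 * pi * sqrt E"
    "AE x in \<Lambda>. (\<lambda>j. V (r j) x) \<longlonglongrightarrow> X x"
    "\<And>j. (\<lambda>x. norm (V (r j) x - X x)) \<in> borel_measurable \<Lambda>"
proof -
  have "\<exists>n0. \<forall>n\<ge>n0. \<forall>m\<ge>n0. (\<integral>\<^sup>+ x. ennreal ((norm (V n x - V m x))\<^sup>2) \<partial>\<Lambda>) \<le> ennreal ((1/8) ^ j)" for j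
    by (rule V_Cauchy[of "(1/8) ^ j"]) auto
  then have "\<exists>n0. \<forall>j. \<forall>n\<ge>n0 j. \<forall>m\<ge>n0 j. (\<integral>\<^sup>+ x. ennreal ((norm (V n x - V m x))\<^sup>2) \<partial>\<Lambda>) \<le> ennreal ((1/8) ^ j)"
    by (intro choice allI)
  then obtain n0 where n0: "\<And>j n m. n \<ge> n0 j \<Longrightarrow> m \<ge> n0 j \<Longrightarrow>
      (\<integral>\<^sup>+ x. ennreal ((norm (V n x - V m x))\<^sup>2) \<partial>\<Lambda>) \<le> ennreal ((1/8) ^ j)"
    by blast
  define r where "r j = j + (\<Sum>i\<le>j. n0 i)" for j
  have r: "strict_mono r" by (auto simp: strict_mono_Suc_iff r_def)
  have r_ge: "n0 j \<le> r j" for j using member_le_sum[of j "{..j}" n0] by (simp add: r_def)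
  have r_Suc: "r j \<le> r (Suc j)" for j by (simp add: r_def)
  define \<delta> where "\<delta> j x = norm (V (r (Suc j)) x - V (r j) x)" for j x
  have [measurable]: "\<delta> j \<in> borel_measurable \<Lambda>" for j unfolding \<delta>_def[abs_def] by (rule V_diff_meas)
  \<comment> \<open>The weights \<open>2 ^ j\<close> against increments of mean square at most
    \<open>(1/8) ^ j\<close> keep the integral finite, and where \<open>H\<close> is finite
    \<open>le_scaled_square\<close> makes the increments summable.\<close>
  define H where "H x = (\<Sum>j. ennreal (2 ^ j) * ennreal ((\<delta> j x)\<^sup>2))" for x
  have H_meas[measurable]: "H \<in> borel_measurable \<Lambda>" unfolding H_def by measurable
  have "(\<integral>\<^sup>+ x. H x \<partial>\<Lambda>) = (\<Sum>j. ennreal (2 ^ j) * (\<integral>\<^sup>+ x. ennreal ((\<delta> j x)\<^sup>2) \<partial>\<Lambda>))"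
    unfolding H_def by (subst nn_integral_suminf) (auto intro!: suminf_cong nn_integral_cmult)
  also have "\<dots> \<le> (\<Sum>j. ennreal ((1/4) ^ j))"
  proof (intro suminf_le)
    fix j
    have "ennreal (2 ^ j) * (\<integral>\<^sup>+ x. ennreal ((\<delta> j x)\<^sup>2) \<partial>\<Lambda>) \<le> ennreal (2 ^ j) * ennreal ((1/8) ^ j)"
      unfolding \<delta>_def by (intro mult_left_mono n0 order_trans[OF r_ge r_Suc] r_ge) simp
    also have "\<dots> = ennreal ((1/4) ^ j)"
      by (subst ennreal_mult'[symmetric]) (simp_all flip: power_mult_distrib)
    finally show "ennreal (2 ^ j) * (\<integral>\<^sup>+ x. ennreal ((\<delta> j x)\<^sup>2) \<partial>\<Lambda>) \<le> ennreal ((1/4) ^ j)" .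
  qed simp_all
  also have "\<dots> = ennreal (4/3)"
    using geometric_sums[of "1/4 :: real"] by (intro suminf_ennreal_eq) auto
  finally have H_int: "(\<integral>\<^sup>+ x. H x \<partial>\<Lambda>) \<noteq> \<infinity>" by (auto simp: top_unique)
  define G where "G = {x \<in> space \<Lambda>. H x \<noteq> \<infinity>}"
  have G[measurable]: "G \<in> sets \<Lambda>" unfolding G_def by measurable
  have AE_G: "AE x in \<Lambda>. x \<in> G"
    using nn_integral_noteq_infinite[OF H_meas H_int] AE_space by eventually_elim (simp add: G_def)
  have conv_G: "convergent (\<lambda>j. V (r j) x)" if "x \<in> G" for x
  proof -
    have "(\<Sum>j. ennreal (2 ^ j * (\<delta> j x)\<^sup>2)) \<noteq> \<top>" using that by (simp add: G_def H_def ennreal_mult')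
    then have "summable (\<lambda>j. 2 ^ j * (\<delta> j x)\<^sup>2)" by (intro summable_suminf_not_top) auto
    then have "summable (\<lambda>j. 2 ^ j * (\<delta> j x)\<^sup>2 + (1/2) ^ j)" by (intro summable_add summable_geometric) auto
    then have "summable (\<lambda>j. norm (V (r (Suc j)) x - V (r j) x))"
    proof (rule summable_comparison_test'[of _ 0])
      fix j
      show "norm (norm (V (r (Suc j)) x - V (r j) x)) \<le> 2 ^ j * (\<delta> j x)\<^sup>2 + (1/2) ^ j"
        using le_scaled_square[of "\<delta> j x" "2 ^ j"] by (simp add: \<delta>_def power_one_over)
    qed
    then have "summable (\<lambda>j. V (r (Suc j)) x - V (r j) x)" by (rule summable_norm_cancel)
    then have "convergent (\<lambda>n. \<Sum>j<n. V (r (Suc j)) x - V (r j) x)" by (simp add: summable_iff_convergent)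
    then have "convergent (\<lambda>n. V (r n) x - V (r 0) x)" by (simp only: sum_lessThan_telescope[of "\<lambda>j. V (r j) x"])
    then have "convergent (\<lambda>n. (V (r n) x - V (r 0) x) + V (r 0) x)" by (intro convergent_add convergent_const)
    then show ?thesis by simp
  qed
  \<comment> \<open>Setting the sequence to zero off \<open>G\<close> makes it converge at every
    point, so \<open>X\<close> is measurable as a pointwise limit and satisfies the norm bound on
    all of the space.\<close>
  define W where "W j x = (if x \<in> G then V (r j) x else 0)" for j x
  define X where "X x = (if x \<in> G then lim (\<lambda>j. V (r j) x) else 0)" for x
  have W_lim: "(\<lambda>j. W j x) \<longlonglongrightarrow> X x" for x
    using conv_G[of x] by (auto simp: W_def X_def convergent_LIMSEQ_iff)
  have W_meas: "W j \<in> \<Lambda> \<rightarrow>\<^sub>M borel" for j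
    unfolding W_def[abs_def] by (intro measurable_If_set V_meas) auto
  have X_meas: "X \<in> \<Lambda> \<rightarrow>\<^sub>M borel" by (rule borel_measurable_LIMSEQ_metric[OF W_meas]) (rule W_lim)
  have X_norm: "norm (X x) \<le> 2 * pi * sqrt E" if "x \<in> space \<Lambda>" for x
  proof (rule Lim_norm_ubound[OF _ W_lim[of x]])
    have "fst x \<in> {0..T}" using that by (auto simp: space_pair_measure space_B)
    then have "norm (W j x) \<le> 2 * pi * sqrt E" for j using norm_U_le E by (auto simp: W_def V_def)
    then show "\<forall>\<^sub>F j in sequentially. norm (W j x) \<le> 2 * pi * sqrt E" by simp
  qed simp
  have X_AE: "AE x in \<Lambda>. (\<lambda>j. V (r j) x) \<longlonglongrightarrow> X x"
    using AE_G
  proof eventually_elim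
    case (elim x)
    then show ?case using W_lim[of x] by (simp add: W_def)
  qed
  \<comment> \<open>The difference with \<open>X\<close> is again approached indirectly: its norm is
    the limit of \<open>norm (V (r j) x - W i x)\<close>, and these are measurable by
    \<open>V_diff_meas\<close>.\<close>
  have D_meas: "(\<lambda>x. norm (V (r j) x - X x)) \<in> borel_measurable \<Lambda>" for j
  proof (rule borel_measurable_LIMSEQ_real)
    show "(\<lambda>i. norm (V (r j) x - W i x)) \<longlonglongrightarrow> norm (V (r j) x - X x)" for x
      by (intro tendsto_intros W_lim)
    show "(\<lambda>x. norm (V (r j) x - W i x)) \<in> borel_measurable \<Lambda>" for i
    proof -
      have "(\<lambda>x. norm (V (r j) x)) \<in> borel_measurable \<Lambda>"
        using measurable_compose[OF V_meas, of norm borel] by (simp add: borel_measurable_continuous_onI continuous_on_norm_id)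
      then have "(\<lambda>x. if x \<in> G then norm (V (r j) x - V (r i) x) else norm (V (r j) x)) \<in> borel_measurable \<Lambda>"
        by (intro measurable_If_set V_diff_meas) auto
      moreover have "(\<lambda>x. norm (V (r j) x - W i x)) = (\<lambda>x. if x \<in> G then norm (V (r j) x - V (r i) x) else norm (V (r j) x))"
        by (auto simp: W_def)
      ultimately show ?thesis by simp
    qed
  qed
  show ?thesis by (rule that[OF r X_meas X_norm X_AE D_meas])
qed

text \<open>\<open>\<mu> t\<close> is the law of the limit field at time t. The time integral of
  \<open>W1\<close> is at most the mean distance between \<open>V (r j)\<close> and \<open>X\<close>
  over \<Lambda>, which vanishes by dominated convergence; the uniform norm bound also gives
  convergence of the energies at almost every time.\<close>

lemma limit_measure:
  obtains r \<mu> where "strict_mono (r :: nat \<Rightarrow> nat)" "\<mu> \<in> L1_prob T"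
    "(\<lambda>j. \<integral>\<^sup>+ t\<in>{0..T}. W1 (empirical_measure (K (r j)) (\<lambda>i. U (r j) i t)) (\<mu> t) \<partial>lborel) \<longlonglongrightarrow> 0"
    "AE t in lborel. t \<in> {0..T} \<longrightarrow> integrable (\<mu> t) (\<lambda>u. (norm u)\<^sup>2) \<and>
      (\<lambda>j. (\<Sum>i<K (r j). (norm (U (r j) i t))\<^sup>2) / real (K (r j))) \<longlonglongrightarrow> (LINT u|\<mu> t. (norm u)\<^sup>2)"
proof -
  obtain r X where r: "strict_mono (r :: nat \<Rightarrow> nat)" and X: "X \<in> \<Lambda> \<rightarrow>\<^sub>M borel"
    and X_norm: "\<And>x. x \<in> space \<Lambda> \<Longrightarrow> norm (X x) \<le> 2 * pi * sqrt E"
    and X_AE: "AE x in \<Lambda>. (\<lambda>j. V (r j) x) \<longlonglongrightarrow> X x"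
    and D_meas: "\<And>j. (\<lambda>x. norm (V (r j) x - X x)) \<in> borel_measurable \<Lambda>"
    using strong_limit by blast
  define \<mu> where "\<mu> t = distr \<Omega> borel (\<lambda>\<omega>. X (t, \<omega>))" for t
  let ?M = "2 * pi * sqrt E"
  have M: "0 \<le> ?M" using E by simp
  have space: "(t, \<omega>) \<in> space \<Lambda>" if "t \<in> {0..T}" "\<omega> \<in> space \<Omega>" for t \<omega>
    using that by (simp add: space_pair_measure space_B)
  have X_t: "(\<lambda>\<omega>. X (t, \<omega>)) \<in> \<Omega> \<rightarrow>\<^sub>M borel" if "t \<in> {0..T}" for t
    using measurable_Pair2[OF X, of t] that by (simp add: space_B)
  have \<mu>_prob: "\<mu> t \<in> borel_probs" if "t \<in> {0..T}" for t
    unfolding \<mu>_def borel_probs_def using prob_space_distr[OF X_t[OF that]] by simp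
  \<comment> \<open>The first entry takes countably many values, and for each of them the pair is a
    continuous function of \<open>X\<close>.\<close>
  have pair_meas: "(\<lambda>\<omega>. (v (I n \<omega>), X (t, \<omega>))) \<in> \<Omega> \<rightarrow>\<^sub>M borel" if "t \<in> {0..T}" for v :: "nat \<Rightarrow> L2x" and n t
  proof (rule measurable_compose_countable[OF _ I_meas])
    fix i
    have "Pair (v i) \<in> (borel :: L2x measure) \<rightarrow>\<^sub>M borel"
      by (intro borel_measurable_continuous_onI continuous_intros)
    from measurable_compose[OF X_t[OF that] this] show "(\<lambda>\<omega>. (v i, X (t, \<omega>))) \<in> \<Omega> \<rightarrow>\<^sub>M borel" .
  qed
  have W1_le: "W1 (empirical_measure (K (r j)) (\<lambda>i. U (r j) i t)) (\<mu> t) \<le> (\<integral>\<^sup>+ \<omega>. ennreal (norm (V (r j) (t, \<omega>) - X (t, \<omega>))) \<partial>\<Omega>)"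
    if t: "t \<in> {0..T}" for j t
  proof -
    have "distr \<Omega> borel (\<lambda>\<omega>. U (r j) (I (r j) \<omega>) t) = empirical_measure (K (r j)) (\<lambda>i. U (r j) i t)"
      by (rule distr_random_index[OF I_meas I_law])
    then show ?thesis
      using W1_le_coupling[OF \<Omega> pair_meas[OF t, of "\<lambda>i. U (r j) i t" "r j"]]
      by (simp add: \<mu>_def V_def dist_norm)
  qed
  have W1_0_le: "W1 (\<mu> t) (return borel 0) \<le> ennreal ?M" if t: "t \<in> {0..T}" for t
  proof -
    have Pair_0: "(\<lambda>u. (u, 0)) \<in> (borel :: L2x measure) \<rightarrow>\<^sub>M (borel :: (L2x \<times> L2x) measure)"
      by (intro borel_measurable_continuous_onI continuous_intros)
    have "return borel 0 = distr \<Omega> borel (\<lambda>_. 0 :: L2x)" by (simp add: distr_const)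
    then have "W1 (\<mu> t) (return borel 0) \<le> (\<integral>\<^sup>+ \<omega>. ennreal (dist (X (t, \<omega>)) 0) \<partial>\<Omega>)"
      unfolding \<mu>_def using W1_le_coupling[OF \<Omega> measurable_compose[OF X_t[OF t] Pair_0]] by simp
    also have "\<dots> \<le> (\<integral>\<^sup>+ \<omega>. ennreal ?M \<partial>\<Omega>)"
      using X_norm[OF space[OF t]] by (intro nn_integral_mono ennreal_leI) simp
    finally show ?thesis by (simp add: emeasure_space_1)
  qed
  have "\<mu> \<in> L1_prob T"
    unfolding L1_prob_def
  proof (intro CollectI conjI ballI allI impI \<mu>_prob)
    fix f :: "L2x \<Rightarrow> real" assume f: "continuous_on UNIV f \<and> bounded (range f)"
    then have f_meas: "f \<in> borel_measurable borel" by (intro borel_measurable_continuous_onI) simp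
    have "(\<lambda>t. LINT \<omega>|\<Omega>. f (X (t, \<omega>))) \<in> borel_measurable B"
      using measurable_compose[OF X f_meas]
      by (intro sigma_finite_measure.borel_measurable_lebesgue_integral[OF \<Omega>_sigma]) (simp add: case_prod_unfold)
    moreover have "(LINT u|\<mu> t. f u) = (LINT \<omega>|\<Omega>. f (X (t, \<omega>)))" if "t \<in> space B" for t
      unfolding \<mu>_def using that by (intro integral_distr X_t f_meas) (simp add: space_B)
    ultimately show "(\<lambda>t. LINT u|\<mu> t. f u) \<in> borel_measurable B"
      using measurable_cong[of B "\<lambda>t. LINT u|\<mu> t. f u" "\<lambda>t. LINT \<omega>|\<Omega>. f (X (t, \<omega>))" borel] by blast
  next
    have "(\<integral>\<^sup>+ t\<in>{0..T}. W1 (\<mu> t) (return borel 0) \<partial>lborel) \<le> (\<integral>\<^sup>+ t\<in>{0..T}. ennreal ?M \<partial>lborel)"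
      using W1_0_le by (intro nn_integral_mono) (simp add: indicator_def)
    also have "\<dots> = ennreal ?M * emeasure lborel {0..T}" by (rule nn_integral_cmult_indicator) simp
    also have "\<dots> < \<infinity>" using T by (simp add: ennreal_mult_less_top)
    finally show "(\<integral>\<^sup>+ t\<in>{0..T}. W1 (\<mu> t) (return borel 0) \<partial>lborel) < \<infinity>" .
  qed
  moreover have "(\<lambda>j. \<integral>\<^sup>+ t\<in>{0..T}. W1 (empirical_measure (K (r j)) (\<lambda>i. U (r j) i t)) (\<mu> t) \<partial>lborel) \<longlonglongrightarrow> 0"
  proof (rule tendsto_sandwich[OF _ _ tendsto_const])
    show "\<forall>\<^sub>F j in sequentially. 0 \<le> (\<integral>\<^sup>+ t\<in>{0..T}. W1 (empirical_measure (K (r j)) (\<lambda>i. U (r j) i t)) (\<mu> t) \<partial>lborel)"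
      by simp
    show "\<forall>\<^sub>F j in sequentially. (\<integral>\<^sup>+ t\<in>{0..T}. W1 (empirical_measure (K (r j)) (\<lambda>i. U (r j) i t)) (\<mu> t) \<partial>lborel) \<le>
      (\<integral>\<^sup>+ x. ennreal (norm (V (r j) x - X x)) \<partial>\<Lambda>)"
    proof (intro always_eventually allI)
      fix j
      have "(\<integral>\<^sup>+ t\<in>{0..T}. W1 (empirical_measure (K (r j)) (\<lambda>i. U (r j) i t)) (\<mu> t) \<partial>lborel) =
        (\<integral>\<^sup>+ t. W1 (empirical_measure (K (r j)) (\<lambda>i. U (r j) i t)) (\<mu> t) \<partial>B)"
        by (rule nn_integral_restrict_space[symmetric]) simp
      also have "\<dots> \<le> (\<integral>\<^sup>+ t. (\<integral>\<^sup>+ \<omega>. ennreal (norm (V (r j) (t, \<omega>) - X (t, \<omega>))) \<partial>\<Omega>) \<partial>B)"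
        using W1_le by (intro nn_integral_mono) (simp add: space_B)
      also have "\<dots> = (\<integral>\<^sup>+ x. ennreal (norm (V (r j) x - X x)) \<partial>\<Lambda>)"
        by (rule sigma_finite_measure.nn_integral_fst[OF \<Omega>_sigma]) (rule measurable_compose[OF D_meas measurable_ennreal])
      finally show "(\<integral>\<^sup>+ t\<in>{0..T}. W1 (empirical_measure (K (r j)) (\<lambda>i. U (r j) i t)) (\<mu> t) \<partial>lborel) \<le>
        (\<integral>\<^sup>+ x. ennreal (norm (V (r j) x - X x)) \<partial>\<Lambda>)" .
    qed
    have "(\<lambda>j. \<integral>\<^sup>+ x. ennreal (norm (V (r j) x - X x)) \<partial>\<Lambda>) \<longlonglongrightarrow> (\<integral>\<^sup>+ x. 0 \<partial>\<Lambda>)"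
    proof (rule nn_integral_dominated_convergence)
      show "(\<lambda>x. ennreal (norm (V (r j) x - X x))) \<in> borel_measurable \<Lambda>" for j
        by (rule measurable_compose[OF D_meas measurable_ennreal])
      show "(\<integral>\<^sup>+ x. ennreal (2 * ?M) \<partial>\<Lambda>) < \<infinity>" using finite_\<Lambda> by (simp add: ennreal_mult_less_top)
      show "AE x in \<Lambda>. ennreal (norm (V (r j) x - X x)) \<le> ennreal (2 * ?M)" for j
      proof (rule AE_I2)
        fix x assume x: "x \<in> space \<Lambda>"
        then have "fst x \<in> {0..T}" by (auto simp: space_pair_measure space_B)
        then have "norm (V (r j) x) \<le> ?M" unfolding V_def by (rule norm_U_le)
        then show "ennreal (norm (V (r j) x - X x)) \<le> ennreal (2 * ?M)"
          using X_norm[OF x] norm_triangle_ineq4[of "V (r j) x" "X x"] by (intro ennreal_leI) linarith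
      qed
      show "AE x in \<Lambda>. (\<lambda>j. ennreal (norm (V (r j) x - X x))) \<longlonglongrightarrow> 0"
        using X_AE
      proof eventually_elim
        case (elim x)
        have "(\<lambda>j. ennreal (norm (V (r j) x - X x))) \<longlonglongrightarrow> ennreal (norm (X x - X x))"
          by (intro tendsto_ennrealI tendsto_intros elim)
        then show ?case by simp
      qed
    qed simp_all
    then show "(\<lambda>j. \<integral>\<^sup>+ x. ennreal (norm (V (r j) x - X x)) \<partial>\<Lambda>) \<longlonglongrightarrow> 0" by simp
  qed
  moreover have "AE t in lborel. t \<in> {0..T} \<longrightarrow> integrable (\<mu> t) (\<lambda>u. (norm u)\<^sup>2) \<and>
      (\<lambda>j. (\<Sum>i<K (r j). (norm (U (r j) i t))\<^sup>2) / real (K (r j))) \<longlonglongrightarrow> (LINT u|\<mu> t. (norm u)\<^sup>2)"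
  proof -
    have sq_meas: "(\<lambda>u :: L2x. (norm u)\<^sup>2) \<in> borel_measurable borel"
      by (intro borel_measurable_continuous_onI continuous_intros)
    \<comment> \<open>Fubini slices the null set of \<Lambda>, so that at almost every single time
      there is convergence almost surely in the sample.\<close>
    have "AE t in B. AE \<omega> in \<Omega>. (\<lambda>j. V (r j) (t, \<omega>)) \<longlonglongrightarrow> X (t, \<omega>)"
      by (rule AE_pair[OF X_AE])
    then have "AE t in B. integrable (\<mu> t) (\<lambda>u. (norm u)\<^sup>2) \<and>
      (\<lambda>j. (\<Sum>i<K (r j). (norm (U (r j) i t))\<^sup>2) / real (K (r j))) \<longlonglongrightarrow> (LINT u|\<mu> t. (norm u)\<^sup>2)"
      using AE_space
    proof eventually_elim
      case (elim t)
      then have t: "t \<in> {0..T}" by (simp add: space_B)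
      have X_sq: "(\<lambda>\<omega>. (norm (X (t, \<omega>)))\<^sup>2) \<in> borel_measurable \<Omega>" by (rule measurable_compose[OF X_t[OF t] sq_meas])
      have "integrable \<Omega> (\<lambda>\<omega>. (norm (X (t, \<omega>)))\<^sup>2)"
        using X_norm[OF space[OF t]] by (intro integrable_const_bound[of _ "?M\<^sup>2"] AE_I2 X_sq) (auto intro!: power_mono)
      then have int: "integrable (\<mu> t) (\<lambda>u. (norm u)\<^sup>2)"
        unfolding \<mu>_def by (subst integrable_distr_eq[OF X_t[OF t] sq_meas])
      have "(\<lambda>j. LINT \<omega>|\<Omega>. (norm (U (r j) (I (r j) \<omega>) t))\<^sup>2) \<longlonglongrightarrow> (LINT \<omega>|\<Omega>. (norm (X (t, \<omega>)))\<^sup>2)"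
      proof (rule integral_dominated_convergence[where w = "\<lambda>_. ?M\<^sup>2"])
        show "(\<lambda>\<omega>. (norm (U (r j) (I (r j) \<omega>) t))\<^sup>2) \<in> borel_measurable \<Omega>" for j
          by (rule measurable_compose[OF I_meas]) simp
        show "AE \<omega> in \<Omega>. (\<lambda>j. (norm (U (r j) (I (r j) \<omega>) t))\<^sup>2) \<longlonglongrightarrow> (norm (X (t, \<omega>)))\<^sup>2"
          using elim(1) by eventually_elim (auto simp: V_def intro!: tendsto_intros)
        show "AE \<omega> in \<Omega>. norm ((norm (U (r j) (I (r j) \<omega>) t))\<^sup>2) \<le> ?M\<^sup>2" for j
          using norm_U_le[OF t] by (intro AE_I2) (auto intro!: power_mono)
      qed (auto simp: X_sq)
      moreover have "(LINT u|\<mu> t. (norm u)\<^sup>2) = (LINT \<omega>|\<Omega>. (norm (X (t, \<omega>)))\<^sup>2)"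
        unfolding \<mu>_def by (rule integral_distr[OF X_t[OF t] sq_meas])
      moreover have "(LINT \<omega>|\<Omega>. (norm (U (r j) (I (r j) \<omega>) t))\<^sup>2) = (\<Sum>i<K (r j). (norm (U (r j) i t))\<^sup>2) / real (K (r j))" for j
        by (rule integral_random_index[OF I_meas I_law])
      ultimately show ?case using int by simp
    qed
    then show ?thesis by (subst (asm) AE_restrict_space_iff) auto
  qed
  ultimately show ?thesis using that[OF r] by blast
qed

end

section \<open>The convergence theorem\<close>

theorem theorem3p2:
  fixes T M \<epsilon> C \<alpha> :: real
    and \<mu>bar :: "L2x measure"
    and m :: "nat \<Rightarrow> real" and Q :: "nat \<Rightarrow> int^2 \<Rightarrow> real"
    and J :: "nat \<Rightarrow> L2x \<Rightarrow> L2x" and S :: "nat \<Rightarrow> real \<Rightarrow> L2x \<Rightarrow> L2x"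
    and P :: "'w measure" and K :: "nat \<Rightarrow> nat" and X :: "nat \<Rightarrow> nat \<Rightarrow> 'w \<Rightarrow> L2x" and \<omega> :: 'w
    and \<mu>\<Delta> :: "nat \<Rightarrow> real \<Rightarrow> L2x measure"
  assumes T: "T > 0"
    (* initial data *)
    and init: "\<mu>bar \<in> borel_probs" "AE u in \<mu>bar. admissible u"
    and M: "M > 0" "emeasure \<mu>bar (ball 0 M) = 1"
    (* spectral viscosity scheme *)
    and params: "SV_parameters \<epsilon> m Q"
    and J: "discretization J"
    and S: "SV_solution_map T \<epsilon> Q J S"
    (* i.i.d. samples *)
    and K: "filterlim K at_top sequentially" "\<And>N. N \<ge> 1 \<Longrightarrow> K N > 0"
    and P: "prob_space P"
    and indep: "\<And>N. N \<ge> 1 \<Longrightarrow> prob_space.indep_vars P (\<lambda>_. borel) (X N) {..<K N}"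
    and ident: "\<And>N i. N \<ge> 1 \<Longrightarrow> i < K N \<Longrightarrow> distr P borel (X N i) = \<mu>bar"
    (* the fixed realisation *)
    and \<omega>: "\<omega> \<in> space P"
    and samples: "\<And>N i. N \<ge> 1 \<Longrightarrow> i < K N \<Longrightarrow> admissible (X N i \<omega>)"
    and samples_ball: "\<And>N i. N \<ge> 1 \<Longrightarrow> i < K N \<Longrightarrow> S N 0 (X N i \<omega>) \<in> ball 0 M"
    and \<mu>\<Delta>_def: "\<And>N t. \<mu>\<Delta> N t = empirical_measure (K N) (\<lambda>i. S N t (X N i \<omega>))"
    and weak: "weakly_converges (\<lambda>N. \<mu>\<Delta> N 0) \<mu>bar"
    (* uniform decay of the structure functions *)
    and C: "C > 0" and \<alpha>: "0 < \<alpha>" "\<alpha> < 1"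
    and S2_bound: "\<And>N r. N \<ge> 1 \<Longrightarrow> r > 0 \<Longrightarrow> (SUP t\<in>{0..T}. S2 (\<mu>\<Delta> N t) r) \<le> ennreal (C * r powr \<alpha>)"
  shows "\<exists>(s :: nat \<Rightarrow> nat) \<mu>. strict_mono s \<and> s 0 \<ge> 1 \<and> \<mu> \<in> L1_prob T \<and>
           ((\<lambda>k. \<integral>\<^sup>+ t\<in>{0..T}. W1 (\<mu>\<Delta> (s k) t) (\<mu> t) \<partial>lborel) \<longlonglongrightarrow> 0) \<and>
           energy_conservative T \<mu>"
proof -
  have S2_t: "S2 (empirical_measure (K N) (\<lambda>i. S N t (X N i \<omega>))) r \<le> ennreal (C * r powr \<alpha>)"
    if "N \<ge> 1" "r > 0" "t \<in> {0..T}" for N r t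
    unfolding \<mu>\<Delta>_def[symmetric] by (rule order_trans[OF SUP_upper[OF that(3)] S2_bound[OF that(1,2)]])
  have init_norm: "norm (S N 0 (X N i \<omega>)) < M" if "N \<ge> 1" "i < K N" for N i
    using samples_ball[OF that] by simp
  obtain c L A q where
    sol: "\<And>N i t. N \<ge> 1 \<Longrightarrow> i < K N \<Longrightarrow> t \<in> {0..T} \<Longrightarrow> S N t (X N i \<omega>) = L2_class (trig (modes N) (c N i t))"
    and herm: "\<And>N i t. N \<ge> 1 \<Longrightarrow> i < K N \<Longrightarrow> hermitian (c N i t)"
    and supp: "\<And>N i t k. N \<ge> 1 \<Longrightarrow> i < K N \<Longrightarrow> k \<notin> modes N \<Longrightarrow> c N i t k = 0"
    and energy: "\<And>N i t. N \<ge> 1 \<Longrightarrow> i < K N \<Longrightarrow> t \<in> {0..T} \<Longrightarrow> (\<Sum>k\<in>modes N. (norm (c N i t k))\<^sup>2) \<le> (M / (2 * pi))\<^sup>2"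
    and lip: "\<And>N i s t k. N \<ge> 1 \<Longrightarrow> i < K N \<Longrightarrow> s \<in> {0..T} \<Longrightarrow> t \<in> {0..T} \<Longrightarrow> norm (c N i t k - c N i s k) \<le> L k * \<bar>t - s\<bar>"
    and q: "0 < q" "q < 1"
    and tail: "\<And>N n t. N \<ge> 1 \<Longrightarrow> t \<in> {0..T} \<Longrightarrow>
      (\<Sum>i<K N. \<Sum>k\<in>{k\<in>modes N. 2 ^ n < norm (wave k)}. (norm (c N i t k))\<^sup>2) / real (K N) \<le> A * q ^ n"
    and diss: "\<And>t1 t2. 0 < t1 \<Longrightarrow> t1 \<le> t2 \<Longrightarrow> t2 \<le> T \<Longrightarrow>
      (\<lambda>N. (\<Sum>i<K N. \<Sum>k\<in>modes N. (norm (c N i t1 k))\<^sup>2) / real (K N) -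
        (\<Sum>i<K N. \<Sum>k\<in>modes N. (norm (c N i t2 k))\<^sup>2) / real (K N)) \<longlonglongrightarrow> 0"
    by (rule sv_ensemble_coefficients[OF T params S K(2) samples init_norm C \<alpha> S2_t], assumption+) (rule that; assumption)
  define E where "E = (M / (2 * pi))\<^sup>2"
  \<comment> \<open>Resolutions start at 1, hence \<open>Suc n\<close>. Indices beyond the samples
    get zero coefficients because the locale assumptions range over every i.\<close>
  define c' where "c' n i t k = (if i < K (Suc n) then c (Suc n) i t k else 0)" for n i t k
  interpret ens: trig_ensemble T E A q Suc "\<lambda>n. K (Suc n)" c' "\<lambda>k. \<bar>L k\<bar>"
  proof
    show "hermitian (c' n i t)" for n i t using herm[of "Suc n" i t] by (simp add: c'_def hermitian_def)
    show "k \<notin> modes (Suc n) \<Longrightarrow> c' n i t k = 0" for n i t k using supp[of "Suc n" i k t] by (simp add: c'_def)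
    show "t \<in> {0..T} \<Longrightarrow> (\<Sum>k\<in>modes (Suc n). (norm (c' n i t k))\<^sup>2) \<le> E" for n i t
      using energy[of "Suc n" i t] by (cases "i < K (Suc n)") (simp_all add: c'_def E_def)
    show "norm (c' n i t k - c' n i s k) \<le> \<bar>L k\<bar> * \<bar>t - s\<bar>" if "s \<in> {0..T}" "t \<in> {0..T}" for n i s t k
    proof (cases "i < K (Suc n)")
      case True
      have "L k * \<bar>t - s\<bar> \<le> \<bar>L k\<bar> * \<bar>t - s\<bar>" by (intro mult_right_mono) auto
      from order_trans[OF lip[OF _ True that, of k] this] show ?thesis using True by (simp add: c'_def)
    qed (simp add: c'_def)
    show "(\<Sum>i<K (Suc n). \<Sum>k\<in>{k \<in> modes (Suc n). 2 ^ p < norm (wave k)}. (norm (c' n i t k))\<^sup>2) / real (K (Suc n)) \<le> A * q ^ p"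
      if "t \<in> {0..T}" for n p t
      using tail[OF _ that, of "Suc n" p] by (simp add: c'_def)
  qed (use T K(2) q in \<open>auto simp: E_def\<close>)
  obtain s and \<Omega> :: "real measure" and I where s: "strict_mono s" and \<Omega>: "prob_space \<Omega>"
    and I: "\<And>n. I n \<in> \<Omega> \<rightarrow>\<^sub>M count_space UNIV"
    and I_law: "\<And>n. distr \<Omega> (count_space UNIV) (I n) = distr (uniform_count_measure {..<K (Suc (s n))}) (count_space UNIV) (\<lambda>i. i)"
    and conv: "AE \<omega> in \<Omega>. \<forall>t\<in>{0..T}. \<forall>k. convergent (\<lambda>n. c' (s n) (I n \<omega>) t k)"
    by (rule ens.convergent_random_subsequence) (rule that; assumption)
  interpret sub: random_trig_ensemble T E A q "\<lambda>n. Suc (s n)" "\<lambda>n. K (Suc (s n))" "\<lambda>n. c' (s n)" "\<lambda>k. \<bar>L k\<bar>" \<Omega> I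
  proof (intro random_trig_ensemble.intro random_trig_ensemble_axioms.intro)
    show "trig_ensemble T E A q (\<lambda>n. Suc (s n)) (\<lambda>n. K (Suc (s n))) (\<lambda>n. c' (s n)) (\<lambda>k. \<bar>L k\<bar>)"
      by unfold_locales (fact ens.T ens.E ens.K ens.q ens.herm ens.supp ens.energy ens.lip ens.tail)+
  qed (fact \<Omega> I I_law conv)+
  obtain r \<mu> where r: "strict_mono (r :: nat \<Rightarrow> nat)" and \<mu>: "\<mu> \<in> L1_prob T"
    and W1_lim: "(\<lambda>j. \<integral>\<^sup>+ t\<in>{0..T}. W1 (empirical_measure (K (Suc (s (r j)))) (\<lambda>i. sub.U (r j) i t)) (\<mu> t) \<partial>lborel) \<longlonglongrightarrow> 0"
    and energy_lim: "AE t in lborel. t \<in> {0..T} \<longrightarrow> integrable (\<mu> t) (\<lambda>u. (norm u)\<^sup>2) \<and>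
      (\<lambda>j. (\<Sum>i<K (Suc (s (r j))). (norm (sub.U (r j) i t))\<^sup>2) / real (K (Suc (s (r j))))) \<longlonglongrightarrow> (LINT u|\<mu> t. (norm u)\<^sup>2)"
    by (rule sub.limit_measure) (rule that; assumption)
  \<comment> \<open>The composite of two extractions: \<open>s\<close> from the Skorohod
    representation and \<open>r\<close> from convergence almost everywhere. The shift keeps every
    resolution at least 1.\<close>
  define \<sigma> where "\<sigma> j = Suc (s (r j))" for j
  have \<sigma>: "strict_mono \<sigma>" using s r by (auto simp: strict_mono_def \<sigma>_def)
  have U: "sub.U (r j) i t = S (\<sigma> j) t (X (\<sigma> j) i \<omega>)" if "i < K (\<sigma> j)" "t \<in> {0..T}" for i j t
  proof -
    have "c' (s (r j)) i t = c (\<sigma> j) i t" using that by (simp add: c'_def[abs_def] \<sigma>_def)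
    then show ?thesis using that sol[of "\<sigma> j" i t] by (simp add: sub.U_def \<sigma>_def)
  qed
  have "(\<lambda>k. \<integral>\<^sup>+ t\<in>{0..T}. W1 (\<mu>\<Delta> (\<sigma> k) t) (\<mu> t) \<partial>lborel) \<longlonglongrightarrow> 0"
  proof -
    have "\<mu>\<Delta> (\<sigma> j) t = empirical_measure (K (Suc (s (r j)))) (\<lambda>i. sub.U (r j) i t)" if "t \<in> {0..T}" for j t
      unfolding \<mu>\<Delta>_def empirical_measure_def \<sigma>_def[symmetric] using U that
      by (intro distr_cong refl) (simp add: space_uniform_count_measure)
    then have "(\<integral>\<^sup>+ t\<in>{0..T}. W1 (\<mu>\<Delta> (\<sigma> j) t) (\<mu> t) \<partial>lborel) =
      (\<integral>\<^sup>+ t\<in>{0..T}. W1 (empirical_measure (K (Suc (s (r j)))) (\<lambda>i. sub.U (r j) i t)) (\<mu> t) \<partial>lborel)" for j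
      by (intro nn_integral_cong) (simp add: indicator_def)
    then show ?thesis using W1_lim by simp
  qed
  moreover have "energy_conservative T \<mu>"
  proof -
    define e where "e j t = (\<Sum>i<K (\<sigma> j). (norm (sub.U (r j) i t))\<^sup>2) / real (K (\<sigma> j))" for j t
    define F where "F t = (LINT u|\<mu> t. (norm u)\<^sup>2)" for t
    have e_eq: "e j t = (2 * pi)\<^sup>2 * ((\<Sum>i<K (\<sigma> j). \<Sum>k\<in>modes (\<sigma> j). (norm (c (\<sigma> j) i t k))\<^sup>2) / real (K (\<sigma> j)))" for j t
      unfolding e_def sub.norm_U by (simp add: \<sigma>_def c'_def sum_distrib_left)
    have e_diff: "(\<lambda>j. e j t1 - e j t2) \<longlonglongrightarrow> 0" if t: "0 < t1" "t1 \<le> t2" "t2 \<le> T" for t1 t2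
      using tendsto_mult_left[OF LIMSEQ_subseq_LIMSEQ[OF diss[OF t] \<sigma>], of "(2 * pi)\<^sup>2"]
      by (simp add: e_eq comp_def right_diff_distrib)
    \<comment> \<open>Time 0 is left out because \<open>diss\<close> needs a positive first time; a
      single point does not affect a statement about almost every t.\<close>
    define good where "good t \<longleftrightarrow> t \<in> {0<..T} \<and> integrable (\<mu> t) (\<lambda>u. (norm u)\<^sup>2) \<and> (\<lambda>j. e j t) \<longlonglongrightarrow> F t" for t
    have AE_good: "AE t in lborel. t \<in> {0..T} \<longrightarrow> good t"
      using energy_lim AE_lborel_singleton[of 0]
      by eventually_elim (auto simp: good_def e_def F_def \<sigma>_def)
    have F_eq: "F t1 = F t2" if "good t1" "good t2" "t1 \<le> t2" for t1 t2
    proof -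
      have "(\<lambda>j. e j t1 - e j t2) \<longlonglongrightarrow> F t1 - F t2" using that by (intro tendsto_diff) (auto simp: good_def)
      moreover have "(\<lambda>j. e j t1 - e j t2) \<longlonglongrightarrow> 0" using that by (intro e_diff) (auto simp: good_def)
      ultimately show ?thesis using LIMSEQ_unique by fastforce
    qed
    \<comment> \<open>The interval has positive length, so some good time exists; its energy serves
      as the constant.\<close>
    have "\<exists>t0. good t0"
    proof (rule ccontr)
      assume "\<nexists>t0. good t0"
      then have "AE t in lborel. t \<notin> {0..T}" using AE_good by simp
      then have "{0..T} \<in> null_sets lborel" by (subst AE_iff_null_sets) auto
      then show False using T by (simp add: null_sets_def)
    qed
    then obtain t0 where t0: "good t0" by blast
    have "AE t in lborel. t \<in> {0..T} \<longrightarrow> integrable (\<mu> t) (\<lambda>u. (norm u)\<^sup>2) \<and> F t = F t0"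
      using AE_good
    proof eventually_elim
      case (elim t)
      show ?case
      proof
        assume "t \<in> {0..T}"
        then have t: "good t" using elim by simp
        have "F t = F t0"
        proof (rule linorder_le_cases[of t t0])
          show "t \<le> t0 \<Longrightarrow> F t = F t0" by (rule F_eq[OF t t0])
          show "t0 \<le> t \<Longrightarrow> F t = F t0" by (rule F_eq[OF t0 t, symmetric])
        qed
        moreover have "integrable (\<mu> t) (\<lambda>u. (norm u)\<^sup>2)" using t unfolding good_def by blast
        ultimately show "integrable (\<mu> t) (\<lambda>u. (norm u)\<^sup>2) \<and> F t = F t0" by blast
      qed
    qed
    then show ?thesis unfolding energy_conservative_def F_def by blast
  qed
  moreover have "\<sigma> 0 \<ge> 1" by (simp add: \<sigma>_def)
  ultimately show ?thesis using \<sigma> \<mu> by blast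
qed

end
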